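(* Let $n\in\{3,4\}$, $\frac{n-2}{n+2}\le m<\frac{n-2}{n}$, $$\gamma_2=\frac{1-m}{2m}\left(n-\frac{2}{1-m}\right),$$ $\beta<0$ and $\alpha=\frac{2\beta}{1-m}$. Let $\lambda_1>\lambda_2>0$, $\lambda_3>0$, and let $f_{\lambda_i}$, $U_{\lambda_i}$, $i=1,2,3$, be as defined in the context. Let $u_{0,1},u_{0,2}$ satisfy $$f_{\lambda_1}(x)\le u_{0,i}(x)\le f_{\lambda_2}(x)\quad\text{in }\mathbb{R}^n\setminus\{0\},\quad i=1,2,$$ $$u_{0,1}-u_{0,2}\in L^1\left(f_{\lambda_3}^{m\gamma_2};\mathbb{R}^n\setminus\{0\}\right),$$ and let $u_1,u_2$ be solutions of $$u_t=\frac{n-1}{m}\Delta u^m\ \text{ in }(\mathbb{R}^n\setminus\{0\})\times(0,\infty),\qquad u(\cdot,0)=u_0\ \text{ in }\mathbb{R}^n\setminus\{0\}$$ with initial values $u_0=u_{0,1},u_{0,2}$, respectively, which satisfy $$U_{\lambda_1}(x,t)\le u_i(x,t)\le U_{\lambda_2}(x,t)\quad\text{in }(\mathbb{R}^n\setminus\{0\})\times(0,\infty),\quad i=1,2.$$ Then $$\int_{\mathbb{R}^n\setminus\{0\}}|u_1-u_2|(x,t)f_{\lambda_3}^{m\gamma_2}(x)\,dx\le\int_{\mathbb{R}^n\setminus\{0\}}|u_{0,1}-u_{0,2}|(x)f_{\lambda_3}^{m\gamma_2}(x)\,dx\quad\forall t>0.$$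
   Context: Self-similar functions. Given $\beta<0$ and $\alpha=\frac{2\beta}{1-m}$, let $f_1$ be the unique positive solution on $(0,\infty)$ of $\frac{n-1}{m}\left((f^m)_{rr}+\frac{n-1}{r}(f^m)_r\right)+\alpha f+\beta r f_r=0$ with $\lim_{r\to\infty}r^{\frac{n-2}{m}}f(r)=1$ (it exists and is unique), regarded also as the radial function $f_1(x)=f_1(|x|)$. For $\lambda>0$ put $f_\lambda(x)=\lambda^{\frac{2}{1-m}}f_1(\lambda x)$, $x\in\mathbb{R}^n\setminus\{0\}$, and $U_\lambda(x,t)=e^{-\alpha t}f_\lambda(e^{-\beta t}x)$, $x\in\mathbb{R}^n\setminus\{0\}$, $t\in\mathbb{R}$. Solutions. For $0\le u_0\in L^1_{\rm loc}(\mathbb{R}^n\setminus\{0\})$, a solution of the Cauchy problem is a function $u>0$ in $(\mathbb{R}^n\setminus\{0\})\times(0,\infty)$ satisfying $u_t=\frac{n-1}{m}\Delta u^m$ there in the classical sense and $\|u(\cdot,t)-u_0\|_{L^1(K)}\to0$ as $t\to0$ for any compact $K\subset\mathbb{R}^n\setminus\{0\}$. Weighted space. For $k:\mathbb{R}^n\setminus\{0\}\to[0,\infty)$, $L^1(k;\mathbb{R}^n\setminus\{0\})=\{h\in L^1_{\rm loc}(\mathbb{R}^n\setminus\{0\}):\int_{\mathbb{R}^n\setminus\{0\}}|h|k\,dx<\infty\}$. *)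

theory Defs
  imports "HOL-Analysis.Analysis"
begin

text \<open>
  The punctured space \<open>- {0}\<close> plays the role of \<open>\<real>\<^sup>n\<close> minus the origin, with \<open>n = CARD('n)\<close>;
  values of functions at the origin never matter.
\<close>

text \<open>
  \<open>f\<close> solves the radial profile equation on \<open>r > 0\<close> and is normalised at infinity; \<open>g1\<close> and \<open>g2\<close>
  are the first two derivatives of \<open>f\<^sup>m\<close>. For such \<open>f\<close> the equation forces \<open>g2\<close> to be continuous,
  so this describes the classical solutions of class \<open>C\<^sup>2\<close>. Only the values of \<open>f\<close> at positive
  arguments are constrained.
\<close>

definition self_similar_profile ::
    "nat \<Rightarrow> real \<Rightarrow> real \<Rightarrow> real \<Rightarrow> (real \<Rightarrow> real) \<Rightarrow> bool" where
  "self_similar_profile n m \<alpha> \<beta> f \<longleftrightarrow>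
     (\<forall>r>0. f r > 0) \<and>
     (\<exists>f1 g1 g2. \<forall>r>0.
        (f has_real_derivative f1 r) (at r) \<and>
        ((\<lambda>s. f s powr m) has_real_derivative g1 r) (at r) \<and>
        (g1 has_real_derivative g2 r) (at r) \<and>
        (real n - 1) / m * (g2 r + (real n - 1) / r * g1 r) + \<alpha> * f r + \<beta> * r * f1 r = 0) \<and>
     ((\<lambda>r. r powr ((real n - 2) / m) * f r) \<longlongrightarrow> 1) at_top"

definition scaled_profile ::
    "real \<Rightarrow> (real \<Rightarrow> real) \<Rightarrow> real \<Rightarrow> real^'n \<Rightarrow> real" where
  "scaled_profile m f1 l x = l powr (2 / (1 - m)) * f1 (norm (l *\<^sub>R x))"

definition self_similar_solution ::
    "real \<Rightarrow> real \<Rightarrow> real \<Rightarrow> (real \<Rightarrow> real) \<Rightarrow> real \<Rightarrow> real^'n \<Rightarrow> real \<Rightarrow> real" where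
  "self_similar_solution m \<alpha> \<beta> f1 l x t =
     exp (- \<alpha> * t) * scaled_profile m f1 l (exp (- \<beta> * t) *\<^sub>R x)"

definition laplacian :: "(real^'n \<Rightarrow> real) \<Rightarrow> real^'n \<Rightarrow> real" where
  "laplacian g x = (\<Sum>b\<in>Basis. (deriv ^^ 2) (\<lambda>s. g (x + s *\<^sub>R b)) 0)"

text \<open>
  Class \<open>C\<close> with indices 2 in space and 1 in time, on an open set of space-time: \<open>ut\<close> is the time
  derivative, \<open>D\<close> the spatial gradient and \<open>H\<close> the spatial Hessian, all jointly continuous.
\<close>

definition C21_on :: "((real^'n) \<times> real) set \<Rightarrow> (real^'n \<Rightarrow> real \<Rightarrow> real) \<Rightarrow> bool" where
  "C21_on S u \<longleftrightarrow>
     (\<exists>(ut :: (real^'n) \<times> real \<Rightarrow> real) (D :: (real^'n) \<times> real \<Rightarrow> real^'n)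
        (H :: (real^'n) \<times> real \<Rightarrow> real^'n^'n).
        (\<forall>x t. (x, t) \<in> S \<longrightarrow>
           (u x has_real_derivative ut (x, t)) (at t) \<and>
           ((\<lambda>y. u y t) has_derivative (\<lambda>h. D (x, t) \<bullet> h)) (at x) \<and>
           ((\<lambda>y. D (y, t)) has_derivative (\<lambda>h. H (x, t) *v h)) (at x)) \<and>
        continuous_on S ut \<and> continuous_on S D \<and> continuous_on S H)"

definition L1_loc_punctured :: "(real^'n \<Rightarrow> real) set" where
  "L1_loc_punctured = {h. \<forall>K. compact K \<and> K \<subseteq> - {0} \<longrightarrow> h absolutely_integrable_on K}"

text \<open>
  Integrals over the punctured space are taken in \<open>[0, \<infinity>]\<close>, so that no value is assigned to a
  divergent integral by convention.
\<close>

definition weighted_norm :: "(real^'n \<Rightarrow> real) \<Rightarrow> (real^'n \<Rightarrow> real) \<Rightarrow> ennreal" where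
  "weighted_norm k h = (\<integral>\<^sup>+x\<in>- {0}. ennreal (\<bar>h x\<bar> * k x) \<partial>lebesgue)"

definition L1_weighted :: "(real^'n \<Rightarrow> real) \<Rightarrow> (real^'n \<Rightarrow> real) set" where
  "L1_weighted k = {h \<in> L1_loc_punctured. weighted_norm k h < \<infinity>}"

definition classical_solution :: "real \<Rightarrow> (real^'n \<Rightarrow> real \<Rightarrow> real) \<Rightarrow> bool" where
  "classical_solution m u \<longleftrightarrow>
     C21_on ((- {0}) \<times> {0<..}) u \<and>
     (\<forall>x t. x \<noteq> 0 \<and> t > 0 \<longrightarrow>
        (u x has_real_derivative
          (real CARD('n) - 1) / m * laplacian (\<lambda>y. u y t powr m) x) (at t))"

definition cauchy_solution ::
    "real \<Rightarrow> (real^'n \<Rightarrow> real) \<Rightarrow> (real^'n \<Rightarrow> real \<Rightarrow> real) \<Rightarrow> bool" where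
  "cauchy_solution m u0 u \<longleftrightarrow>
     (\<forall>x. x \<noteq> 0 \<longrightarrow> 0 \<le> u0 x) \<and> u0 \<in> L1_loc_punctured \<and>
     (\<forall>x t. x \<noteq> 0 \<and> t > 0 \<longrightarrow> u x t > 0) \<and>
     classical_solution m u \<and>
     (\<forall>K. compact K \<and> K \<subseteq> - {0} \<longrightarrow>
        ((\<lambda>t. \<integral>\<^sup>+x\<in>K. ennreal \<bar>u x t - u0 x\<bar> \<partial>lebesgue) \<longlongrightarrow> 0) (at_right 0))"

end

(*
  Write rho = ln |x|, d = n - 2, p = 2m/(1-m); the hypotheses on m say d/2 <= p < d. For
  V(rho) = f(e^rho)^m the profile equation becomes V'' + d V' = c (V' + p V) with c > 0, so every
  critical point of e^(p rho) V is a strict minimum. As this function tends to 0 it is decreasing;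
  hence V' <= -p V, V is superharmonic, and -d V <= V', V <= e^(-d rho). The weight is a multiple
  of a translate of V^gamma with 0 < gamma <= 1, hence superharmonic too.

  For delta = u1 - u2 and a = u1^m - u2^m Kato's inequality bounds the time derivative of the
  integral of |delta| psi by that of (n-1)/m |a| Laplace(psi) + |delta| psi_t. Take
  psi = weight * exp(-E (1 + rho^2)) * bump(rho/k) with E = eps e^(Mt). Only derivatives of the
  cutoff contribute. The barriers give |a| <= C r^2 |delta| near 0, so that psi_t absorbs the terms
  of order E there, and |a| <= C r^(-d) everywhere, which makes the terms of order E away from 0 and
  all terms of order 1/k small: a Gaussian in rho beats every power of r. Then k -> infinity and
  eps -> 0.
*)
theory Submission
  imports Defs
begin

text \<open>Since \<open>\<gamma>\<^sub>2\<close> = d/p - 1, the range of m amounts to 0 <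
  \<open>\<gamma>\<^sub>2\<close> \<le> 1, and a concave increasing power of a positive
  superharmonic function is again superharmonic. The obstacle is the origin. The Laplacian of a
  cutoff carries r^(-2), so the bound of |a| by r^(-d) leads to r^(-N) with N = n + d
  \<open>\<gamma>\<^sub>2\<close> > n: integrable at infinity, not at 0. The bound of |a| by r^2
  |\<delta>| cancels r^(-2), but then needs |\<delta>| times the weight to be integrable near 0 at
  positive times, which is part of the claim. The factor exp (-E (1 + \<rho>^2)) breaks the circle
  in the manner of Gronwall: its space derivatives cost a multiple of E (1 + \<rho>^2) times the
  factor itself, its time derivative gains M E (1 + \<rho>^2) times the factor, so one large M wins
  for every E \<le> 1. The power r^2 comes from the mean value theorem: |a| is m u^(m-1) |\<delta>|
  at an intermediate value u, where u^m is at least a multiple of r^(-p), and p (1 - m)/m = 2. For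
  fixed \<epsilon> the same factor makes r^(-N) integrable, so the bump only keeps supports
  compact.\<close>

section \<open>The profile in logarithmic coordinates\<close>

text \<open>A point y with \<open>q1 y\<close> nonnegative lets q climb above \<open>q y\<close>;
  since q later falls below that value again, it attains an interior maximum on some [y, R]. That
  maximum is a critical point, and by \<open>conv\<close> q increases to its right, a
  contradiction.\<close>

lemma neg_derivative_of_convex_critical_points:
  fixes q q1 q2 :: "real \<Rightarrow> real"
  assumes d1: "\<And>x. (q has_real_derivative q1 x) (at x)"
    and d2: "\<And>x. (q1 has_real_derivative q2 x) (at x)"
    and conv: "\<And>x. q1 x = 0 \<Longrightarrow> q2 x > 0"
    and pos: "\<And>x. q x > 0"
    and lim: "(q \<longlongrightarrow> 0) at_top"
  shows "q1 x < 0"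
proof -
  have nomax: False if crit: "q1 y \<ge> 0" for y
  proof -
    obtain e where e: "e > 0" "\<And>h. 0 < h \<Longrightarrow> h < e \<Longrightarrow> q y < q (y + h)"
    proof (cases "q1 y = 0")
      case False
      with crit have "q1 y > 0" by simp
      from DERIV_pos_inc_right[OF d1 this] that show ?thesis by blast
    next
      case True
      from DERIV_pos_inc_right[OF d2 conv[OF True]] True
      obtain e where e: "e > 0" "\<And>h. 0 < h \<Longrightarrow> h < e \<Longrightarrow> 0 < q1 (y + h)" by auto
      have "q y < q (y + h)" if h: "0 < h" "h < e" for h
      proof (rule DERIV_pos_imp_increasing_open[where f = q])
        fix z assume "y < z" "z < y + h"
        with e(2)[of "z - y"] h have "0 < q1 z" by simp
        with d1 show "\<exists>l. DERIV q z :> l \<and> 0 < l" by blast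
      qed (use h d1 in \<open>auto intro!: DERIV_isCont continuous_at_imp_continuous_on\<close>)
      with e that show ?thesis by blast
    qed
    \<comment> \<open>The higher value at z is what excludes y itself as the place of the
      maximum.\<close>
    define z where "z = y + e / 2"
    have z: "y < z" "q y < q z" using e(1) e(2)[of "e/2"] by (auto simp: z_def)
    from lim pos[of y] have "eventually (\<lambda>x. q x < q y) at_top" by (rule order_tendstoD)
    moreover have "eventually (\<lambda>x. x > z) at_top" by (rule eventually_gt_at_top)
    ultimately have "eventually (\<lambda>x. q x < q y \<and> x > z) at_top" by eventually_elim simp
    then obtain R where R: "q R < q y" "z < R"
      unfolding eventually_at_top_linorder by blast
    have cont: "continuous_on {y..R} q"
      using d1 by (auto intro!: DERIV_isCont continuous_at_imp_continuous_on)
    obtain M where M: "M \<in> {y..R}" "\<And>x. x \<in> {y..R} \<Longrightarrow> q x \<le> q M"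
      using continuous_attains_sup[OF _ _ cont] z R by auto
    have qM: "q M > q y" using M(2)[of z] z R by auto
    then have MM: "y < M" "M < R" using M(1) R by (auto simp: less_le)
    define \<delta> where "\<delta> = min (M - y) (R - M)"
    have \<delta>: "\<delta> > 0" using MM by (simp add: \<delta>_def)
    have "q1 M = 0"
      by (rule DERIV_local_max[OF d1 \<delta>]) (use M(2) in \<open>auto simp: \<delta>_def abs_less_iff\<close>)
    from DERIV_pos_inc_right[OF d2 conv[OF this]] this
    obtain e' where e': "e' > 0" "\<And>h. 0 < h \<Longrightarrow> h < e' \<Longrightarrow> 0 < q1 (M + h)" by auto
    define h where "h = min (e'/2) (\<delta>/2)"
    have h: "0 < h" "h < e'" "h < \<delta>" using e' \<delta> by (auto simp: h_def)
    have "q M < q (M + h)"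
    proof (rule DERIV_pos_imp_increasing_open[where f = q])
      fix z assume "M < z" "z < M + h"
      with e'(2)[of "z - M"] h have "0 < q1 z" by simp
      with d1 show "\<exists>l. DERIV q z :> l \<and> 0 < l" by blast
    qed (use h d1 in \<open>auto intro!: DERIV_isCont continuous_at_imp_continuous_on\<close>)
    moreover have "q (M + h) \<le> q M" using M(2)[of "M + h"] h MM by (auto simp: \<delta>_def)
    ultimately show False by simp
  qed
  show ?thesis using nomax[of x] by force
qed

text \<open>The left side of the equation annihilates exp (-d x), the bracket on the right
  annihilates exp (-p x). Accordingly exp (p x) V decreases and exp (d x) V increases; the
  conclusions express these two monotonicities, the sign they give to the right side, and the
  limit.\<close>

lemma profile_ode_bounds:
  fixes V V1 V2 c :: "real \<Rightarrow> real" and p d :: real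
  assumes d1: "\<And>x. (V has_real_derivative V1 x) (at x)"
    and d2: "\<And>x. (V1 has_real_derivative V2 x) (at x)"
    and pos: "\<And>x. V x > 0"
    and ode: "\<And>x. V2 x + d * V1 x = c x * (V1 x + p * V x)"
    and c: "\<And>x. c x > 0"
    and pd: "0 < p" "p < d"
    and lim: "((\<lambda>x. exp (d * x) * V x) \<longlongrightarrow> 1) at_top"
  shows "V1 x \<le> - p * V x" "V2 x + d * V1 x \<le> 0" "- d * V x \<le> V1 x" "V x \<le> exp (- d * x)"
    and "x \<le> y \<Longrightarrow> exp (p * y) * V y \<le> exp (p * x) * V x"
proof -
  define q where "q x = exp (p * x) * V x" for x
  \<comment> \<open>Up to the factor exp (p x) this is the bracket of the equation, so its sign is
    that of V2 + d V1.\<close>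
  define q1 where "q1 x = exp (p * x) * (V1 x + p * V x)" for x
  define q2 where "q2 x = exp (p * x) * (V2 x + 2 * p * V1 x + p\<^sup>2 * V x)" for x
  have dq: "(q has_real_derivative q1 x) (at x)" for x
    unfolding q_def q1_def
    by (rule derivative_eq_intros d1 refl | simp add: algebra_simps)+
  have dq1: "(q1 has_real_derivative q2 x) (at x)" for x
    unfolding q1_def q2_def
    by (rule derivative_eq_intros d1 d2 refl | simp add: algebra_simps power2_eq_square)+
  have conv: "q2 x > 0" if "q1 x = 0" for x
  proof -
    \<comment> \<open>At a critical point the right side vanishes whatever the value of c, so only p
      < d decides the sign of q2.\<close>
    from that have e: "V1 x = - p * V x" by (simp add: q1_def)
    with ode[of x] have "V2 x = d * p * V x" by simp
    with e have "q2 x = exp (p * x) * (p * (d - p) * V x)"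
      by (simp add: q2_def algebra_simps power2_eq_square)
    with pd pos[of x] show ?thesis by simp
  qed
  have limq: "(q \<longlongrightarrow> 0) at_top"
  proof -
    have "LIM x at_top. (d - p) * x :> at_top"
      using pd by (intro filterlim_tendsto_pos_mult_at_top[OF tendsto_const] filterlim_ident) auto
    then have "LIM x at_top. - ((d - p) * x) :> at_bot"
      by (simp add: filterlim_uminus_at_top)
    then have "((\<lambda>x. exp (- ((d - p) * x))) \<longlongrightarrow> 0) at_top"
      by (rule filterlim_compose[OF exp_at_bot])
    from tendsto_mult[OF this lim]
    have "((\<lambda>x. V x * exp (x * p)) \<longlongrightarrow> 0) at_top"
      by (simp add: mult.assoc[symmetric] exp_add[symmetric] algebra_simps)
    moreover have "q = (\<lambda>x. V x * exp (x * p))" by (simp add: fun_eq_iff q_def mult.commute)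
    ultimately show ?thesis by (simp only:)
  qed
  have q1neg: "q1 x < 0" for x
    by (rule neg_derivative_of_convex_critical_points[OF dq dq1 conv _ limq])
      (auto simp: q_def pos)
  then have V1: "V1 x + p * V x < 0" for x by (simp add: q1_def mult_less_0_iff)
  from V1[of x] show "V1 x \<le> - p * V x" by simp
  have sup: "V2 x + d * V1 x \<le> 0" for x
    unfolding ode using V1[of x] c[of x] by (simp add: mult_nonneg_nonpos less_imp_le)
  then show "V2 x + d * V1 x \<le> 0" .
  \<comment> \<open>V1 + d V is a primitive of V2 + d V1, whose sign is already known.\<close>
  have anti: "V1 y + d * V y \<le> V1 x + d * V x" if "x \<le> y" for x y
  proof (rule DERIV_nonpos_imp_nonincreasing[OF that, where f = "\<lambda>x. V1 x + d * V x"])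
    fix z
    have "((\<lambda>x. V1 x + d * V x) has_real_derivative V2 z + d * V1 z) (at z)"
      by (intro DERIV_add d2 DERIV_cmult d1)
    with sup[of z] show "\<exists>l. ((\<lambda>x. V1 x + d * V x) has_real_derivative l) (at z) \<and> l \<le> 0" by blast
  qed
  have low: "- d * V x \<le> V1 x" for x
  proof (rule ccontr)
    assume "\<not> ?thesis"
    define k where "k = - (V1 x + d * V x)"
    have k: "k > 0" using \<open>\<not> _\<close> by (simp add: k_def)
    \<comment> \<open>From x on the slope of V is at most -k, so V would be used up by the time y,
      against positivity.\<close>
    define y where "y = x + V x / k"
    have xy: "x < y" using pos[of x] k by (simp add: y_def)
    have "V y + k * y \<le> V x + k * x"
    proof (rule DERIV_nonpos_imp_nonincreasing[OF less_imp_le[OF xy], where f = "\<lambda>x. V x + k * x"])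
      fix z assume "x \<le> z"
      from anti[OF this] have "V1 z + d * V z \<le> - k" by (simp add: k_def)
      moreover have "d * V z > 0" using pos[of z] pd by simp
      ultimately have "V1 z + k \<le> 0" by simp
      moreover have "((\<lambda>x. V x + k * x) has_real_derivative V1 z + k) (at z)"
        by (auto intro!: derivative_eq_intros d1)
      ultimately show "\<exists>l. ((\<lambda>x. V x + k * x) has_real_derivative l) (at z) \<and> l \<le> 0" by blast
    qed
    moreover have "k * y = k * x + V x" using k by (simp add: y_def field_simps)
    ultimately show False using pos[of y] by simp
  qed
  then show "- d * V x \<le> V1 x" .
  have mono: "exp (d * x) * V x \<le> exp (d * y) * V y" if "x \<le> y" for x y
  proof (rule DERIV_nonneg_imp_nondecreasing[OF that, where f = "\<lambda>x. exp (d * x) * V x"])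
    fix z
    have "((\<lambda>x. exp (d * x) * V x) has_real_derivative exp (d * z) * (V1 z + d * V z)) (at z)"
      by (rule derivative_eq_intros d1 refl | simp add: algebra_simps)+
    moreover have "exp (d * z) * (V1 z + d * V z) \<ge> 0" using low[of z] by simp
    ultimately show "\<exists>l. ((\<lambda>x. exp (d * x) * V x) has_real_derivative l) (at z) \<and> 0 \<le> l" by blast
  qed
  have "exp (d * x) * V x \<le> 1"
    by (rule tendsto_lowerbound[OF lim])
      (auto intro: eventually_mono[OF eventually_ge_at_top[of x]] mono)
  then show "V x \<le> exp (- d * x)" by (simp add: exp_minus field_simps)
  show "exp (p * y) * V y \<le> exp (p * x) * V x" if "x \<le> y"
  proof -
    have "q y \<le> q x"
      by (rule DERIV_nonpos_imp_nonincreasing[OF that, where f = q]) (use dq q1neg less_imp_le in blast)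
    then show ?thesis by (simp add: q_def)
  qed
qed

text \<open>With \<rho> = ln r the radial operator gets constant coefficients. The relation \<alpha>
  = 2 \<beta> / (1 - m) turns \<alpha> f + \<beta> r f' into (\<beta>/m) f^(1-m) times V' + p V with
  p = 2 m / (1 - m); on the other side of the equation this term has a positive coefficient because
  \<beta> < 0.\<close>

lemma self_similar_profile_log_ode:
  fixes f :: "real \<Rightarrow> real"
  assumes prof: "self_similar_profile n m \<alpha> \<beta> f"
    and n: "real n > 2" and m: "0 < m" "m < 1" and \<beta>: "\<beta> < 0" and \<alpha>: "\<alpha> = 2 * \<beta> / (1 - m)"
  defines "V \<equiv> \<lambda>\<rho>. f (exp \<rho>) powr m"
  obtains V1 V2 c where
    "\<And>x. (V has_real_derivative V1 x) (at x)"
    "\<And>x. (V1 has_real_derivative V2 x) (at x)"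
    "continuous_on UNIV V2"
    "\<And>x. V x > 0"
    "\<And>x. V2 x + (real n - 2) * V1 x = c x * (V1 x + (2 * m / (1 - m)) * V x)"
    "\<And>x. c x > 0"
    "((\<lambda>x. exp ((real n - 2) * x) * V x) \<longlongrightarrow> 1) at_top"
proof -
  have fpos: "f r > 0" if "r > 0" for r using prof that by (simp add: self_similar_profile_def)
  have flim: "((\<lambda>r. r powr ((real n - 2) / m) * f r) \<longlongrightarrow> 1) at_top"
    using prof by (simp add: self_similar_profile_def)
  obtain f1 g1 g2 where D: "\<And>r. r > 0 \<Longrightarrow>
        (f has_real_derivative f1 r) (at r) \<and>
        ((\<lambda>s. f s powr m) has_real_derivative g1 r) (at r) \<and>
        (g1 has_real_derivative g2 r) (at r) \<and>
        (real n - 1) / m * (g2 r + (real n - 1) / r * g1 r) + \<alpha> * f r + \<beta> * r * f1 r = 0"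
    using prof by (auto simp: self_similar_profile_def)
  have df: "(f has_real_derivative f1 r) (at r)" if "r > 0" for r using D[OF that] by blast
  have dg: "((\<lambda>s. f s powr m) has_real_derivative g1 r) (at r)" if "r > 0" for r
    using D[OF that] by blast
  have dg1: "(g1 has_real_derivative g2 r) (at r)" if "r > 0" for r using D[OF that] by blast
  define V1 where "V1 \<rho> = exp \<rho> * g1 (exp \<rho>)" for \<rho>
  define V2 where "V2 \<rho> = exp \<rho> * g1 (exp \<rho>) + (exp \<rho>)\<^sup>2 * g2 (exp \<rho>)" for \<rho>
  define c where "c \<rho> = (exp \<rho>)\<^sup>2 * (- \<beta>) / (real n - 1) * f (exp \<rho>) powr (1 - m)" for \<rho>
  have dV: "(V has_real_derivative V1 x) (at x)" for x
    unfolding V_def V1_def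
    using DERIV_chain2[OF dg[OF exp_gt_zero[of x]] DERIV_exp] by (simp add: mult.commute)
  have dV1: "(V1 has_real_derivative V2 x) (at x)" for x
    unfolding V1_def V2_def
    using DERIV_mult[OF DERIV_exp[of x] DERIV_chain2[OF dg1[OF exp_gt_zero[of x]] DERIV_exp]]
    by (simp add: algebra_simps power2_eq_square)
  have Vpos: "V x > 0" for x using fpos[of "exp x"] by (simp add: V_def)
  have ode: "V2 x + (real n - 2) * V1 x = c x * (V1 x + (2 * m / (1 - m)) * V x)" for x
  proof -
    define r where "r = exp x"
    have r: "r > 0" by (simp add: r_def)
    \<comment> \<open>The profile supplies the derivatives of f and of f^m separately; uniqueness of
      derivatives ties them together by the chain rule.\<close>
    have g1: "g1 r = m * f r powr (m - 1) * f1 r"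
      by (rule DERIV_unique[OF dg[OF r]])
        (rule DERIV_chain2[where f = "\<lambda>y. y powr m", OF has_real_derivative_powr[OF fpos[OF r]] df[OF r]])
    have pm: "f r powr (1 - m) * f r powr m = f r" "f r powr (1 - m) * f r powr (m - 1) = 1"
      using fpos[OF r] by (simp_all add: powr_add[symmetric])
    have f1: "f r powr (1 - m) * g1 r = m * f1 r"
      using pm(2) by (simp add: g1 algebra_simps)
    have eq: "(real n - 1) / m * (g2 r + (real n - 1) / r * g1 r) = - (\<alpha> * f r + \<beta> * r * f1 r)"
      using D[OF r] by simp
    have n1: "real n - 1 > 0" using n by simp
    have "V2 x + (real n - 2) * V1 x = r\<^sup>2 * (g2 r + (real n - 1) / r * g1 r)"
      using r by (simp add: V2_def V1_def r_def[symmetric] field_simps power2_eq_square)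
    also have "\<dots> = r\<^sup>2 * (m / (real n - 1)) * ((real n - 1) / m * (g2 r + (real n - 1) / r * g1 r))"
      using n1 m by simp
    also have "\<dots> = - (r\<^sup>2 * (m / (real n - 1))) * (\<alpha> * f r + \<beta> * r * f1 r)"
      unfolding eq by (simp only: mult_minus_left mult_minus_right)
    also have "\<alpha> * f r + \<beta> * r * f1 r
        = f r powr (1 - m) * (\<beta> / m) * (r * g1 r + (2 * m / (1 - m)) * f r powr m)"
    proof -
      have eq: "f r powr (1 - m) * (\<beta> / m) * (r * g1 r + (2 * m / (1 - m)) * f r powr m)
          = (\<beta> / m) * (r * (f r powr (1 - m) * g1 r)
             + (2 * m / (1 - m)) * (f r powr (1 - m) * f r powr m))" by (simp only: algebra_simps)
      also have "\<dots> = (\<beta> / m) * (r * (m * f1 r) + (2 * m / (1 - m)) * f r)"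
        unfolding f1 pm(1) ..
      also have "\<dots> = \<alpha> * f r + \<beta> * r * f1 r" unfolding \<alpha> using m by (simp add: field_simps)
      finally show ?thesis ..
    qed
    also have "- (r\<^sup>2 * (m / (real n - 1))) *
        (f r powr (1 - m) * (\<beta> / m) * (r * g1 r + (2 * m / (1 - m)) * f r powr m))
      = c x * (V1 x + (2 * m / (1 - m)) * V x)"
      using m by (simp add: c_def V1_def V_def r_def[symmetric])
    finally show ?thesis .
  qed
  have cpos: "c x > 0" for x
    unfolding c_def using \<beta> n fpos[of "exp x"] by (intro mult_pos_pos divide_pos_pos) auto
  have cont_f: "continuous_on UNIV (\<lambda>x. f (exp x))"
  proof (intro continuous_at_imp_continuous_on ballI)
    fix x :: real
    show "isCont (\<lambda>x. f (exp x)) x"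
      by (rule isCont_o2[where g = f and f = exp and a = x, OF _ DERIV_isCont[OF df[OF exp_gt_zero]]]) simp
  qed
  have contV: "continuous_on UNIV V" "continuous_on UNIV V1"
    using dV dV1 by (auto intro!: continuous_at_imp_continuous_on DERIV_isCont)
  have contc: "continuous_on UNIV c"
    unfolding c_def using fpos n by (intro continuous_intros cont_f) (auto simp: less_imp_neq[symmetric])
  \<comment> \<open>The second derivative is only known to exist; its continuity is read off from
    the equation solved for it.\<close>
  have "V2 = (\<lambda>x. c x * (V1 x + (2 * m / (1 - m)) * V x) - (real n - 2) * V1 x)"
    using ode by (auto simp: fun_eq_iff algebra_simps)
  then have contV2: "continuous_on UNIV V2"
    by (simp only:) (intro continuous_intros contV contc)
  have limV: "((\<lambda>x. exp ((real n - 2) * x) * V x) \<longlongrightarrow> 1) at_top"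
  proof -
    have "((\<lambda>x. (exp x powr ((real n - 2) / m) * f (exp x)) powr m) \<longlongrightarrow> 1 powr m) at_top"
      by (intro tendsto_powr tendsto_const filterlim_compose[OF flim] exp_at_top) auto
    moreover have "(exp x powr ((real n - 2) / m) * f (exp x)) powr m = exp ((real n - 2) * x) * V x"
      for x using fpos[of "exp x"] m by (simp add: powr_mult V_def powr_powr) (simp add: powr_def)
    ultimately show ?thesis by simp
  qed
  show ?thesis by (rule that[OF dV dV1 contV2 Vpos ode cpos limV])
qed

section \<open>Kato's inequality\<close>

lemma lborel_integral_translate:
  fixes F :: "'a::euclidean_space \<Rightarrow> real"
  assumes "integrable lborel F"
  shows "integrable lborel (\<lambda>x. F (c + x))" and "integral\<^sup>L lborel (\<lambda>x. F (c + x)) = integral\<^sup>L lborel F"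
proof -
  have [measurable]: "F \<in> borel_measurable borel" using assms by auto
  have "integrable (distr lborel borel ((+) c)) F" unfolding lborel_distr_plus by (rule assms)
  then show "integrable lborel (\<lambda>x. F (c + x))" by (subst (asm) integrable_distr_eq) auto
  have "integral\<^sup>L (distr lborel borel ((+) c)) F = integral\<^sup>L lborel F" unfolding lborel_distr_plus ..
  then show "integral\<^sup>L lborel (\<lambda>x. F (c + x)) = integral\<^sup>L lborel F"
    by (subst (asm) integral_distr) auto
qed

lemma integrable_indicator_continuous:
  fixes f :: "'a::euclidean_space \<Rightarrow> real"
  assumes "compact K" "continuous_on K f"
  shows "integrable lborel (\<lambda>x. indicator K x * f x)"
  using borel_integrable_compact[OF assms] by simp

lemma integrable_continuous_compact_support:
  fixes F :: "'a::euclidean_space \<Rightarrow> real"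
  assumes "compact K" "continuous_on K F" "\<And>x. x \<notin> K \<Longrightarrow> F x = 0"
  shows "integrable lborel F"
proof -
  have "(\<lambda>x. indicator K x * F x) = F" using assms(3) by (auto simp: indicator_def fun_eq_iff)
  with integrable_indicator_continuous[OF assms(1,2)] show ?thesis by simp
qed

text \<open>Integration by parts along b without Fubini: the difference quotients of F along b
  integrate to 0 by translation invariance, and dominated convergence passes this on to the
  derivative.\<close>

lemma integral_line_derivative_eq_0:
  fixes F G :: "'a::euclidean_space \<Rightarrow> real"
  assumes d: "\<And>x. ((\<lambda>s. F (x + s *\<^sub>R b)) has_real_derivative G x) (at 0)"
    and cont: "continuous_on UNIV F" "continuous_on UNIV G"
    and K: "compact K" and supp: "\<And>x. x \<notin> K \<Longrightarrow> F x = 0" "\<And>x. x \<notin> K \<Longrightarrow> G x = 0"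
  shows "integral\<^sup>L lborel G = 0"
proof -
  have intF: "integrable lborel F" 
    by (rule integrable_continuous_compact_support[OF K continuous_on_subset[OF cont(1)]]) (use supp in auto)
  have dl: "((\<lambda>s. F (x + s *\<^sub>R b)) has_real_derivative G (x + s *\<^sub>R b)) (at s)" for x s
    using d[of "x + s *\<^sub>R b"] DERIV_shift[of "\<lambda>s. F (x + s *\<^sub>R b)" "G (x + s *\<^sub>R b)" 0 s]
    by (simp add: algebra_simps)
  obtain C where C: "\<And>x. x \<in> K \<Longrightarrow> \<bar>G x\<bar> \<le> C" "C > 0"
  proof -
    have "bounded (G ` K)"
      by (intro compact_imp_bounded compact_continuous_image K continuous_on_subset[OF cont(2)]) auto
    then show ?thesis using that by (auto simp: bounded_pos)
  qed
  have GC: "\<bar>G x\<bar> \<le> C" for x using C supp(2)[of x] by (cases "x \<in> K") auto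
  obtain R where R: "\<And>x. x \<in> K \<Longrightarrow> norm x \<le> R"
    using compact_imp_bounded[OF K] by (auto simp: bounded_iff)
  \<comment> \<open>The steps \<open>h i\<close> are at most 1, so a shift moves a point by at most
    \<open>norm b\<close>; outside this ball both x and the shifted point miss K.\<close>
  define B where "B = cball (0::'a) (R + norm b)"
  define h where "h i = 1 / real (Suc i)" for i
  have h: "h i > 0" "h i \<le> 1" for i by (auto simp: h_def)
  have h0: "h \<longlonglongrightarrow> 0" unfolding h_def using LIMSEQ_inverse_real_of_nat by (simp add: inverse_eq_divide)
  define Q where "Q i x = (F (x + h i *\<^sub>R b) - F x) / h i" for i x
  have Qlim: "(\<lambda>i. Q i x) \<longlonglongrightarrow> G x" for x
  proof -
    have "((\<lambda>s. (F (x + s *\<^sub>R b) - F x) / s) \<longlongrightarrow> G x) (at 0)"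
      using d[of x] by (simp add: DERIV_def)
    moreover have "filterlim h (at 0) sequentially"
      using h0 h by (auto simp: filterlim_at less_imp_neq[symmetric])
    ultimately show ?thesis unfolding Q_def by (rule filterlim_compose)
  qed
  have Qbound: "norm (Q i x) \<le> C * indicator B x" for i x
  proof (cases "x \<in> B")
    case True
    obtain z where "0 < z" "z < h i" "F (x + h i *\<^sub>R b) - F (x + 0 *\<^sub>R b) = (h i - 0) * G (x + z *\<^sub>R b)"
      using MVT2[OF h(1)[of i], of "\<lambda>s. F (x + s *\<^sub>R b)" "\<lambda>s. G (x + s *\<^sub>R b)"] dl by blast
    then have "Q i x = G (x + z *\<^sub>R b)" using h(1)[of i] by (simp add: Q_def)
    with GC True show ?thesis by simp
  next
    case False
    then have n: "norm x > R + norm b" by (simp add: B_def)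
    then have "x \<notin> K" using R[of x] norm_ge_zero[of b] by linarith
    moreover have "norm (x + h i *\<^sub>R b) > R"
    proof -
      have "norm x \<le> norm (x + h i *\<^sub>R b) + norm (h i *\<^sub>R b)"
        by (metis add_diff_cancel norm_triangle_ineq4)
      moreover have "norm (h i *\<^sub>R b) \<le> norm b" using h[of i] by (simp add: mult_left_le_one_le)
      ultimately show ?thesis using n by linarith
    qed
    then have "x + h i *\<^sub>R b \<notin> K" using R by force
    ultimately show ?thesis using False supp by (simp add: Q_def)
  qed
  have Qint0: "integral\<^sup>L lborel (Q i) = 0" for i
    unfolding Q_def using lborel_integral_translate[OF intF, of "h i *\<^sub>R b"] intF
    by (simp add: add.commute)
  have [measurable]: "F \<in> borel_measurable borel" "G \<in> borel_measurable borel"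
    using cont by (auto intro: borel_measurable_continuous_onI)
  have "(\<lambda>i. integral\<^sup>L lborel (Q i)) \<longlonglongrightarrow> integral\<^sup>L lborel G"
  proof (rule integral_dominated_convergence[where w = "\<lambda>x. C * indicator B x"])
    show "integrable lborel (\<lambda>x. C * indicator B x)"
      using emeasure_lborel_cball_finite[of 0 "R + norm b"]
      by (auto simp: B_def top.not_eq_extremum intro!: integrable_mult_right integrable_real_indicator)
    show "G \<in> borel_measurable lborel" "Q i \<in> borel_measurable lborel" for i
      unfolding Q_def by measurable
  qed (use Qlim Qbound in auto)
  then show ?thesis unfolding Qint0 by (simp add: LIMSEQ_const_iff)
qed

text \<open>Here sqrt (a^2 + \<kappa>^2) is a smooth convex substitute for |a|. Two integrations by
  parts move both derivatives onto \<psi>; the term contributed by convexity has a sign and is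
  dropped.\<close>

lemma kato_integral_inequality_smooth:
  fixes a \<psi> :: "'a::euclidean_space \<Rightarrow> real"
  assumes K: "compact K" "K \<subseteq> S" "open S"
    and a1: "\<And>x. x \<in> S \<Longrightarrow> ((\<lambda>s. a (x + s *\<^sub>R b)) has_real_derivative a1 x) (at 0)"
    and a2: "\<And>x. x \<in> S \<Longrightarrow> ((\<lambda>s. a1 (x + s *\<^sub>R b)) has_real_derivative a2 x) (at 0)"
    and ca: "continuous_on S a" "continuous_on S a1" "continuous_on S a2"
    and \<psi>1: "\<And>x. ((\<lambda>s. \<psi> (x + s *\<^sub>R b)) has_real_derivative \<psi>1 x) (at 0)"
    and \<psi>2: "\<And>x. ((\<lambda>s. \<psi>1 (x + s *\<^sub>R b)) has_real_derivative \<psi>2 x) (at 0)"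
    and c\<psi>: "continuous_on UNIV \<psi>" "continuous_on UNIV \<psi>1" "continuous_on UNIV \<psi>2"
    and supp: "\<And>x. x \<notin> K \<Longrightarrow> \<psi> x = 0 \<and> \<psi>1 x = 0 \<and> \<psi>2 x = 0"
    and nonneg: "\<And>x. \<psi> x \<ge> 0" and \<kappa>: "\<kappa> > 0"
  shows "(LINT x|lborel. indicator K x * (\<psi> x * (a x / sqrt ((a x)\<^sup>2 + \<kappa>\<^sup>2)) * a2 x))
       \<le> (LINT x|lborel. indicator K x * (sqrt ((a x)\<^sup>2 + \<kappa>\<^sup>2) * \<psi>2 x))"
proof -
  define j where "j x = sqrt ((a x)\<^sup>2 + \<kappa>\<^sup>2)" for x
  have jpos: "j x > 0" for x using \<kappa> by (simp add: j_def add_nonneg_pos)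
  have j2: "(j x)\<^sup>2 = (a x)\<^sup>2 + \<kappa>\<^sup>2" for x by (simp add: j_def)
  \<comment> \<open>This is the flux \<psi> j' - j \<psi>' along b. In its derivative the products
    of first derivatives cancel, and G is \<psi> j'' - j \<psi>'' with j'' written out.\<close>
  define F where "F x = \<psi> x * (a x * a1 x / j x) - j x * \<psi>1 x" for x
  define G where "G x = \<psi> x * (a x / j x * a2 x) + \<psi> x * (\<kappa>\<^sup>2 * (a1 x)\<^sup>2 / j x ^ 3) - j x * \<psi>2 x" for x
  have off: "F x = 0 \<and> G x = 0" if "x \<notin> K" for x using supp[OF that] by (simp add: F_def G_def)
  have dj: "((\<lambda>s. j (x + s *\<^sub>R b)) has_real_derivative a x * a1 x / j x) (at 0)" if "x \<in> S" for x
  proof -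
    have "((\<lambda>s. sqrt ((a (x + s *\<^sub>R b))\<^sup>2 + \<kappa>\<^sup>2)) has_real_derivative
        (2 * a x * a1 x) * (inverse (sqrt ((a x)\<^sup>2 + \<kappa>\<^sup>2)) / 2)) (at 0)"
      using jpos[of x]
      by (auto intro!: derivative_eq_intros a1[OF that] simp: j_def add_nonneg_pos \<kappa>)
    then show ?thesis by (simp add: j_def field_simps)
  qed
  have dF: "((\<lambda>s. F (x + s *\<^sub>R b)) has_real_derivative G x) (at 0)" for x
  proof (cases "x \<in> S")
    case True
    have dq: "((\<lambda>s. a (x + s *\<^sub>R b) * a1 (x + s *\<^sub>R b) / j (x + s *\<^sub>R b)) has_real_derivative
       ((a1 x * a1 x + a x * a2 x) * j x - (a x * a1 x) * (a x * a1 x / j x)) / (j x * j x)) (at 0)"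
      using jpos[of x]
      by (auto intro!: derivative_eq_intros a1[OF True] a2[OF True] dj[OF True] simp: mult.commute)
    from DERIV_diff[OF DERIV_mult[OF \<psi>1[of x] dq] DERIV_mult[OF dj[OF True] \<psi>2[of x]]]
    have "((\<lambda>s. F (x + s *\<^sub>R b)) has_real_derivative
       \<psi>1 x * (a x * a1 x / j x)
       + \<psi> x * (((a1 x * a1 x + a x * a2 x) * j x - (a x * a1 x) * (a x * a1 x / j x)) / (j x * j x))
       - (a x * a1 x / j x * \<psi>1 x + j x * \<psi>2 x)) (at 0)"
      unfolding F_def by (simp add: mult.commute)
    moreover have eq: "((a1 x * a1 x + a x * a2 x) * j x - (a x * a1 x) * (a x * a1 x / j x)) / (j x * j x)
        = a x / j x * a2 x + \<kappa>\<^sup>2 * (a1 x)\<^sup>2 / j x ^ 3"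
    proof -
      have "a1 x * a1 x * (j x)\<^sup>2 - (a x * a1 x) * (a x * a1 x) = \<kappa>\<^sup>2 * (a1 x)\<^sup>2"
        unfolding j2 by (simp add: algebra_simps power2_eq_square)
      with jpos[of x] show ?thesis by (simp add: field_simps power2_eq_square power3_eq_cube)
    qed
    ultimately show ?thesis unfolding eq G_def by (simp add: algebra_simps)
  next
    case False
    \<comment> \<open>Outside S nothing is known about a, but x lies in the open complement of K,
      where F vanishes identically.\<close>
    then have xK: "x \<in> - K" using K(2) by auto
    have "open (- K)" using K(1) by (simp add: compact_imp_closed open_Compl)
    then have "open ((\<lambda>s. x + s *\<^sub>R b) -` (- K))"
      by (rule open_vimage) (intro continuous_intros)
    with xK have "eventually (\<lambda>s. x + s *\<^sub>R b \<in> - K) (nhds 0)"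
      by (auto simp: eventually_nhds intro!: exI[of _ "(\<lambda>s. x + s *\<^sub>R b) -` (- K)"])
    then have ev: "eventually (\<lambda>s. F (x + s *\<^sub>R b) = 0) (nhds 0)"
      by eventually_elim (use off in auto)
    have "((\<lambda>s. F (x + s *\<^sub>R b)) has_real_derivative 0) (at 0)"
      by (subst DERIV_cong_ev[OF refl ev refl]) simp
    with off xK show ?thesis by simp
  qed
  have cj: "continuous_on S j" unfolding j_def by (intro continuous_intros ca)
  have cS: "continuous_on S F" "continuous_on S G"
    unfolding F_def G_def using jpos
    by (intro continuous_intros ca cj continuous_on_subset[OF c\<psi>(1)] continuous_on_subset[OF c\<psi>(2)]
       continuous_on_subset[OF c\<psi>(3)]; force simp: less_imp_neq[symmetric])+
  have opK: "open (- K)" using K(1) by (simp add: compact_imp_closed open_Compl)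
  have cK: "continuous_on (- K) F" "continuous_on (- K) G"
    using off by (auto intro: continuous_on_eq[OF continuous_on_const[of _ 0]])
  \<comment> \<open>Two open sets cover the space, so continuity on each gives continuity
    everywhere.\<close>
  have U: "S \<union> - K = UNIV" using K(2) by auto
  have cU: "continuous_on UNIV F" "continuous_on UNIV G"
    using continuous_on_open_Un[OF K(3) opK] cS cK U by metis+
  have "integral\<^sup>L lborel G = 0"
    by (rule integral_line_derivative_eq_0[OF dF cU K(1)]) (use off in auto)
  have sub: "continuous_on K f" if "continuous_on S f" for f :: "'a \<Rightarrow> real"
    using continuous_on_subset[OF that K(2)] .
  have subU: "continuous_on K f" if "continuous_on UNIV f" for f :: "'a \<Rightarrow> real"
    using continuous_on_subset[OF that] by auto
  have i1: "integrable lborel (\<lambda>x. indicator K x * (\<psi> x * (a x / j x) * a2 x))"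
    by (intro integrable_indicator_continuous K continuous_intros sub[OF cj] sub[OF ca(1)] sub[OF ca(3)]
       subU[OF c\<psi>(1)]) (use jpos in \<open>auto simp: less_imp_neq[symmetric]\<close>)
  have i2: "integrable lborel (\<lambda>x. indicator K x * (j x * \<psi>2 x))"
    by (intro integrable_indicator_continuous K continuous_intros sub[OF cj] subU[OF c\<psi>(3)])
  have i3: "integrable lborel G"
    by (rule integrable_continuous_compact_support[OF K(1)]) (use off sub[OF cS(2)] in auto)
  have "(LINT x|lborel. indicator K x * (\<psi> x * (a x / j x) * a2 x)
          - indicator K x * (j x * \<psi>2 x)) \<le> integral\<^sup>L lborel G"
  proof (rule integral_mono[OF _ i3])
    show "integrable lborel (\<lambda>x. indicator K x * (\<psi> x * (a x / j x) * a2 x)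
          - indicator K x * (j x * \<psi>2 x))" using i1 i2 by simp
    fix x
    have "0 \<le> \<psi> x * (\<kappa>\<^sup>2 * (a1 x)\<^sup>2 / j x ^ 3)"
      using nonneg[of x] jpos[of x] by (intro mult_nonneg_nonneg divide_nonneg_pos) auto
    then show "indicator K x * (\<psi> x * (a x / j x) * a2 x) - indicator K x * (j x * \<psi>2 x) \<le> G x"
      using off[of x] by (auto simp: indicator_def G_def)
  qed
  with \<open>integral\<^sup>L lborel G = 0\<close> i1 i2 show ?thesis by (simp add: j_def)
qed

text \<open>Limit \<kappa> -> 0 in the smooth version. The quotient a / sqrt (a^2 + \<kappa>^2) is
  bounded by 1 and, for \<kappa> \<le> 1, the root by |a| + 1, so dominated convergence applies on
  K.\<close>

lemma kato_integral_inequality: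
  fixes a \<psi> :: "'a::euclidean_space \<Rightarrow> real"
  assumes K: "compact K" "K \<subseteq> S" "open S"
    and a1: "\<And>x. x \<in> S \<Longrightarrow> ((\<lambda>s. a (x + s *\<^sub>R b)) has_real_derivative a1 x) (at 0)"
    and a2: "\<And>x. x \<in> S \<Longrightarrow> ((\<lambda>s. a1 (x + s *\<^sub>R b)) has_real_derivative a2 x) (at 0)"
    and ca: "continuous_on S a" "continuous_on S a1" "continuous_on S a2"
    and \<psi>1: "\<And>x. ((\<lambda>s. \<psi> (x + s *\<^sub>R b)) has_real_derivative \<psi>1 x) (at 0)"
    and \<psi>2: "\<And>x. ((\<lambda>s. \<psi>1 (x + s *\<^sub>R b)) has_real_derivative \<psi>2 x) (at 0)"
    and c\<psi>: "continuous_on UNIV \<psi>" "continuous_on UNIV \<psi>1" "continuous_on UNIV \<psi>2"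
    and supp: "\<And>x. x \<notin> K \<Longrightarrow> \<psi> x = 0 \<and> \<psi>1 x = 0 \<and> \<psi>2 x = 0"
    and nonneg: "\<And>x. \<psi> x \<ge> 0"
  shows "integrable lborel (\<lambda>x. indicator K x * (\<psi> x * sgn (a x) * a2 x))"
    and "integrable lborel (\<lambda>x. indicator K x * (\<bar>a x\<bar> * \<psi>2 x))"
    and "(LINT x|lborel. indicator K x * (\<psi> x * sgn (a x) * a2 x))
       \<le> (LINT x|lborel. indicator K x * (\<bar>a x\<bar> * \<psi>2 x))"
proof -
  define \<kappa> where "\<kappa> i = 1 / real (Suc i)" for i
  have \<kappa>: "\<kappa> i > 0" "\<kappa> i \<le> 1" for i by (auto simp: \<kappa>_def)
  have \<kappa>0: "\<kappa> \<longlonglongrightarrow> 0" unfolding \<kappa>_def using LIMSEQ_inverse_real_of_nat by (simp add: inverse_eq_divide)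
  have jpos: "sqrt ((a x)\<^sup>2 + (\<kappa> i)\<^sup>2) > 0" for x i using \<kappa>(1)[of i] by (simp add: add_nonneg_pos)
  have sub: "continuous_on K f" if "continuous_on S f" for f :: "'a \<Rightarrow> real"
    using continuous_on_subset[OF that K(2)] .
  have subU: "continuous_on K f" if "continuous_on UNIV f" for f :: "'a \<Rightarrow> real"
    using continuous_on_subset[OF that] by auto
  note cc = sub[OF ca(1)] sub[OF ca(3)] subU[OF c\<psi>(1)] subU[OF c\<psi>(3)]
  define L where "L i x = indicator K x * (\<psi> x * (a x / sqrt ((a x)\<^sup>2 + (\<kappa> i)\<^sup>2)) * a2 x)" for i x
  define R where "R i x = indicator K x * (sqrt ((a x)\<^sup>2 + (\<kappa> i)\<^sup>2) * \<psi>2 x)" for i x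
  have iL: "integrable lborel (L i)" for i
    unfolding L_def by (intro integrable_indicator_continuous K continuous_intros cc)
      (use jpos[of _ i] in \<open>auto simp: less_imp_neq[symmetric]\<close>)
  have iR: "integrable lborel (R i)" for i
    unfolding R_def by (intro integrable_indicator_continuous K continuous_intros cc)
  have LR: "integral\<^sup>L lborel (L i) \<le> integral\<^sup>L lborel (R i)" for i
    unfolding L_def R_def
    by (rule kato_integral_inequality_smooth[OF K a1 a2 ca \<psi>1 \<psi>2 c\<psi> supp nonneg \<kappa>(1)])
  have limsqrt: "(\<lambda>i. sqrt ((a x)\<^sup>2 + (\<kappa> i)\<^sup>2)) \<longlonglongrightarrow> \<bar>a x\<bar>" for x
  proof -
    have "(\<lambda>i. sqrt ((a x)\<^sup>2 + (\<kappa> i)\<^sup>2)) \<longlonglongrightarrow> sqrt ((a x)\<^sup>2 + 0\<^sup>2)" by (intro tendsto_intros \<kappa>0)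
    then show ?thesis by simp
  qed
  have limL: "(\<lambda>i. L i x) \<longlonglongrightarrow> indicator K x * (\<psi> x * sgn (a x) * a2 x)" for x
  \<comment> \<open>Where a vanishes the quotient is 0 for every i, in agreement with sgn 0 =
    0.\<close>
  proof (cases "a x = 0")
    case False
    have "(\<lambda>i. L i x) \<longlonglongrightarrow> indicator K x * (\<psi> x * (a x / \<bar>a x\<bar>) * a2 x)"
      unfolding L_def by (intro tendsto_intros limsqrt) (use False in auto)
    with False show ?thesis by (simp add: sgn_if abs_if split: if_splits)
  qed (simp add: L_def)
  have limR: "(\<lambda>i. R i x) \<longlonglongrightarrow> indicator K x * (\<bar>a x\<bar> * \<psi>2 x)" for x
    unfolding R_def by (intro tendsto_intros limsqrt)
  have dL: "integrable lborel (\<lambda>x. indicator K x * \<bar>\<psi> x * a2 x\<bar>)"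
    by (intro integrable_indicator_continuous K continuous_intros cc)
  have dR: "integrable lborel (\<lambda>x. indicator K x * ((\<bar>a x\<bar> + 1) * \<bar>\<psi>2 x\<bar>))"
    by (intro integrable_indicator_continuous K continuous_intros cc)
  have mL: "(\<lambda>x. indicator K x * (\<psi> x * sgn (a x) * a2 x)) \<in> borel_measurable lborel"
    by (rule borel_measurable_LIMSEQ_real[OF limL]) (use iL in auto)
  have mR: "(\<lambda>x. indicator K x * (\<bar>a x\<bar> * \<psi>2 x)) \<in> borel_measurable lborel"
    by (rule borel_measurable_LIMSEQ_real[OF limR]) (use iR in auto)
  have bL: "norm (L i x) \<le> indicator K x * \<bar>\<psi> x * a2 x\<bar>" for i x
  proof -
    have "\<bar>a x\<bar> \<le> sqrt ((a x)\<^sup>2 + (\<kappa> i)\<^sup>2)" by (simp add: real_le_rsqrt)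
    then have "\<bar>a x / sqrt ((a x)\<^sup>2 + (\<kappa> i)\<^sup>2)\<bar> \<le> 1" using jpos[of x i] by simp
    then have "\<bar>\<psi> x * a2 x\<bar> * \<bar>a x / sqrt ((a x)\<^sup>2 + (\<kappa> i)\<^sup>2)\<bar> \<le> \<bar>\<psi> x * a2 x\<bar> * 1"
      by (intro mult_left_mono) auto
    then show ?thesis by (auto simp: L_def indicator_def abs_mult mult_ac)
  qed
  have bR: "norm (R i x) \<le> indicator K x * ((\<bar>a x\<bar> + 1) * \<bar>\<psi>2 x\<bar>)" for i x
  proof -
    have "sqrt ((a x)\<^sup>2 + (\<kappa> i)\<^sup>2) \<le> sqrt ((a x)\<^sup>2) + sqrt ((\<kappa> i)\<^sup>2)"
      by (rule sqrt_add_le_add_sqrt) auto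
    then have "sqrt ((a x)\<^sup>2 + (\<kappa> i)\<^sup>2) \<le> \<bar>a x\<bar> + 1" using \<kappa>[of i] by simp
    then have "sqrt ((a x)\<^sup>2 + (\<kappa> i)\<^sup>2) * \<bar>\<psi>2 x\<bar> \<le> (\<bar>a x\<bar> + 1) * \<bar>\<psi>2 x\<bar>"
      by (rule mult_right_mono) auto
    then show ?thesis by (auto simp: R_def indicator_def abs_mult)
  qed
  show "integrable lborel (\<lambda>x. indicator K x * (\<psi> x * sgn (a x) * a2 x))"
    by (rule integrable_dominated_convergence[where s = L, OF mL _ dL])
      (use iL limL bL in \<open>auto intro: borel_measurable_integrable\<close>)
  show "integrable lborel (\<lambda>x. indicator K x * (\<bar>a x\<bar> * \<psi>2 x))"
    by (rule integrable_dominated_convergence[where s = R, OF mR _ dR])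
      (use iR limR bR in \<open>auto intro: borel_measurable_integrable\<close>)
  have "(\<lambda>i. integral\<^sup>L lborel (L i)) \<longlonglongrightarrow> (LINT x|lborel. indicator K x * (\<psi> x * sgn (a x) * a2 x))"
    by (rule integral_dominated_convergence[where s = L, OF mL _ dL])
      (use iL limL bL in \<open>auto intro: borel_measurable_integrable\<close>)
  moreover have "(\<lambda>i. integral\<^sup>L lborel (R i)) \<longlonglongrightarrow> (LINT x|lborel. indicator K x * (\<bar>a x\<bar> * \<psi>2 x))"
    by (rule integral_dominated_convergence[where s = R, OF mR _ dR])
      (use iR limR bR in \<open>auto intro: borel_measurable_integrable\<close>)
  ultimately show "(LINT x|lborel. indicator K x * (\<psi> x * sgn (a x) * a2 x))
       \<le> (LINT x|lborel. indicator K x * (\<bar>a x\<bar> * \<psi>2 x))"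
    by (rule LIMSEQ_le) (use LR in auto)
qed

section \<open>Growth of an integral of absolute values\<close>

text \<open>Subtract the line of slope B + e. A maximum of the difference at a point M > a is
  impossible, since one backward step of slope at most B + e/2 would lead to a larger value; so the
  maximum sits at a.\<close>

lemma le_of_left_dini_le:
  fixes \<phi> :: "real \<Rightarrow> real"
  assumes ab: "a \<le> b" and cont: "continuous_on {a..b} \<phi>"
    and dini: "\<And>t e. a < t \<Longrightarrow> t \<le> b \<Longrightarrow> e > 0 \<Longrightarrow> \<exists>h. 0 < h \<and> h \<le> t - a \<and> \<phi> t - \<phi> (t - h) \<le> (B + e) * h"
  shows "\<phi> b \<le> \<phi> a + B * (b - a)"
proof (rule field_le_epsilon)
  fix \<eta> :: real assume \<eta>: "\<eta> > 0"
  \<comment> \<open>The summand 1 keeps the denominator positive when a = b.\<close>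
  define e where "e = \<eta> / (b - a + 1)"
  have e: "e > 0" "e * (b - a) \<le> \<eta>" using \<eta> ab by (auto simp: e_def field_simps)
  define g where "g t = \<phi> t - (B + e) * (t - a)" for t
  have "continuous_on {a..b} g" unfolding g_def by (intro continuous_intros cont)
  then obtain M where M: "M \<in> {a..b}" "\<And>t. t \<in> {a..b} \<Longrightarrow> g t \<le> g M"
    using continuous_attains_sup[of "{a..b}" g] ab by auto
  have "M = a"
  proof (rule ccontr)
    assume "M \<noteq> a"
    with M(1) have "a < M" "M \<le> b" by auto
    with dini[of M "e/2"] e obtain h where h: "0 < h" "h \<le> M - a" "\<phi> M - \<phi> (M - h) \<le> (B + e/2) * h"
      by auto
    have "g (M - h) \<le> g M" using M h by auto
    then have "(B + e) * h \<le> (B + e/2) * h" using h(3) by (simp add: g_def algebra_simps)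
    with e h(1) show False by simp
  qed
  with M(2)[of b] ab have "g b \<le> g a" by simp
  then show "\<phi> b \<le> \<phi> a + B * (b - a) + \<eta>" using e(2) by (simp add: g_def algebra_simps)
qed

text \<open>|P| need not be differentiable in time where P vanishes, so only backward differences
  are estimated: |P t| - |P (t - h)| is at most sgn (P t) times P t - P (t - h), with the sign
  frozen at the later time. In the limit this gives exactly sgn P times P'.\<close>

lemma integral_abs_growth:
  fixes P P' :: "'a::euclidean_space \<Rightarrow> real \<Rightarrow> real"
  assumes K: "compact K" and ab: "a \<le> b"
    and d: "\<And>x t. x \<in> K \<Longrightarrow> t \<in> {a..b} \<Longrightarrow> (P x has_real_derivative P' x t) (at t)"
    and contP: "\<And>t. t \<in> {a..b} \<Longrightarrow> continuous_on K (\<lambda>x. P x t)"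
    and contP': "continuous_on (K \<times> {a..b}) (\<lambda>z. P' (fst z) (snd z))"
    and B: "\<And>t. t \<in> {a..b} \<Longrightarrow> (LINT x|lborel. indicator K x * (sgn (P x t) * P' x t)) \<le> B"
  shows "(LINT x|lborel. indicator K x * \<bar>P x b\<bar>) \<le> (LINT x|lborel. indicator K x * \<bar>P x a\<bar>) + B * (b - a)"
proof -
  have "bounded ((\<lambda>z. P' (fst z) (snd z)) ` (K \<times> {a..b}))"
    by (intro compact_imp_bounded compact_continuous_image contP' compact_Times K compact_Icc)
  then obtain C where C0: "C > 0" "\<forall>z \<in> K \<times> {a..b}. \<bar>P' (fst z) (snd z)\<bar> \<le> C"
    unfolding bounded_pos by auto
  then have C: "\<And>x t. x \<in> K \<Longrightarrow> t \<in> {a..b} \<Longrightarrow> \<bar>P' x t\<bar> \<le> C" "C > 0"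
    by force+
  have lip: "\<bar>P x t - P x s\<bar> \<le> C * (t - s)" if "x \<in> K" "a \<le> s" "s \<le> t" "t \<le> b" for x s t
  proof (cases "s = t")
    case False
    then have st: "s < t" using that by simp
    have "\<exists>z>s. z < t \<and> P x t - P x s = (t - s) * P' x z"
      by (rule MVT2[OF st]) (use d that in auto)
    then obtain z where z: "s < z" "z < t" "P x t - P x s = (t - s) * P' x z" by blast
    have "\<bar>P' x z\<bar> \<le> C" using C(1)[of x z] that z by auto
    with z that show ?thesis by (simp add: abs_mult mult.commute[of C] mult_left_mono)
  qed simp
  define \<phi> where "\<phi> t = (LINT x|lborel. indicator K x * \<bar>P x t\<bar>)" for t
  have int: "integrable lborel (\<lambda>x. indicator K x * \<bar>P x t\<bar>)" if "t \<in> {a..b}" for t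
    by (intro integrable_indicator_continuous K continuous_intros contP that)
  have intC: "integrable lborel (\<lambda>x. indicator K x * c)" for c :: real
    by (intro integrable_indicator_continuous K continuous_intros)
  define m where "m = (LINT x|lborel. indicator K x * C)"
  have m: "m \<ge> 0" unfolding m_def using C(2) by (intro integral_nonneg_AE) auto
  have lip\<phi>: "\<bar>\<phi> t - \<phi> s\<bar> \<le> m * (t - s)" if "a \<le> s" "s \<le> t" "t \<le> b" for s t
  proof -
    have i: "integrable lborel (\<lambda>x. indicator K x * \<bar>P x t\<bar>)" "integrable lborel (\<lambda>x. indicator K x * \<bar>P x s\<bar>)"
      using int that by auto
    have "\<bar>\<phi> t - \<phi> s\<bar> = \<bar>LINT x|lborel. indicator K x * \<bar>P x t\<bar> - indicator K x * \<bar>P x s\<bar>\<bar>"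
      using i by (simp add: \<phi>_def)
    also have "\<dots> \<le> (LINT x|lborel. \<bar>indicator K x * \<bar>P x t\<bar> - indicator K x * \<bar>P x s\<bar>\<bar>)"
      by (rule integral_abs_bound)
    also have "\<dots> \<le> (LINT x|lborel. indicator K x * C * (t - s))"
    proof (rule integral_mono)
      fix x
      show "\<bar>indicator K x * \<bar>P x t\<bar> - indicator K x * \<bar>P x s\<bar>\<bar> \<le> indicator K x * C * (t - s)"
        using lip[of x s t] that by (cases "x \<in> K") auto
    qed (use i intC in auto)
    finally show ?thesis by (simp add: m_def)
  qed
  have cont: "continuous_on {a..b} \<phi>"
  proof (rule lipschitz_on_continuous_on[of m])
    show "m-lipschitz_on {a..b} \<phi>"
    proof (rule lipschitz_onI[OF _ m])
      fix s t assume "s \<in> {a..b}" "t \<in> {a..b}"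
      then show "dist (\<phi> s) (\<phi> t) \<le> m * dist s t"
        using lip\<phi>[of s t] lip\<phi>[of t s] by (cases "s \<le> t") (auto simp: dist_real_def abs_minus_commute)
    qed
  qed
  have "\<phi> b \<le> \<phi> a + B * (b - a)"
  proof (rule le_of_left_dini_le[OF ab cont])
    fix t e :: real assume t: "a < t" "t \<le> b" and e: "e > 0"
    define h where "h i = (t - a) / real (Suc i)" for i
    have h: "0 < h i" "h i \<le> t - a" for i using t by (auto simp: h_def field_simps intro: mult_right_mono)
    have h0: "h \<longlonglongrightarrow> 0"
      unfolding h_def using tendsto_mult[OF tendsto_const LIMSEQ_inverse_real_of_nat, of "t - a"]
      by (simp add: divide_inverse)
    define Q where "Q i x = indicator K x * (sgn (P x t) * ((P x t - P x (t - h i)) / h i))" for i x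
    have limQ: "(\<lambda>i. Q i x) \<longlonglongrightarrow> indicator K x * (sgn (P x t) * P' x t)" for x
    proof (cases "x \<in> K")
      case True
      have "((\<lambda>s. (P x (t + s) - P x t) / s) \<longlongrightarrow> P' x t) (at 0)"
        using d[OF True, of t] t by (simp add: DERIV_def)
      moreover have "filterlim (\<lambda>i. - h i) (at 0) sequentially"
        using tendsto_minus[OF h0] h by (auto simp: filterlim_at less_imp_neq[symmetric])
      ultimately have "(\<lambda>i. (P x (t + - h i) - P x t) / - h i) \<longlonglongrightarrow> P' x t"
        by (rule filterlim_compose)
      then have "(\<lambda>i. (P x t - P x (t - h i)) / h i) \<longlonglongrightarrow> P' x t"
        by (simp add: minus_divide_left)
      then show ?thesis unfolding Q_def by (intro tendsto_intros)
    qed (simp add: Q_def)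
    have bQ: "norm (Q i x) \<le> indicator K x * C" for i x
    proof (cases "x \<in> K")
      case True
      have "\<bar>P x t - P x (t - h i)\<bar> \<le> C * h i" using lip[OF True, of "t - h i" t] h[of i] t by auto
      then have "\<bar>(P x t - P x (t - h i)) / h i\<bar> \<le> C" using h(1)[of i] by (simp add: field_simps)
      then show ?thesis using True C(2) by (auto simp: Q_def abs_mult abs_sgn_eq)
    qed (simp add: Q_def)
    have mP: "(\<lambda>x. indicator K x * P x s) \<in> borel_measurable borel" if "s \<in> {a..b}" for s
      using borel_measurable_integrable[OF integrable_indicator_continuous[OF K contP[OF that]]] by simp
    have mQ: "Q i \<in> borel_measurable lborel" for i
    proof -
      have "t \<in> {a..b}" "t - h i \<in> {a..b}" using t h[of i] by auto
      note [measurable] = mP[OF this(1)] mP[OF this(2)]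
      \<comment> \<open>P is controlled only on K, so measurability comes from its truncation, whose
        sign agrees with that of P on K.\<close>
      have "Q i = (\<lambda>x. sgn (indicator K x * P x t)
          * ((indicator K x * P x t - indicator K x * P x (t - h i)) / h i))"
        by (auto simp: fun_eq_iff Q_def indicator_def)
      moreover have "\<dots> \<in> borel_measurable borel" by measurable
      ultimately show ?thesis by simp
    qed
    have iQ: "integrable lborel (Q i)" for i
      by (rule Bochner_Integration.integrable_bound[OF intC[of C] mQ]) (use bQ C(2) in \<open>auto simp: abs_mult\<close>)
    have "(\<lambda>i. integral\<^sup>L lborel (Q i)) \<longlonglongrightarrow> (LINT x|lborel. indicator K x * (sgn (P x t) * P' x t))"
      by (rule integral_dominated_convergence[where s = Q, OF borel_measurable_LIMSEQ_real[OF limQ mQ] mQ intC[of C]])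
        (use limQ bQ in auto)
    moreover have "(LINT x|lborel. indicator K x * (sgn (P x t) * P' x t)) < B + e"
      using B[of t] t e by auto
    ultimately have "eventually (\<lambda>i. integral\<^sup>L lborel (Q i) < B + e) sequentially"
      by (rule order_tendstoD)
    then obtain i where i: "integral\<^sup>L lborel (Q i) < B + e"
      unfolding eventually_sequentially by blast
    have ti: "t \<in> {a..b}" "t - h i \<in> {a..b}" using t h[of i] by auto
    have "\<phi> t - \<phi> (t - h i) = (LINT x|lborel. indicator K x * \<bar>P x t\<bar> - indicator K x * \<bar>P x (t - h i)\<bar>)"
      unfolding \<phi>_def by (rule Bochner_Integration.integral_diff[symmetric]; rule int; rule ti)
    also have "\<dots> \<le> (LINT x|lborel. Q i x * h i)"
    proof (rule integral_mono)
      fix x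
      have "\<bar>P x t\<bar> - \<bar>P x (t - h i)\<bar> \<le> sgn (P x t) * (P x t - P x (t - h i))"
        by (auto simp: sgn_if abs_if)
      then show "indicator K x * \<bar>P x t\<bar> - indicator K x * \<bar>P x (t - h i)\<bar> \<le> Q i x * h i"
        using h(1)[of i] by (auto simp: indicator_def Q_def)
    qed (use int ti iQ in auto)
    also have "\<dots> \<le> (B + e) * h i" using i h(1)[of i] by simp
    finally show "\<exists>h. 0 < h \<and> h \<le> t - a \<and> \<phi> t - \<phi> (t - h) \<le> (B + e) * h" using h by blast
  qed
  then show ?thesis by (simp add: \<phi>_def)
qed

section \<open>Radial test functions\<close>

lemma has_derivative_ln_norm_line:
  fixes x b :: "'a::euclidean_space"
  assumes "x \<noteq> 0"
  shows "((\<lambda>s. ln (norm (x + s *\<^sub>R b))) has_real_derivative (x \<bullet> b) / (norm x)\<^sup>2) (at 0)"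
proof -
  have n: "norm (x + s *\<^sub>R b) = sqrt ((norm x)\<^sup>2 + 2 * s * (x \<bullet> b) + s\<^sup>2 * (b \<bullet> b))" for s
    unfolding norm_eq_sqrt_inner
    by (simp add: algebra_simps inner_add_left inner_add_right inner_commute power2_eq_square)
  have "((\<lambda>s. ln (sqrt ((norm x)\<^sup>2 + 2 * s * (x \<bullet> b) + s\<^sup>2 * (b \<bullet> b)))) has_real_derivative
    (2 * (x \<bullet> b)) * (inverse (sqrt ((norm x)\<^sup>2)) / 2) / sqrt ((norm x)\<^sup>2)) (at 0)"
    using assms by (auto intro!: derivative_eq_intros)
  then show ?thesis unfolding n using assms by (simp add: field_simps power2_eq_square)
qed

text \<open>The origin is a separate case because \<open>ln 0 = 0\<close>.\<close>

definition radial :: "(real \<Rightarrow> real) \<Rightarrow> 'a::euclidean_space \<Rightarrow> real" where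
  "radial \<phi> x = (if x = 0 then 0 else \<phi> (ln (norm x)))"

definition radial_line_deriv :: "(real \<Rightarrow> real) \<Rightarrow> 'a::euclidean_space \<Rightarrow> 'a \<Rightarrow> real" where
  "radial_line_deriv \<phi>1 b x = radial \<phi>1 x * ((x \<bullet> b) / (norm x)\<^sup>2)"

text \<open>Chain rule for \<phi> (ln |x|): the factor of \<open>\<phi>2\<close> is the squared
  first derivative of ln |x| along b, the factor of \<open>\<phi>1\<close> is its second
  derivative.\<close>

definition radial_line_deriv2 ::
    "(real \<Rightarrow> real) \<Rightarrow> (real \<Rightarrow> real) \<Rightarrow> 'a::euclidean_space \<Rightarrow> 'a \<Rightarrow> real" where
  "radial_line_deriv2 \<phi>1 \<phi>2 b x = radial \<phi>2 x * ((x \<bullet> b) / (norm x)\<^sup>2)\<^sup>2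
     + radial \<phi>1 x * ((b \<bullet> b) / (norm x)\<^sup>2 - 2 * ((x \<bullet> b) / (norm x)\<^sup>2)\<^sup>2)"

definition annulus :: "real \<Rightarrow> 'a::euclidean_space set" where
  "annulus k = {x. exp (- k) \<le> norm x \<and> norm x \<le> exp k}"

lemma compact_annulus: "compact (annulus k)"
proof -
  have "annulus k = cball (0::'a) (exp k) - ball 0 (exp (- k))" by (auto simp: annulus_def)
  then show ?thesis by (simp add: compact_diff)
qed

lemma annulus_subset_punctured: "annulus k \<subseteq> - {0::'a::euclidean_space}"
  using exp_gt_zero[of "- k"] by (auto simp: annulus_def simp del: exp_gt_zero)

lemma mem_annulus_iff: "x \<noteq> 0 \<Longrightarrow> x \<in> annulus k \<longleftrightarrow> \<bar>ln (norm x)\<bar> \<le> k"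
proof -
  assume "x \<noteq> 0"
  then have "norm x = exp (ln (norm x))" by simp
  then have "x \<in> annulus k \<longleftrightarrow> exp (- k) \<le> exp (ln (norm x)) \<and> exp (ln (norm x)) \<le> exp k"
    by (simp add: annulus_def)
  then show ?thesis by (simp only: exp_le_cancel_iff) linarith
qed

lemma radial_line_derivatives:
  fixes x b :: "'a::euclidean_space"
  assumes x: "x \<noteq> 0"
    and d1: "\<And>y. (\<phi> has_real_derivative \<phi>1 y) (at y)"
    and d2: "\<And>y. (\<phi>1 has_real_derivative \<phi>2 y) (at y)"
  shows "((\<lambda>s. radial \<phi> (x + s *\<^sub>R b)) has_real_derivative radial_line_deriv \<phi>1 b x) (at 0)"
    and "((\<lambda>s. radial_line_deriv \<phi>1 b (x + s *\<^sub>R b)) has_real_derivative radial_line_deriv2 \<phi>1 \<phi>2 b x) (at 0)"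
proof -
  have "open ((\<lambda>s. x + s *\<^sub>R b) -` (- {0}))"
    by (rule open_vimage) (auto intro!: continuous_intros)
  then have ev: "eventually (\<lambda>s. x + s *\<^sub>R b \<noteq> 0) (nhds 0)"
    using x by (auto simp: eventually_nhds intro!: exI[of _ "(\<lambda>s. x + s *\<^sub>R b) -` (- {0})"])
  have chain: "((\<lambda>s. \<theta> (ln (norm (x + s *\<^sub>R b)))) has_real_derivative \<theta>1 (ln (norm x)) * ((x \<bullet> b) / (norm x)\<^sup>2)) (at 0)"
    if "\<And>y. (\<theta> has_real_derivative \<theta>1 y) (at y)" for \<theta> \<theta>1
    using DERIV_chain2[OF that has_derivative_ln_norm_line[OF x, of b]] by simp
  show "((\<lambda>s. radial \<phi> (x + s *\<^sub>R b)) has_real_derivative radial_line_deriv \<phi>1 b x) (at 0)"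
    using DERIV_cong_ev[OF refl eventually_mono[OF ev] refl,
      of "\<lambda>s. radial \<phi> (x + s *\<^sub>R b)" "\<lambda>s. \<phi> (ln (norm (x + s *\<^sub>R b)))"] chain[OF d1] x
    by (simp add: radial_def radial_line_deriv_def)
  have n2: "(norm (x + s *\<^sub>R b))\<^sup>2 = (norm x)\<^sup>2 + 2 * s * (x \<bullet> b) + s\<^sup>2 * (b \<bullet> b)" for s
    unfolding power2_norm_eq_inner
    by (simp add: algebra_simps inner_add_left inner_add_right inner_commute power2_eq_square)
  have q: "((\<lambda>s. ((x + s *\<^sub>R b) \<bullet> b) / (norm (x + s *\<^sub>R b))\<^sup>2) has_real_derivative
       (b \<bullet> b) / (norm x)\<^sup>2 - 2 * ((x \<bullet> b) / (norm x)\<^sup>2)\<^sup>2) (at 0)"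
  proof -
    have "((\<lambda>s. (x \<bullet> b + s * (b \<bullet> b)) / ((norm x)\<^sup>2 + 2 * s * (x \<bullet> b) + s\<^sup>2 * (b \<bullet> b))) has_real_derivative
       ((b \<bullet> b) * (norm x)\<^sup>2 - (x \<bullet> b) * (2 * (x \<bullet> b))) / ((norm x)\<^sup>2 * (norm x)\<^sup>2)) (at 0)"
      using x by (auto intro!: derivative_eq_intros)
    moreover have "((b \<bullet> b) * (norm x)\<^sup>2 - (x \<bullet> b) * (2 * (x \<bullet> b))) / ((norm x)\<^sup>2 * (norm x)\<^sup>2)
       = (b \<bullet> b) / (norm x)\<^sup>2 - 2 * ((x \<bullet> b) / (norm x)\<^sup>2)\<^sup>2"
      using x by (simp add: field_simps power2_eq_square)
    ultimately show ?thesis unfolding n2 by (simp add: inner_add_left)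
  qed
  from DERIV_mult[OF chain[OF d2] q]
  have "((\<lambda>s. \<phi>1 (ln (norm (x + s *\<^sub>R b))) * (((x + s *\<^sub>R b) \<bullet> b) / (norm (x + s *\<^sub>R b))\<^sup>2))
     has_real_derivative radial_line_deriv2 \<phi>1 \<phi>2 b x) (at 0)"
    using x by (simp add: radial_def radial_line_deriv2_def power2_eq_square algebra_simps)
  then show "((\<lambda>s. radial_line_deriv \<phi>1 b (x + s *\<^sub>R b)) has_real_derivative radial_line_deriv2 \<phi>1 \<phi>2 b x) (at 0)"
    using DERIV_cong_ev[OF refl eventually_mono[OF ev] refl, of "\<lambda>s. radial_line_deriv \<phi>1 b (x + s *\<^sub>R b)"
        "\<lambda>s. \<phi>1 (ln (norm (x + s *\<^sub>R b))) * (((x + s *\<^sub>R b) \<bullet> b) / (norm (x + s *\<^sub>R b))\<^sup>2)"]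
    by (simp add: radial_def radial_line_deriv_def)
qed

lemma continuous_on_radial:
  assumes "continuous_on UNIV \<phi>" "0 \<notin> A"
  shows "continuous_on A (radial \<phi>)"
proof -
  have "continuous_on A (\<lambda>x. \<phi> (ln (norm x)))"
    using assms by (intro continuous_on_compose2[OF assms(1)] continuous_intros) auto
  then show ?thesis by (rule continuous_on_eq) (use assms(2) in \<open>auto simp: radial_def\<close>)
qed

text \<open>The support condition makes everything vanish on the open ball of radius exp (-k), so
  the derivative formulas and the continuity, valid away from the origin, extend across it.\<close>

lemma radial_test_function:
  fixes b :: "'a::euclidean_space"
  assumes d1: "\<And>y. (\<phi> has_real_derivative \<phi>1 y) (at y)"
    and d2: "\<And>y. (\<phi>1 has_real_derivative \<phi>2 y) (at y)"
    and c2: "continuous_on UNIV \<phi>2"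
    and supp: "\<And>y. k < \<bar>y\<bar> \<Longrightarrow> \<phi> y = 0 \<and> \<phi>1 y = 0 \<and> \<phi>2 y = 0"
  shows "((\<lambda>s. radial \<phi> (x + s *\<^sub>R b)) has_real_derivative radial_line_deriv \<phi>1 b x) (at 0)"
    and "((\<lambda>s. radial_line_deriv \<phi>1 b (x + s *\<^sub>R b)) has_real_derivative radial_line_deriv2 \<phi>1 \<phi>2 b x) (at 0)"
    and "continuous_on UNIV (radial \<phi> :: 'a \<Rightarrow> real)"
    and "continuous_on UNIV (radial_line_deriv \<phi>1 b)"
    and "continuous_on UNIV (radial_line_deriv2 \<phi>1 \<phi>2 b)"
    and "y \<notin> annulus k \<Longrightarrow> radial \<phi> y = 0 \<and> radial_line_deriv \<phi>1 b y = 0 \<and> radial_line_deriv2 \<phi>1 \<phi>2 b y = 0"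
proof -
  show off: "radial \<phi> y = 0 \<and> radial_line_deriv \<phi>1 b y = 0 \<and> radial_line_deriv2 \<phi>1 \<phi>2 b y = 0"
    if "y \<notin> annulus k" for y
    using that supp[of "ln (norm y)"]
    by (cases "y = 0") (auto simp: radial_def radial_line_deriv_def radial_line_deriv2_def mem_annulus_iff)
  define W where "W = ball (0::'a) (exp (- k))"
  have W: "open W" "0 \<in> W" "W \<inter> annulus k = {}" by (auto simp: W_def annulus_def)
  have offW: "radial \<phi> y = 0" "radial_line_deriv \<phi>1 b y = 0" "radial_line_deriv2 \<phi>1 \<phi>2 b y = 0"
    if "y \<in> W" for y using off[of y] that W(3) by auto
  have "((\<lambda>s. radial \<phi> (x + s *\<^sub>R b)) has_real_derivative radial_line_deriv \<phi>1 b x) (at 0) \<and>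
    ((\<lambda>s. radial_line_deriv \<phi>1 b (x + s *\<^sub>R b)) has_real_derivative radial_line_deriv2 \<phi>1 \<phi>2 b x) (at 0)"
  proof (cases "x = 0")
    case True
    have "open ((\<lambda>s. x + s *\<^sub>R b) -` W)"
      by (rule open_vimage) (auto intro!: continuous_intros W)
    then have ev: "eventually (\<lambda>s. x + s *\<^sub>R b \<in> W) (nhds 0)"
      using True W by (auto simp: eventually_nhds intro!: exI[of _ "(\<lambda>s. x + s *\<^sub>R b) -` W"])
    have "((\<lambda>s. f (x + s *\<^sub>R b)) has_real_derivative 0) (at 0)" if "\<And>y. y \<in> W \<Longrightarrow> f y = 0" for f :: "'a \<Rightarrow> real"
    proof -
      have "eventually (\<lambda>s. f (x + s *\<^sub>R b) = 0) (nhds 0)" using ev by eventually_elim (use that in auto)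
      from DERIV_cong_ev[OF refl this refl] show ?thesis by simp
    qed
    from this[of "radial \<phi>"] this[of "radial_line_deriv \<phi>1 b"] show ?thesis
      using offW offW[OF W(2)] True by auto
  next
    case False
    from radial_line_derivatives[OF False d1 d2] show ?thesis by blast
  qed
  then show "((\<lambda>s. radial \<phi> (x + s *\<^sub>R b)) has_real_derivative radial_line_deriv \<phi>1 b x) (at 0)"
    and "((\<lambda>s. radial_line_deriv \<phi>1 b (x + s *\<^sub>R b)) has_real_derivative radial_line_deriv2 \<phi>1 \<phi>2 b x) (at 0)"
    by blast+
  have c: "continuous_on UNIV \<phi>" "continuous_on UNIV \<phi>1"
    using d1 d2 by (auto intro!: continuous_at_imp_continuous_on DERIV_isCont)
  have U: "W \<union> - {0} = UNIV" using W(2) by auto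
  have glue: "continuous_on UNIV f" if "\<And>y. y \<in> W \<Longrightarrow> f y = 0" "continuous_on (- {0}) f" for f :: "'a \<Rightarrow> real"
  proof -
    have "continuous_on W f" by (rule continuous_on_eq[OF continuous_on_const[of _ 0]]) (use that in auto)
    from continuous_on_open_Un[OF W(1) _ this that(2)] show ?thesis unfolding U by auto
  qed
  have q: "continuous_on (- {0}) (\<lambda>x::'a. (x \<bullet> b) / (norm x)\<^sup>2)" "continuous_on (- {0}) (\<lambda>x::'a. (b \<bullet> b) / (norm x)\<^sup>2)"
    by (intro continuous_intros; simp)+
  have r: "continuous_on (- {0}) (radial \<phi> :: 'a \<Rightarrow> real)" "continuous_on (- {0}) (radial \<phi>1 :: 'a \<Rightarrow> real)"
    "continuous_on (- {0}) (radial \<phi>2 :: 'a \<Rightarrow> real)"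
    using c c2 by (auto intro: continuous_on_radial)
  show "continuous_on UNIV (radial \<phi> :: 'a \<Rightarrow> real)"
    by (rule glue[OF offW(1) r(1)])
  show "continuous_on UNIV (radial_line_deriv \<phi>1 b)"
    by (rule glue[OF offW(2)], assumption)
      (unfold radial_line_deriv_def[abs_def], intro continuous_intros q r)
  show "continuous_on UNIV (radial_line_deriv2 \<phi>1 \<phi>2 b)"
    by (rule glue[OF offW(3)], assumption)
      (unfold radial_line_deriv2_def[abs_def], intro continuous_intros q r)
qed

text \<open>The numerator is the operator of the profile equation: with d = n - 2, r^2 times the
  Laplacian is \<phi>'' + d \<phi>' in the logarithmic variable. Superharmonicity of a radial
  function can therefore be read off there.\<close>

lemma sum_radial_line_deriv2:
  fixes x :: "'a::euclidean_space"
  shows "(\<Sum>b\<in>Basis. radial_line_deriv2 \<phi>1 \<phi>2 b x)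
    = (radial \<phi>2 x + (real DIM('a) - 2) * radial \<phi>1 x) / (norm x)\<^sup>2"
proof (cases "x = 0")
  case False
  have s: "(\<Sum>b\<in>Basis. ((x \<bullet> b) / (norm x)\<^sup>2)\<^sup>2) = 1 / (norm x)\<^sup>2"
  proof -
    have "(\<Sum>b\<in>Basis. ((x \<bullet> b) / (norm x)\<^sup>2)\<^sup>2) = (\<Sum>b\<in>Basis. (x \<bullet> b)\<^sup>2) / ((norm x)\<^sup>2)\<^sup>2"
      by (simp add: power_divide sum_divide_distrib)
    also have "(\<Sum>b\<in>Basis. (x \<bullet> b)\<^sup>2) = (norm x)\<^sup>2"
      unfolding power2_norm_eq_inner by (subst euclidean_inner) (simp add: power2_eq_square)
    finally show ?thesis using False by (simp add: power2_eq_square)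
  qed
  have "(\<Sum>b\<in>Basis. radial_line_deriv2 \<phi>1 \<phi>2 b x)
    = radial \<phi>2 x * (\<Sum>b\<in>Basis. ((x \<bullet> b) / (norm x)\<^sup>2)\<^sup>2)
     + radial \<phi>1 x * ((\<Sum>b\<in>(Basis::'a set). (b \<bullet> b) / (norm x)\<^sup>2) - 2 * (\<Sum>b\<in>Basis. ((x \<bullet> b) / (norm x)\<^sup>2)\<^sup>2))"
    by (simp add: radial_line_deriv2_def sum.distrib sum_distrib_left sum_subtractf algebra_simps)
  also have "(\<Sum>b\<in>(Basis::'a set). (b \<bullet> b) / (norm x)\<^sup>2) = real DIM('a) / (norm x)\<^sup>2" by simp
  finally show ?thesis unfolding s by (simp add: field_simps diff_divide_distrib add_divide_distrib)
qed (simp add: radial_line_deriv2_def radial_def)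

text \<open>An exponent of at least 2 flattens the kink: at 0 the difference quotient is bounded by
  |h|^(j+1).\<close>

lemma DERIV_max_0_power:
  "((\<lambda>y. (max 0 y) ^ Suc (Suc j)) has_real_derivative real (Suc (Suc j)) * (max 0 x) ^ Suc j) (at (x::real))"
proof -
  consider "x > 0" | "x < 0" | "x = 0" by linarith
  then show ?thesis
  proof cases
    case 1
    have "eventually (\<lambda>y. y > 0) (nhds x)" using 1 eventually_nhds_in_open[of "{0<..}" x] by simp
    then have "eventually (\<lambda>y. (max 0 y) ^ Suc (Suc j) = y ^ Suc (Suc j)) (nhds x)"
      by eventually_elim (simp add: max_def)
    from DERIV_cong_ev[OF refl this refl] 1 show ?thesis
      by (auto intro!: derivative_eq_intros simp del: power_Suc simp: max_def)
  next
    case 2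
    have "eventually (\<lambda>y. y < 0) (nhds x)" using 2 eventually_nhds_in_open[of "{..<0}" x] by simp
    then have "eventually (\<lambda>y. (max 0 y) ^ Suc (Suc j) = 0) (nhds x)"
      by eventually_elim (simp add: max_def)
    from DERIV_cong_ev[OF refl this refl] 2 show ?thesis by (simp add: max_def)
  next
    case 3
    have "((\<lambda>h. (max 0 h) ^ Suc (Suc j) / h) \<longlongrightarrow> 0) (at (0::real))"
    proof (rule Lim_null_comparison)
      have "((\<lambda>h::real. \<bar>h\<bar> ^ Suc j) \<longlongrightarrow> \<bar>0\<bar> ^ Suc j) (at 0)" by (intro tendsto_intros)
      then show "((\<lambda>h::real. \<bar>h\<bar> ^ Suc j) \<longlongrightarrow> 0) (at 0)" by simp
      show "eventually (\<lambda>h::real. norm ((max 0 h) ^ Suc (Suc j) / h) \<le> \<bar>h\<bar> ^ Suc j) (at 0)"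
      proof (intro always_eventually allI)
        fix h :: real
        show "norm ((max 0 h) ^ Suc (Suc j) / h) \<le> \<bar>h\<bar> ^ Suc j"
        proof (cases "0 \<le> h")
          case False
          then have "(max 0 h) ^ Suc (Suc j) = 0" by (simp add: max_def)
          then show ?thesis by (simp only: div_0 norm_zero zero_le_power_abs)
        qed (auto simp: max_def)
      qed
    qed
    with 3 show ?thesis by (simp add: DERIV_def)
  qed
qed

text \<open>The cube is the least integer power of the positive part of 1 - y^2 that is of class
  C^2, and it comes with explicit numerical bounds on the derivatives.\<close>

definition bump :: "real \<Rightarrow> real" where "bump y = (max 0 (1 - y\<^sup>2)) ^ 3"
definition bump1 :: "real \<Rightarrow> real" where "bump1 y = - 6 * y * (max 0 (1 - y\<^sup>2))\<^sup>2"
definition bump2 :: "real \<Rightarrow> real" where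
  "bump2 y = - 6 * (max 0 (1 - y\<^sup>2))\<^sup>2 + 24 * y\<^sup>2 * max 0 (1 - y\<^sup>2)"

lemma DERIV_bump: "(bump has_real_derivative bump1 y) (at y)"
proof -
  have eqs: "Suc (Suc 1) = 3" "Suc 1 = 2" by simp_all
  have e: "((\<lambda>y. 1 - y\<^sup>2) has_real_derivative - 2 * y) (at y)"
    by (auto intro!: derivative_eq_intros)
  from DERIV_chain2[where g = "\<lambda>y. 1 - y\<^sup>2", OF DERIV_max_0_power[of 1 "1 - y\<^sup>2"] e]
  have "((\<lambda>y. (max 0 (1 - y\<^sup>2)) ^ 3) has_real_derivative 3 * (max 0 (1 - y\<^sup>2))\<^sup>2 * (- 2 * y)) (at y)"
    unfolding eqs by simp
  moreover have "3 * (max 0 (1 - y\<^sup>2))\<^sup>2 * (- 2 * y) = bump1 y" by (simp add: bump1_def)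
  ultimately show ?thesis unfolding bump_def[abs_def] by simp
qed

lemma DERIV_bump1: "(bump1 has_real_derivative bump2 y) (at y)"
proof -
  have eqs: "Suc (Suc 0) = 2" "Suc 0 = 1" by simp_all
  have e: "((\<lambda>y. 1 - y\<^sup>2) has_real_derivative - 2 * y) (at y)"
    by (auto intro!: derivative_eq_intros)
  from DERIV_chain2[where g = "\<lambda>y. 1 - y\<^sup>2", OF DERIV_max_0_power[of 0 "1 - y\<^sup>2"] e]
  have "((\<lambda>y. (max 0 (1 - y\<^sup>2))\<^sup>2) has_real_derivative (2 * max 0 (1 - y\<^sup>2)) * (- 2 * y)) (at y)"
    unfolding eqs by (simp add: power2_eq_square)
  from DERIV_mult[OF DERIV_cmult[OF DERIV_ident, of "-6"] this]
  show ?thesis unfolding bump1_def[abs_def] bump2_def by (simp add: power2_eq_square algebra_simps)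
qed

lemma continuous_on_bump2: "continuous_on A bump2"
  unfolding bump2_def[abs_def] by (intro continuous_intros)

lemma bump_bounds: "0 \<le> bump y" "bump y \<le> 1" "\<bar>bump1 y\<bar> \<le> 6" "\<bar>bump2 y\<bar> \<le> 30"
  and bump_support: "1 < \<bar>y\<bar> \<Longrightarrow> bump y = 0 \<and> bump1 y = 0 \<and> bump2 y = 0"
proof -
  define z where "z = max 0 (1 - y\<^sup>2)"
  have z: "0 \<le> z" "z \<le> 1" by (auto simp: z_def)
  then have z2: "0 \<le> z\<^sup>2" "z\<^sup>2 \<le> 1" by (auto simp: power_le_one)
  show "0 \<le> bump y" "bump y \<le> 1" using z by (auto simp: bump_def z_def[symmetric] power_le_one)
  show s: "bump y = 0 \<and> bump1 y = 0 \<and> bump2 y = 0" if "1 < \<bar>y\<bar>"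
  proof -
    have "1 < y\<^sup>2" using that by (metis abs_square_le_1 not_le)
    then show ?thesis by (simp add: bump_def bump1_def bump2_def max_def)
  qed
  show "\<bar>bump1 y\<bar> \<le> 6"
  proof (cases "\<bar>y\<bar> \<le> 1")
    case True
    then have "\<bar>y\<bar> * z\<^sup>2 \<le> 1 * 1" using z2 by (intro mult_mono) auto
    then show ?thesis by (simp add: bump1_def z_def[symmetric] abs_mult)
  qed (use s in auto)
  show "\<bar>bump2 y\<bar> \<le> 30"
  proof (cases "\<bar>y\<bar> \<le> 1")
    case True
    then have "y\<^sup>2 \<le> 1" by (simp add: abs_square_le_1)
    then have "y\<^sup>2 * z \<le> 1 * 1" "0 \<le> y\<^sup>2 * z" using z by (intro mult_mono mult_nonneg_nonneg; simp)+
    then have "\<bar>- 6 * z\<^sup>2 + 24 * (y\<^sup>2 * z)\<bar> \<le> 30" using z2 by linarith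
    then show ?thesis by (simp only: bump2_def z_def[symmetric] mult.assoc)
  qed (use s in auto)
qed

text \<open>Dyadic comparison with a sum of multiples of indicators of balls of radius 2^k: the k-th
  integral is a constant times 2^((n - s) k), a convergent geometric series since s > n.\<close>

lemma integrable_min_1_norm_powr:
  assumes s: "s > real DIM('a::euclidean_space)"
  shows "integrable lborel (\<lambda>x::'a. min 1 (norm x powr - s))"
proof -
  let ?n = "DIM('a)"
  \<comment> \<open>The additional factor 2^s pays for rounding up: when k is the ceiling of log2
    |x|, the norm still exceeds 2^(k-1).\<close>
  define f :: "nat \<Rightarrow> 'a \<Rightarrow> real"
    where "f k x = 2 powr (s - s * real k) * indicator (cball 0 (2 ^ k)) x" for k x
  have s0: "s > 0" using s by (smt (verit) of_nat_0_le_iff)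
  have fin: "emeasure lborel (cball (0::'a) r) < \<infinity>" for r
    using emeasure_lborel_cball_finite[of 0 r] by (simp add: top.not_eq_extremum)
  have fi: "integrable lborel (f k)" for k
    unfolding f_def using fin by (intro integrable_mult_right integrable_real_indicator) auto
  have geo: "summable (\<lambda>k. (2 powr (real ?n - s)) ^ k)" "summable (\<lambda>k. (2 powr (- s)) ^ k)"
    using s s0 by (auto intro!: summable_geometric simp: powr_less_one)
  have eq: "2 powr (s - s * real k) = 2 powr s * (2 powr (- s)) ^ k" for k
    by (simp add: powr_power powr_diff powr_minus field_simps)
  have "(LINT x|lborel. norm (f k x)) = 2 powr s * unit_ball_vol (real ?n) * (2 powr (real ?n - s)) ^ k" for k
  proof -
    have "(LINT x|lborel. norm (f k x)) = 2 powr (s - s * real k) * measure lborel (cball (0::'a) (2 ^ k))"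
      by (simp add: f_def abs_mult)
    also have "\<dots> = 2 powr (s - s * real k) * (unit_ball_vol (real ?n) * (2 ^ k) ^ ?n)"
      by (simp add: content_cball)
    also have "((2::real) ^ k) ^ ?n = 2 powr (real ?n * real k)"
      by (simp add: powr_realpow[symmetric] powr_powr mult.commute)
    also have "2 powr (s - s * real k) * (unit_ball_vol (real ?n) * 2 powr (real ?n * real k))
       = 2 powr s * unit_ball_vol (real ?n) * 2 powr ((real ?n - s) * real k)"
      by (simp add: powr_add[symmetric] algebra_simps powr_diff)
    finally show ?thesis by (simp add: powr_power mult.commute)
  qed
  then have sumi: "summable (\<lambda>k. LINT x|lborel. norm (f k x))"
    using geo(1) by (simp add: summable_mult)
  have sumx: "summable (\<lambda>k. norm (f k x))" for x
  proof (rule summable_comparison_test')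
    show "summable (\<lambda>k. 2 powr s * (2 powr (- s)) ^ k)" using geo(2) by (rule summable_mult)
    show "norm (norm (f k x)) \<le> 2 powr s * (2 powr (- s)) ^ k" for k
      using eq[of k] by (auto simp: f_def indicator_def)
  qed
  have int: "integrable lborel (\<lambda>x. \<Sum>k. f k x)"
    by (rule integrable_suminf[OF fi _ sumi]) (use sumx in auto)
  show ?thesis
  proof (rule Bochner_Integration.integrable_bound[OF int])
    show "(\<lambda>x::'a. min 1 (norm x powr - s)) \<in> borel_measurable lborel" by measurable
    show "AE x in lborel. norm (min 1 (norm x powr - s)) \<le> norm (\<Sum>k. f k x)"
    proof (rule AE_I2)
      fix x :: 'a
      have nn: "0 \<le> f k x" for k by (simp add: f_def)
      have sx: "summable (\<lambda>k. f k x)" using sumx[of x] nn by simp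
      have single: "f k x \<le> (\<Sum>k. f k x)" for k
        using sum_le_suminf[OF sx, of "{k}"] nn by auto
      have "\<exists>k. min 1 (norm x powr - s) \<le> f k x"
      proof (cases "norm x \<le> 1")
        case True
        then have "1 \<le> f 0 x" using s0 by (simp add: f_def ge_one_powr_ge_zero)
        then show ?thesis by (intro exI[of _ 0]) auto
      next
        case False
        define k where "k = nat \<lceil>log 2 (norm x)\<rceil>"
        have x0: "norm x > 0" using False by linarith
        have l: "log 2 (norm x) > 0" using False x0 by simp
        then have k: "log 2 (norm x) \<le> real k" "real k < log 2 (norm x) + 1"
          unfolding k_def by linarith+
        have "norm x \<le> 2 ^ k"
          using k(1) x0 by (simp add: log_le_iff powr_realpow)
        moreover have "norm x powr - s = 2 powr (- s * log 2 (norm x))"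
          using x0 by (metis mult.commute powr_log_cancel powr_powr zero_less_numeral numeral_One numeral_eq_iff semiring_norm(85))
        moreover have "2 powr (- s * log 2 (norm x)) \<le> 2 powr (s - s * real k)"
        proof (intro powr_mono)
          have "s * (real k - 1) \<le> s * log 2 (norm x)" using k(2) s0 by (intro mult_left_mono) auto
          then show "- s * log 2 (norm x) \<le> s - s * real k" by (simp add: algebra_simps)
        qed simp
        ultimately have "norm x powr - s \<le> f k x" by (simp add: f_def)
        then show ?thesis by (intro exI[of _ k]) auto
      qed
      then obtain k where "min 1 (norm x powr - s) \<le> f k x" by blast
      with single[of k] nn[of k] show "norm (min 1 (norm x powr - s)) \<le> norm (\<Sum>k. f k x)" by auto
    qed
  qed
qed

text \<open>Half of the excess s - n is spent on the factor 1 + \<rho>^2, which is at most C exp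
  (\<kappa> \<rho>) for \<rho> \<ge> 0; the remaining power is still integrable at infinity.\<close>

lemma integrable_norm_powr_ln_outside_ball:
  assumes s: "s > real DIM('a::euclidean_space)"
  shows "integrable lborel (\<lambda>x::'a. indicator {x. 1 \<le> norm x} x * (exp (- s * ln (norm x)) * (1 + (ln (norm x))\<^sup>2)))"
proof -
  define \<kappa> where "\<kappa> = (s - real DIM('a)) / 2"
  have \<kappa>: "\<kappa> > 0" "s - \<kappa> > real DIM('a)" using s by (auto simp: \<kappa>_def field_simps)
  \<comment> \<open>From squaring 1 + \<rho> \<le> (1 + 2/\<kappa>) (1 + \<kappa> \<rho>/2) \<le> (1
    + 2/\<kappa>) exp (\<kappa> \<rho>/2).\<close>
  define C where "C = (1 + 2 / \<kappa>)\<^sup>2"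
  have bd: "(1 + \<rho>\<^sup>2) \<le> C * exp (\<kappa> * \<rho>)" if "\<rho> \<ge> 0" for \<rho> :: real
  proof -
    have "1 + \<rho>\<^sup>2 \<le> (1 + \<rho>)\<^sup>2" using that by (simp add: power2_eq_square algebra_simps)
    also have "1 + \<rho> \<le> (1 + 2 / \<kappa>) * exp (\<kappa> * \<rho> / 2)"
    proof -
      have "1 + \<rho> \<le> (1 + 2 / \<kappa>) * (1 + \<kappa> * \<rho> / 2)" using that \<kappa> by (simp add: field_simps)
      also have "\<dots> \<le> (1 + 2 / \<kappa>) * exp (\<kappa> * \<rho> / 2)"
        using \<kappa> by (intro mult_left_mono exp_ge_add_one_self) auto
      finally show ?thesis .
    qed
    then have "(1 + \<rho>)\<^sup>2 \<le> ((1 + 2 / \<kappa>) * exp (\<kappa> * \<rho> / 2))\<^sup>2" using that by (intro power_mono) auto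
    also have "\<dots> = C * exp (\<kappa> * \<rho>)"
      by (simp add: C_def power_mult_distrib exp_double[symmetric])
    finally show ?thesis .
  qed
  have "integrable lborel (\<lambda>x::'a. C * min 1 (norm x powr - (s - \<kappa>)))"
    by (intro integrable_mult_right integrable_min_1_norm_powr \<kappa>(2))
  then show ?thesis
  proof (rule Bochner_Integration.integrable_bound)
    show "AE x::'a in lborel. norm (indicator {x. 1 \<le> norm x} x * (exp (- s * ln (norm x)) * (1 + (ln (norm x))\<^sup>2)))
       \<le> norm (C * min 1 (norm x powr - (s - \<kappa>)))"
    proof (rule AE_I2)
      fix x :: 'a
      have C0: "C \<ge> 0" by (simp add: C_def)
      show "norm (indicator {x. 1 \<le> norm x} x * (exp (- s * ln (norm x)) * (1 + (ln (norm x))\<^sup>2)))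
       \<le> norm (C * min 1 (norm x powr - (s - \<kappa>)))"
      proof (cases "1 \<le> norm x")
        case True
        define \<rho> where "\<rho> = ln (norm x)"
        have \<rho>: "\<rho> \<ge> 0" using True by (simp add: \<rho>_def)
        have p: "norm x powr - (s - \<kappa>) = exp (- (s - \<kappa>) * \<rho>)"
          using True by (auto simp: powr_def \<rho>_def)
        have "exp (- (s - \<kappa>) * \<rho>) \<le> 1" using \<rho> \<kappa>(2) by (auto simp: mult_nonneg_nonneg intro!: mult_nonpos_nonneg)
        then have m: "min 1 (norm x powr - (s - \<kappa>)) = exp (- (s - \<kappa>) * \<rho>)" unfolding p by simp
        have "exp (- s * \<rho>) * (1 + \<rho>\<^sup>2) \<le> exp (- s * \<rho>) * (C * exp (\<kappa> * \<rho>))"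
          by (intro mult_left_mono bd \<rho>) auto
        also have "\<dots> = C * exp (- (s - \<kappa>) * \<rho>)" by (simp add: exp_add[symmetric] algebra_simps)
        finally show ?thesis using True C0 unfolding m by (simp add: \<rho>_def abs_mult)
      qed (use C0 in auto)
    qed
  qed measurable
qed

text \<open>One half of the Gaussian exponent absorbs 1 + \<rho>^2, the other half beats exp (a
  \<rho>) for any real a by completing the square. Taking a = -N bounds the integrand near the
  origin, a = n + 1 - N gives decay like r^(-n-1).\<close>

lemma integrable_log_gaussian:
  fixes N E :: real
  assumes E: "E > 0"
  shows "integrable lborel (\<lambda>x::'a::euclidean_space.
    exp (- N * ln (norm x)) * (1 + (ln (norm x))\<^sup>2) * exp (- E * (1 + (ln (norm x))\<^sup>2)))"
proof -
  define C where "C a = (1 + 2 / E) * exp (a\<^sup>2 / (2 * E))" for a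
  have C0: "C a > 0" for a using E by (simp add: C_def add_pos_pos)
  have bd: "exp (a * \<rho>) * (1 + \<rho>\<^sup>2) * exp (- E * (1 + \<rho>\<^sup>2)) \<le> C a" for a \<rho> :: real
  proof -
    have "1 + \<rho>\<^sup>2 \<le> (1 + 2 / E) * (1 + E * \<rho>\<^sup>2 / 2)" using E by (simp add: field_simps)
    also have "\<dots> \<le> (1 + 2 / E) * exp (E * \<rho>\<^sup>2 / 2)"
      using E by (intro mult_left_mono exp_ge_add_one_self) auto
    finally have "exp (a * \<rho>) * (1 + \<rho>\<^sup>2) * exp (- E * (1 + \<rho>\<^sup>2))
       \<le> exp (a * \<rho>) * ((1 + 2 / E) * exp (E * \<rho>\<^sup>2 / 2)) * exp (- E * (1 + \<rho>\<^sup>2))"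
      by (intro mult_right_mono mult_left_mono) auto
    also have "\<dots> = (1 + 2 / E) * exp (a * \<rho> + E * \<rho>\<^sup>2 / 2 - E * (1 + \<rho>\<^sup>2))"
    proof -
      have "exp (a * \<rho>) * exp (E * \<rho>\<^sup>2 / 2) * exp (- E * (1 + \<rho>\<^sup>2)) = exp (a * \<rho> + E * \<rho>\<^sup>2 / 2 - E * (1 + \<rho>\<^sup>2))"
        by (simp add: exp_add[symmetric])
      moreover have "exp (a * \<rho>) * ((1 + 2 / E) * exp (E * \<rho>\<^sup>2 / 2)) * exp (- E * (1 + \<rho>\<^sup>2))
         = (1 + 2 / E) * (exp (a * \<rho>) * exp (E * \<rho>\<^sup>2 / 2) * exp (- E * (1 + \<rho>\<^sup>2)))"
        by (simp only: mult_ac)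
      ultimately show ?thesis by (simp only:)
    qed
    also have "\<dots> \<le> (1 + 2 / E) * exp (a\<^sup>2 / (2 * E))"
    proof -
      have "0 \<le> (a - E * \<rho>)\<^sup>2 / (2 * E)" using E by simp
      also have "\<dots> = a\<^sup>2 / (2 * E) - a * \<rho> + E * \<rho>\<^sup>2 / 2"
        using E by (simp add: field_simps power2_eq_square)
      finally have "a * \<rho> + E * \<rho>\<^sup>2 / 2 - E * (1 + \<rho>\<^sup>2) \<le> a\<^sup>2 / (2 * E)" using E by (simp add: algebra_simps)
      then show ?thesis using E by (intro mult_left_mono) auto
    qed
    finally show ?thesis by (simp add: C_def)
  qed
  let ?s = "real DIM('a) + 1"
  define M where "M = max (C (- N)) (C (?s - N))"
  have M0: "M > 0" using C0 by (simp add: M_def less_max_iff_disj)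
  have "integrable lborel (\<lambda>x::'a. M * min 1 (norm x powr - ?s))"
    by (intro integrable_mult_right integrable_min_1_norm_powr) simp
  then show ?thesis
  proof (rule Bochner_Integration.integrable_bound)
    \<comment> \<open>The origin has to be excluded: there \<open>ln 0 = 0\<close> makes the
      integrand positive, while the \<open>powr\<close> with base 0 makes the majorant 0.\<close>
    have "AE x::'a in lborel. x \<noteq> 0" by (rule AE_lborel_singleton)
    then show "AE x::'a in lborel. norm (exp (- N * ln (norm x)) * (1 + (ln (norm x))\<^sup>2) * exp (- E * (1 + (ln (norm x))\<^sup>2)))
       \<le> norm (M * min 1 (norm x powr - ?s))"
    proof eventually_elim
      case (elim x)
      define \<rho> where "\<rho> = ln (norm x)"
      have p: "norm x powr - ?s = exp (- ?s * \<rho>)" using elim by (simp add: powr_def \<rho>_def)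
      define g where "g = exp (- N * \<rho>) * (1 + \<rho>\<^sup>2) * exp (- E * (1 + \<rho>\<^sup>2))"
      have g0: "g \<ge> 0" by (simp add: g_def add_nonneg_nonneg)
      have "g \<le> C (- N)" using bd[of "- N" \<rho>] by (simp add: g_def)
      then have 1: "g \<le> M * 1" by (simp add: M_def)
      have "exp (?s * \<rho>) * g \<le> C (?s - N)"
      proof -
        have "exp (?s * \<rho>) * exp (- N * \<rho>) = exp ((?s - N) * \<rho>)"
          by (simp add: exp_add[symmetric] algebra_simps)
        then have "exp (?s * \<rho>) * g = exp ((?s - N) * \<rho>) * (1 + \<rho>\<^sup>2) * exp (- E * (1 + \<rho>\<^sup>2))"
          by (simp only: g_def mult.assoc[symmetric])
        with bd[of "?s - N" \<rho>] show ?thesis by (simp only:)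
      qed
      then have "exp (?s * \<rho>) * g \<le> M" by (simp add: M_def)
      then have "exp (- ?s * \<rho>) * (exp (?s * \<rho>) * g) \<le> exp (- ?s * \<rho>) * M" by (rule mult_left_mono) simp
      moreover have "exp (- ?s * \<rho>) * (exp (?s * \<rho>) * g) = g"
        unfolding mult_minus_left exp_minus by simp
      ultimately have 2: "g \<le> M * exp (- ?s * \<rho>)" by (simp only: mult.commute)
      have "g \<le> M * min 1 (exp (- ?s * \<rho>))" using 1 2 by (simp add: min_def)
      then show ?case using g0 M0 unfolding p \<rho>_def[symmetric] g_def[symmetric] by simp
    qed
  qed measurable
qed

text \<open>For \<gamma> \<le> 1 the power is concave and increasing, so it preserves V2 + d V1
  \<le> 0. The bound on 2 w1 + d w follows from -d w \<le> w1 \<le> 0; this combination is the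
  coefficient of the first derivative of a cutoff when the operator acts on a product.\<close>

lemma weight_properties:
  fixes V V1 V2 :: "real \<Rightarrow> real" and d \<gamma> C :: real
  assumes d1: "\<And>x. (V has_real_derivative V1 x) (at x)"
    and d2: "\<And>x. (V1 has_real_derivative V2 x) (at x)"
    and c2: "continuous_on UNIV V2" and pos: "\<And>x. V x > 0"
    and sup: "\<And>x. V2 x + d * V1 x \<le> 0" and low: "\<And>x. - d * V x \<le> V1 x" and up: "\<And>x. V1 x \<le> 0"
    and bnd: "\<And>x. V x \<le> C * exp (- d * x)" and C: "C > 0" and \<gamma>: "0 < \<gamma>" "\<gamma> \<le> 1" and d: "d > 0"
  obtains w1 w2 where
    "\<And>x. ((\<lambda>x. V x powr \<gamma>) has_real_derivative w1 x) (at x)"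
    "\<And>x. (w1 has_real_derivative w2 x) (at x)"
    "continuous_on UNIV w2"
    "\<And>x. w2 x + d * w1 x \<le> 0"
    "\<And>x. \<bar>2 * w1 x + d * V x powr \<gamma>\<bar> \<le> 3 * d * V x powr \<gamma>"
    "\<And>x. V x powr \<gamma> \<le> C powr \<gamma> * exp (- (d * \<gamma>) * x)"
proof -
  define w where "w x = V x powr \<gamma>" for x
  define w1 where "w1 x = \<gamma> * (V x powr (\<gamma> - 1) * V1 x)" for x
  define w2 where "w2 x = \<gamma> * ((\<gamma> - 1) * V x powr (\<gamma> - 2) * V1 x * V1 x + V x powr (\<gamma> - 1) * V2 x)" for x
  have dp: "((\<lambda>x. V x powr a) has_real_derivative a * V x powr (a - 1) * V1 x) (at x)" for a x
    by (rule DERIV_chain2[where f = "\<lambda>y. y powr a", OF has_real_derivative_powr[OF pos] d1])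
  have D1: "((\<lambda>x. V x powr \<gamma>) has_real_derivative w1 x) (at x)" for x
    using dp[of \<gamma> x] by (simp add: w1_def mult.assoc)
  have D2: "(w1 has_real_derivative w2 x) (at x)" for x
    unfolding w1_def w2_def
    using DERIV_cmult[OF DERIV_mult[OF dp[of "\<gamma> - 1" x] d2[of x]], of \<gamma>] by (simp add: algebra_simps)
  have cV: "continuous_on UNIV V" "continuous_on UNIV V1"
    using d1 d2 by (auto intro!: continuous_at_imp_continuous_on DERIV_isCont)
  have c: "continuous_on UNIV w2"
    unfolding w2_def using pos by (intro continuous_intros cV c2) (auto simp: less_imp_neq[symmetric])
  have S: "w2 x + d * w1 x \<le> 0" for x
  proof -
    have "w2 x + d * w1 x = \<gamma> * ((\<gamma> - 1) * (V x powr (\<gamma> - 2) * (V1 x * V1 x)) + V x powr (\<gamma> - 1) * (V2 x + d * V1 x))"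
      by (simp add: w1_def w2_def algebra_simps)
    also have "\<dots> \<le> 0"
    proof (rule mult_nonneg_nonpos[OF less_imp_le[OF \<gamma>(1)] add_nonpos_nonpos])
      show "(\<gamma> - 1) * (V x powr (\<gamma> - 2) * (V1 x * V1 x)) \<le> 0"
        by (rule mult_nonpos_nonneg) (use \<gamma> in auto)
      show "V x powr (\<gamma> - 1) * (V2 x + d * V1 x) \<le> 0"
        by (rule mult_nonneg_nonpos) (use sup in auto)
    qed
    finally show ?thesis .
  qed
  have w1b: "- d * w x \<le> w1 x" "w1 x \<le> 0" for x
  proof -
    have e: "V x powr (\<gamma> - 1) * V x = w x" using pos[of x] by (simp add: w_def powr_diff)
    have "V x powr (\<gamma> - 1) * (- d * V x) \<le> V x powr (\<gamma> - 1) * V1 x"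
      by (intro mult_left_mono low) auto
    then have l: "- d * w x \<le> V x powr (\<gamma> - 1) * V1 x" using e by (simp add: algebra_simps)
    have n: "V x powr (\<gamma> - 1) * V1 x \<le> 0" by (intro mult_nonneg_nonpos up) auto
    show "w1 x \<le> 0" unfolding w1_def by (rule mult_nonneg_nonpos[OF less_imp_le[OF \<gamma>(1)] n])
    have "1 * (V x powr (\<gamma> - 1) * V1 x) \<le> \<gamma> * (V x powr (\<gamma> - 1) * V1 x)"
      using \<gamma> n by (intro mult_right_mono_neg) auto
    with l show "- d * w x \<le> w1 x" unfolding w1_def by simp
  qed
  have b: "\<bar>2 * w1 x + d * V x powr \<gamma>\<bar> \<le> 3 * d * V x powr \<gamma>" for x
  proof -
    have "0 \<le> d * w x" using d by (simp add: w_def)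
    with w1b[of x] show ?thesis unfolding w_def by (simp add: abs_le_iff)
  qed
  have u: "V x powr \<gamma> \<le> C powr \<gamma> * exp (- (d * \<gamma>) * x)" for x
  proof -
    have "V x powr \<gamma> \<le> (C * exp (- d * x)) powr \<gamma>"
      using \<gamma> pos[of x] bnd[of x] by (intro powr_mono2) auto
    also have "\<dots> = C powr \<gamma> * exp (- (d * \<gamma>) * x)"
      using C by (simp add: powr_mult) (simp add: powr_def)
    finally show ?thesis .
  qed
  show ?thesis by (rule that[OF D1 D2 c S b u])
qed

definition cutoff_weight :: "(real \<Rightarrow> real) \<Rightarrow> real \<Rightarrow> real \<Rightarrow> real \<Rightarrow> real" where
  "cutoff_weight w E k \<rho> = w \<rho> * (exp (- E * (1 + \<rho>\<^sup>2)) * bump (\<rho> / k))"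

text \<open>Applied to w \<eta>, the operator gives (w'' + d w') \<eta> + (2 w' + d w) \<eta>' + w
  \<eta>''. The first term is nonpositive. Derivatives of the Gaussian reproduce \<eta> with a
  factor of order E (1 + x^2), whereas each derivative of the bump brings a factor of order 1/k but
  loses the bump itself.\<close>

lemma cutoff_weight_properties:
  fixes w w1 w2 :: "real \<Rightarrow> real" and d D E k :: real
  assumes d1: "\<And>x. (w has_real_derivative w1 x) (at x)"
    and d2: "\<And>x. (w1 has_real_derivative w2 x) (at x)"
    and c2: "continuous_on UNIV w2" and pos: "\<And>x. w x \<ge> 0"
    and sup: "\<And>x. w2 x + d * w1 x \<le> 0"
    and D: "\<And>x. \<bar>2 * w1 x + d * w x\<bar> \<le> D * w x" "D \<ge> 0"
    and E: "0 \<le> E" "E \<le> 1" and k: "k \<ge> 1"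
  obtains \<phi>1 \<phi>2 where
    "\<And>x. (cutoff_weight w E k has_real_derivative \<phi>1 x) (at x)"
    "\<And>x. (\<phi>1 has_real_derivative \<phi>2 x) (at x)"
    "continuous_on UNIV \<phi>2"
    "\<And>x. k < \<bar>x\<bar> \<Longrightarrow> cutoff_weight w E k x = 0 \<and> \<phi>1 x = 0 \<and> \<phi>2 x = 0"
    "\<And>x. \<phi>2 x + d * \<phi>1 x \<le> (D + 4) * E * (1 + x\<^sup>2) * cutoff_weight w E k x
        + (6 * D + 42) / k * (1 + x\<^sup>2) * w x * exp (- E * (1 + x\<^sup>2))"
proof -
  define e where "e x = exp (- E * (1 + x\<^sup>2))" for x
  define b where "b x = bump (x / k)" for x
  define b1 where "b1 x = bump1 (x / k) / k" for x
  define b2 where "b2 x = bump2 (x / k) / k\<^sup>2" for x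
  define \<eta> where "\<eta> x = e x * b x" for x
  define \<eta>1 where "\<eta>1 x = - 2 * E * x * (e x * b x) + e x * b1 x" for x
  define \<eta>2 where "\<eta>2 x = (4 * E\<^sup>2 * x\<^sup>2 - 2 * E) * (e x * b x) - 4 * E * x * (e x * b1 x) + e x * b2 x" for x
  define \<phi>1 where "\<phi>1 x = w1 x * \<eta> x + w x * \<eta>1 x" for x
  define \<phi>2 where "\<phi>2 x = w2 x * \<eta> x + 2 * w1 x * \<eta>1 x + w x * \<eta>2 x" for x
  have k0: "k > 0" using k by simp
  have \<phi>: "cutoff_weight w E k x = w x * \<eta> x" for x by (simp add: cutoff_weight_def \<eta>_def e_def b_def)
  have dk: "((\<lambda>x. x / k) has_real_derivative 1 / k) (at x)" for x
    using k0 by (auto intro!: derivative_eq_intros)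
  have de: "(e has_real_derivative - 2 * E * x * e x) (at x)" for x
    unfolding e_def by (auto intro!: derivative_eq_intros)
  have db: "(b has_real_derivative b1 x) (at x)" for x
    using DERIV_chain2[OF DERIV_bump dk] unfolding b_def b1_def by simp
  have db1: "(b1 has_real_derivative b2 x) (at x)" for x
    using DERIV_cdivide[OF DERIV_chain2[OF DERIV_bump1 dk], of k] unfolding b1_def b2_def
    by (simp add: power2_eq_square)
  have d\<eta>: "(\<eta> has_real_derivative \<eta>1 x) (at x)" for x
    unfolding \<eta>_def \<eta>1_def by (auto intro!: derivative_eq_intros de db simp: algebra_simps)
  have d\<eta>1: "(\<eta>1 has_real_derivative \<eta>2 x) (at x)" for x
    unfolding \<eta>1_def \<eta>2_def
    by (auto intro!: derivative_eq_intros de db db1 simp: algebra_simps power2_eq_square)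
  have 1: "(cutoff_weight w E k has_real_derivative \<phi>1 x) (at x)" for x
    unfolding \<phi> \<phi>1_def using DERIV_mult[OF d1[of x] d\<eta>[of x]] by (simp add: mult.commute \<phi> fun_eq_iff[symmetric])
  have 2: "(\<phi>1 has_real_derivative \<phi>2 x) (at x)" for x
    unfolding \<phi>1_def \<phi>2_def
    by (auto intro!: derivative_eq_intros d1 d2 d\<eta> d\<eta>1 simp: algebra_simps)
  have cw: "continuous_on UNIV w" "continuous_on UNIV w1" "continuous_on UNIV \<eta>" "continuous_on UNIV \<eta>1"
    "continuous_on UNIV e" "continuous_on UNIV b" "continuous_on UNIV b1"
    using d1 d2 d\<eta> d\<eta>1 de db db1 by (auto intro!: continuous_at_imp_continuous_on DERIV_isCont)
  have cb2: "continuous_on UNIV b2"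
    unfolding b2_def
    by (intro continuous_intros continuous_on_compose2[OF continuous_on_bump2[of UNIV]]) (use k0 in auto)
  have 3: "continuous_on UNIV \<phi>2"
    unfolding \<phi>2_def \<eta>2_def by (intro continuous_intros cw c2 cb2)
  have 4: "cutoff_weight w E k x = 0 \<and> \<phi>1 x = 0 \<and> \<phi>2 x = 0" if "k < \<bar>x\<bar>" for x
  proof -
    have "1 < \<bar>x / k\<bar>" using that k0 by simp
    from bump_support[OF this] show ?thesis
      by (simp add: \<phi> \<phi>1_def \<phi>2_def \<eta>_def \<eta>1_def \<eta>2_def b_def b1_def b2_def)
  qed
  have 5: "\<phi>2 x + d * \<phi>1 x \<le> (D + 4) * E * (1 + x\<^sup>2) * cutoff_weight w E k x
        + (6 * D + 42) / k * (1 + x\<^sup>2) * w x * exp (- E * (1 + x\<^sup>2))" for x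
  proof -
    \<comment> \<open>X is a common bound for 1, x^2 and 2 |x|, the polynomial factors that
      differentiation of the Gaussian produces.\<close>
    define X where "X = 1 + x\<^sup>2"
    have "0 \<le> (\<bar>x\<bar> - 1)\<^sup>2" by simp
    then have X: "X \<ge> 1" "2 * \<bar>x\<bar> \<le> X" by (simp_all add: X_def power2_eq_square algebra_simps)
    have e0: "e x > 0" by (simp add: e_def)
    have bb: "0 \<le> b x" "b x \<le> 1" using bump_bounds by (auto simp: b_def)
    have b1: "\<bar>b1 x\<bar> \<le> 6 / k" unfolding b1_def using bump_bounds(3) k0 by (simp add: divide_right_mono)
    have b2: "\<bar>b2 x\<bar> \<le> 30 / k"
    proof -
      have "\<bar>b2 x\<bar> \<le> 30 / k\<^sup>2" unfolding b2_def using bump_bounds(4) k0 by (simp add: divide_right_mono)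
      also have "\<dots> \<le> 30 / k" using k by (simp add: power2_eq_square field_simps)
      finally show ?thesis .
    qed
    have \<eta>0: "\<eta> x \<ge> 0" using e0 bb by (simp add: \<eta>_def)
    have eb1: "\<bar>e x * b1 x\<bar> \<le> 6 / k * e x"
      using mult_right_mono[OF b1 less_imp_le[OF e0]] e0 by (simp add: abs_mult mult.commute)
    have eb2: "e x * b2 x \<le> 30 / k * e x"
      using mult_right_mono[OF order_trans[OF abs_ge_self b2] less_imp_le[OF e0]] by (simp add: mult.commute)
    have EX: "2 * E * \<bar>x\<bar> \<le> E * X" using X(2) E(1) mult_left_mono[OF X(2) E(1)] by (simp add: algebra_simps)
    have a1: "\<bar>\<eta>1 x\<bar> \<le> E * X * \<eta> x + 6 / k * e x"
    proof -
      have "\<bar>\<eta>1 x\<bar> \<le> \<bar>- 2 * E * x * \<eta> x\<bar> + \<bar>e x * b1 x\<bar>" by (simp add: \<eta>1_def \<eta>_def)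
      also have "\<bar>- 2 * E * x * \<eta> x\<bar> = 2 * E * \<bar>x\<bar> * \<eta> x" using E \<eta>0 by (simp add: abs_mult)
      also have "\<dots> \<le> E * X * \<eta> x" by (intro mult_right_mono EX \<eta>0)
      finally show ?thesis using eb1 by simp
    qed
    \<comment> \<open>Here 42 = 12 + 30: the cross term gives 2 X times 6/k, the second derivative
      of the bump 30/k. The condition E \<le> 1 turns E^2 into E.\<close>
    have a2: "\<eta>2 x \<le> 4 * E * X * \<eta> x + (42 / k) * X * e x"
    proof -
      have i: "(4 * E\<^sup>2 * x\<^sup>2 - 2 * E) * \<eta> x \<le> 4 * E * X * \<eta> x"
      proof (rule mult_right_mono[OF _ \<eta>0])
        have "E\<^sup>2 * x\<^sup>2 \<le> E * x\<^sup>2" using E by (intro mult_right_mono) (auto simp: power2_eq_square mult_left_le)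
        then show "4 * E\<^sup>2 * x\<^sup>2 - 2 * E \<le> 4 * E * X" using E by (simp add: X_def algebra_simps)
      qed
      have ii: "- 4 * E * x * (e x * b1 x) \<le> 12 / k * X * e x"
      proof -
        have "- 4 * E * x * (e x * b1 x) \<le> \<bar>- 4 * E * x * (e x * b1 x)\<bar>" by simp
        also have "\<dots> = (2 * (2 * E * \<bar>x\<bar>)) * \<bar>e x * b1 x\<bar>" using E by (simp add: abs_mult)
        also have "\<dots> \<le> (2 * X) * (6 / k * e x)"
        proof (rule mult_mono[OF _ eb1])
          have "E * X \<le> 1 * X" using E X by (intro mult_right_mono) auto
          then show "2 * (2 * E * \<bar>x\<bar>) \<le> 2 * X" using EX by simp
        qed (use X in auto)
        finally show ?thesis by simp
      qed
      have iii: "30 / k * e x \<le> 30 / k * X * e x"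
        using X(1) e0 k0 by (simp add: divide_right_mono mult_left_mono)
      have "\<eta>2 x = (4 * E\<^sup>2 * x\<^sup>2 - 2 * E) * \<eta> x - 4 * E * x * (e x * b1 x) + e x * b2 x"
        by (simp add: \<eta>2_def \<eta>_def)
      also have "\<dots> \<le> 4 * E * X * \<eta> x + 12 / k * X * e x + 30 / k * X * e x"
        using i ii iii eb2 by simp
      also have "\<dots> = 4 * E * X * \<eta> x + (42 / k) * X * e x" by (simp add: algebra_simps add_divide_distrib[symmetric])
      finally show ?thesis .
    qed
    have "\<phi>2 x + d * \<phi>1 x = (w2 x + d * w1 x) * \<eta> x + (2 * w1 x + d * w x) * \<eta>1 x + w x * \<eta>2 x"
      by (simp add: \<phi>2_def \<phi>1_def algebra_simps)
    also have "\<dots> \<le> 0 + (D * w x) * (E * X * \<eta> x + 6 / k * e x) + w x * (4 * E * X * \<eta> x + (42 / k) * X * e x)"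
    proof (intro add_mono mult_left_mono a2 pos)
      show "(w2 x + d * w1 x) * \<eta> x \<le> 0" using sup \<eta>0 by (rule mult_nonpos_nonneg)
      have "(2 * w1 x + d * w x) * \<eta>1 x \<le> \<bar>2 * w1 x + d * w x\<bar> * \<bar>\<eta>1 x\<bar>"
        by (metis abs_ge_self abs_mult)
      also have "\<dots> \<le> (D * w x) * (E * X * \<eta> x + 6 / k * e x)"
        using D pos[of x] by (intro mult_mono a1) auto
      finally show "(2 * w1 x + d * w x) * \<eta>1 x \<le> (D * w x) * (E * X * \<eta> x + 6 / k * e x)" .
    qed
    also have "\<dots> \<le> 0 + (D * w x) * (E * X * \<eta> x + 6 / k * X * e x) + w x * (4 * E * X * \<eta> x + (42 / k) * X * e x)"
    proof -
      have "6 / k * e x \<le> 6 / k * X * e x" using X(1) e0 k0 by (simp add: divide_right_mono mult_left_mono)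
      then have "(D * w x) * (E * X * \<eta> x + 6 / k * e x) \<le> (D * w x) * (E * X * \<eta> x + 6 / k * X * e x)"
        using D(2) pos[of x] by (intro mult_left_mono) auto
      then show ?thesis by simp
    qed
    also have "\<dots> = (D + 4) * E * X * (w x * \<eta> x) + (6 * D + 42) / k * X * w x * e x"
      using k0 by (simp add: field_simps)
    finally show ?thesis by (simp add: X_def e_def \<phi>)
  qed
  show ?thesis by (rule that[OF 1 2 3 4 5])
qed

section \<open>The growth estimate\<close>

text \<open>
  The weight is superharmonic, so only derivatives of the cutoff contribute to the growth of the
  integral. Near the origin \<open>|a| \<le> A0 r\<^sup>2 |\<delta>|\<close> lets the time derivative of the factor
  \<open>exp (-\<epsilon> e\<^bsup>Mt\<^esup> (1 + \<rho>\<^sup>2))\<close> absorb them; far out \<open>|a| \<le> A1 r\<^bsup>-d\<^esup>\<close> makes them small with \<open>\<epsilon>\<close>.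
\<close>

lemma weighted_l1_growth:
  fixes \<delta> \<delta>t a :: "'a::euclidean_space \<Rightarrow> real \<Rightarrow> real" and a1 a2 :: "'a \<Rightarrow> 'a \<Rightarrow> real \<Rightarrow> real"
  defines "d \<equiv> real DIM('a) - 2"
  assumes t1: "0 \<le> t1" "t1 \<le> T"
    and d\<delta>: "\<And>x t. x \<noteq> 0 \<Longrightarrow> t \<in> {t1..T} \<Longrightarrow> (\<delta> x has_real_derivative \<delta>t x t) (at t)"
    and c\<delta>: "continuous_on ((- {0}) \<times> {t1..T}) (\<lambda>z. \<delta> (fst z) (snd z))"
    and c\<delta>t: "continuous_on ((- {0}) \<times> {t1..T}) (\<lambda>z. \<delta>t (fst z) (snd z))"
    and da: "\<And>x t b. x \<noteq> 0 \<Longrightarrow> t \<in> {t1..T} \<Longrightarrow> b \<in> Basis \<Longrightarrow>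
      ((\<lambda>s. a (x + s *\<^sub>R b) t) has_real_derivative a1 b x t) (at 0)"
    and da1: "\<And>x t b. x \<noteq> 0 \<Longrightarrow> t \<in> {t1..T} \<Longrightarrow> b \<in> Basis \<Longrightarrow>
      ((\<lambda>s. a1 b (x + s *\<^sub>R b) t) has_real_derivative a2 b x t) (at 0)"
    and ca: "\<And>t. t \<in> {t1..T} \<Longrightarrow> continuous_on (- {0}) (\<lambda>x. a x t)"
      "\<And>t b. t \<in> {t1..T} \<Longrightarrow> b \<in> Basis \<Longrightarrow> continuous_on (- {0}) (\<lambda>x. a1 b x t)"
      "\<And>t b. t \<in> {t1..T} \<Longrightarrow> b \<in> Basis \<Longrightarrow> continuous_on (- {0}) (\<lambda>x. a2 b x t)"
    and pde: "\<And>x t. x \<noteq> 0 \<Longrightarrow> t \<in> {t1..T} \<Longrightarrow> \<delta>t x t = cn * (\<Sum>b\<in>Basis. a2 b x t)" and cn: "cn > 0"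
    and sg: "\<And>x t. x \<noteq> 0 \<Longrightarrow> t \<in> {t1..T} \<Longrightarrow> sgn (a x t) = sgn (\<delta> x t)"
    and near: "\<And>x t. x \<noteq> 0 \<Longrightarrow> t \<in> {t1..T} \<Longrightarrow> norm x \<le> 1 \<Longrightarrow> \<bar>a x t\<bar> \<le> A0 * (norm x)\<^sup>2 * \<bar>\<delta> x t\<bar>"
    and far: "\<And>x t. x \<noteq> 0 \<Longrightarrow> t \<in> {t1..T} \<Longrightarrow> \<bar>a x t\<bar> \<le> A1 * exp (- d * ln (norm x))"
    and A: "A0 \<ge> 0" "A1 \<ge> 0"
    and w1: "\<And>x. (w has_real_derivative w1 x) (at x)"
    and w2: "\<And>x. (w1 has_real_derivative w2 x) (at x)"
    and cw2: "continuous_on UNIV w2" and wpos: "\<And>x. w x \<ge> 0"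
    and sup: "\<And>x. w2 x + d * w1 x \<le> 0"
    and D: "\<And>x. \<bar>2 * w1 x + d * w x\<bar> \<le> D * w x" "D \<ge> 0"
    and wb: "\<And>x. w x \<le> Cw * exp (- Nw * x)" and Cw: "Cw \<ge> 0" and Nw: "Nw > 0"
    and \<epsilon>: "\<epsilon> > 0" and M: "M = cn * A0 * (D + 4)" and \<epsilon>1: "\<epsilon> * exp (M * T) \<le> 1" and k: "k \<ge> 1"
  defines "\<psi> \<equiv> \<lambda>t. radial (cutoff_weight w (\<epsilon> * exp (M * t)) k)"
  shows "(LINT x|lborel. indicator (annulus k) x * (\<bar>\<delta> x T\<bar> * \<psi> T x))
    \<le> (LINT x|lborel. indicator (annulus k) x * (\<bar>\<delta> x t1\<bar> * \<psi> t1 x))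
      + cn * A1 * Cw * ((D + 4) * (\<epsilon> * exp (M * T)) * (LINT x|lborel. indicator {x::'a. 1 \<le> norm x} x *
            (exp (- (real DIM('a) + Nw) * ln (norm x)) * (1 + (ln (norm x))\<^sup>2)))
        + (6 * D + 42) / k * (LINT x::'a|lborel. exp (- (real DIM('a) + Nw) * ln (norm x)) * (1 + (ln (norm x))\<^sup>2)
            * exp (- \<epsilon> * (1 + (ln (norm x))\<^sup>2)))) * (T - t1)"
proof -
  \<comment> \<open>The powers of 1/r collected in the estimates: d from \<open>far\<close>, 2 from
    the Laplacian, \<open>Nw\<close> from the weight. Since d + 2 is the dimension, N exceeds
    it.\<close>
  define N where "N = real DIM('a) + Nw"
  define K where "K = (annulus k :: 'a set)"
  have K: "compact K" "K \<subseteq> - {0}" using compact_annulus annulus_subset_punctured by (auto simp: K_def)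
  have K0: "x \<noteq> 0" if "x \<in> K" for x using that K(2) by auto
  define E where "E t = \<epsilon> * exp (M * t)" for t
  have M0: "M \<ge> 0" using cn A D(2) by (simp add: M)
  have E: "0 < E t" "\<epsilon> \<le> E t" "E t \<le> E T" "E t \<le> 1" if "t \<in> {t1..T}" for t
  proof -
    have t: "0 \<le> t" "t \<le> T" using that t1 by auto
    show "0 < E t" using \<epsilon> by (simp add: E_def)
    show "\<epsilon> \<le> E t" using \<epsilon> M0 t by (simp add: E_def)
    show "E t \<le> E T" using \<epsilon> M0 t by (simp add: E_def mult_left_mono)
    then show "E t \<le> 1" using \<epsilon>1 by (simp add: E_def)
  qed
  define \<rho> where "\<rho> x = ln (norm x)" for x :: 'a
  have \<psi>: "\<psi> t x = w (\<rho> x) * (exp (- E t * (1 + (\<rho> x)\<^sup>2)) * bump (\<rho> x / k))" if "x \<in> K" for t x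
    using K0[OF that] by (simp add: \<psi>_def radial_def cutoff_weight_def E_def \<rho>_def)
  have \<psi>0: "\<psi> t x \<ge> 0" for t x
    using wpos bump_bounds(1) by (simp add: \<psi>_def radial_def cutoff_weight_def)
  have cw: "continuous_on UNIV w" using w1 by (auto intro!: continuous_at_imp_continuous_on DERIV_isCont)
  have cb: "continuous_on UNIV bump" using DERIV_bump by (auto intro!: continuous_at_imp_continuous_on DERIV_isCont)
  have c\<rho>: "continuous_on (- {0}) \<rho>" unfolding \<rho>_def by (intro continuous_intros) auto
  define P where "P x t = \<delta> x t * \<psi> t x" for x t
  \<comment> \<open>The second summand is the time derivative of the Gaussian factor, whose
    coefficient satisfies E' = M E.\<close>
  define P' where "P' x t = \<delta>t x t * \<psi> t x + \<delta> x t * (- M * E t * (1 + (\<rho> x)\<^sup>2) * \<psi> t x)" for x t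
  have dP: "(P x has_real_derivative P' x t) (at t)" if x: "x \<in> K" and t: "t \<in> {t1..T}" for x t
  proof -
    have "((\<lambda>t. \<psi> t x) has_real_derivative - M * E t * (1 + (\<rho> x)\<^sup>2) * \<psi> t x) (at t)"
      unfolding \<psi>[OF x] unfolding E_def by (auto intro!: derivative_eq_intros)
    from DERIV_mult[OF d\<delta>[OF K0[OF x] t] this] show ?thesis
      unfolding P_def P'_def by (simp add: mult.commute add.commute)
  qed
  have c\<psi>: "continuous_on (K \<times> {t1..T}) (\<lambda>z. \<psi> (snd z) (fst z))"
  proof -
    have "continuous_on (K \<times> {t1..T}) (\<lambda>z. w (\<rho> (fst z)) * (exp (- E (snd z) * (1 + (\<rho> (fst z))\<^sup>2)) * bump (\<rho> (fst z) / k)))"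
      unfolding E_def using K0 k
      by (intro continuous_intros continuous_on_compose2[OF cw] continuous_on_compose2[OF cb]
         continuous_on_compose2[OF c\<rho>]) auto
    then show ?thesis by (rule continuous_on_eq) (auto simp: \<psi>)
  qed
  have sub: "K \<times> {t1..T} \<subseteq> (- {0}) \<times> {t1..T}" using K(2) by auto
  have c\<rho>K: "continuous_on (K \<times> {t1..T}) (\<lambda>z. \<rho> (fst z))"
    by (intro continuous_on_compose2[OF c\<rho>] continuous_intros) (use K0 in auto)
  have cP': "continuous_on (K \<times> {t1..T}) (\<lambda>z. P' (fst z) (snd z))"
    unfolding P'_def E_def
    by (intro continuous_intros c\<psi> c\<rho>K continuous_on_subset[OF c\<delta> sub] continuous_on_subset[OF c\<delta>t sub])
  have slice: "continuous_on K (\<lambda>x. f (x, t))" if "continuous_on (K \<times> {t1..T}) f" "t \<in> {t1..T}" for f :: "'a \<times> real \<Rightarrow> real" and t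
    by (rule continuous_on_compose2[OF that(1)]) (use that(2) in \<open>auto intro!: continuous_intros\<close>)
  have c\<psi>t: "continuous_on K (\<psi> t)" if "t \<in> {t1..T}" for t
    using slice[OF c\<psi> that] by simp
  have c\<delta>s: "continuous_on K (\<lambda>x. \<delta> x t)" if "t \<in> {t1..T}" for t
    using slice[OF continuous_on_subset[OF c\<delta> sub] that] by simp
  have cP: "continuous_on K (\<lambda>x. P x t)" if "t \<in> {t1..T}" for t
    unfolding P_def by (intro continuous_intros c\<psi>t c\<delta>s that)
  \<comment> \<open>F1 majorizes the terms of order E outside the unit ball, F2 the terms of order
    1/k everywhere. Their combination H bounds the growth rate uniformly in t.\<close>
  define F1 where "F1 x = indicator {x::'a. 1 \<le> norm x} x * (exp (- N * ln (norm x)) * (1 + (ln (norm x))\<^sup>2))" for x :: 'a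
  define F2 where "F2 x = exp (- N * ln (norm x)) * (1 + (ln (norm x))\<^sup>2) * exp (- \<epsilon> * (1 + (ln (norm x))\<^sup>2))" for x :: 'a
  have iF1: "integrable lborel F1" unfolding F1_def
    by (rule integrable_norm_powr_ln_outside_ball) (use Nw in \<open>simp add: N_def\<close>)
  have iF2: "integrable lborel F2" unfolding F2_def by (rule integrable_log_gaussian[OF \<epsilon>])
  define H where "H x = cn * A1 * Cw * ((D + 4) * E T * F1 x + (6 * D + 42) / k * F2 x)" for x
  have iH: "integrable lborel H" unfolding H_def
    by (intro integrable_mult_right Bochner_Integration.integrable_add iF1 iF2)
  have ET: "E T > 0" using \<epsilon> by (simp add: E_def)
  have F0: "F1 x \<ge> 0" "F2 x \<ge> 0" for x by (auto simp: F1_def F2_def add_nonneg_nonneg)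
  have H0: "H x \<ge> 0" for x
    unfolding H_def using cn A Cw D(2) F0 ET k
    by (intro mult_nonneg_nonneg add_nonneg_nonneg divide_nonneg_nonneg) auto
  have bound: "(LINT x|lborel. indicator K x * (sgn (P x t) * P' x t)) \<le> integral\<^sup>L lborel H"
    if t: "t \<in> {t1..T}" for t
  proof -
    note Et = E[OF t]
    obtain \<phi>1 \<phi>2 where \<phi>:
      "\<And>x. (cutoff_weight w (E t) k has_real_derivative \<phi>1 x) (at x)"
      "\<And>x. (\<phi>1 has_real_derivative \<phi>2 x) (at x)"
      "continuous_on UNIV \<phi>2"
      "\<And>x. k < \<bar>x\<bar> \<Longrightarrow> cutoff_weight w (E t) k x = 0 \<and> \<phi>1 x = 0 \<and> \<phi>2 x = 0"
      "\<And>x. \<phi>2 x + d * \<phi>1 x \<le> (D + 4) * E t * (1 + x\<^sup>2) * cutoff_weight w (E t) k x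
        + (6 * D + 42) / k * (1 + x\<^sup>2) * w x * exp (- E t * (1 + x\<^sup>2))"
      by (rule cutoff_weight_properties[OF w1 w2 cw2 wpos sup D less_imp_le[OF Et(1)] Et(4) k])
        (rule that; blast)
    have \<psi>t: "\<psi> t = radial (cutoff_weight w (E t) k)" by (simp add: \<psi>_def E_def)
    let ?L = "\<lambda>b x. radial_line_deriv2 \<phi>1 \<phi>2 b x"
    have test: "((\<lambda>s. \<psi> t (x + s *\<^sub>R b)) has_real_derivative radial_line_deriv \<phi>1 b x) (at 0)"
      "((\<lambda>s. radial_line_deriv \<phi>1 b (x + s *\<^sub>R b)) has_real_derivative ?L b x) (at 0)"
      "continuous_on UNIV (\<psi> t)" "continuous_on UNIV (radial_line_deriv \<phi>1 b)" "continuous_on UNIV (?L b)"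
      "x \<notin> K \<Longrightarrow> \<psi> t x = 0 \<and> radial_line_deriv \<phi>1 b x = 0 \<and> ?L b x = 0" for x b
      unfolding \<psi>t K_def
      by (rule radial_test_function(1)[OF \<phi>(1-4)] radial_test_function(2)[OF \<phi>(1-4)]
        radial_test_function(3)[OF \<phi>(1-4)] radial_test_function(4)[OF \<phi>(1-4)]
        radial_test_function(5)[OF \<phi>(1-4)] radial_test_function(6)[OF \<phi>(1-4)]; assumption)+
    have kato: "integrable lborel (\<lambda>x. indicator K x * (\<psi> t x * sgn (a x t) * a2 b x t))"
      "integrable lborel (\<lambda>x. indicator K x * (\<bar>a x t\<bar> * ?L b x))"
      "(LINT x|lborel. indicator K x * (\<psi> t x * sgn (a x t) * a2 b x t))
        \<le> (LINT x|lborel. indicator K x * (\<bar>a x t\<bar> * ?L b x))" if b: "b \<in> Basis" for b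
    proof -
      have S: "open (- {0::'a})" by auto
      have 1: "((\<lambda>s. a (x + s *\<^sub>R b) t) has_real_derivative a1 b x t) (at 0)" if "x \<in> - {0}" for x
        using da[OF _ t b] that by auto
      have 2: "((\<lambda>s. a1 b (x + s *\<^sub>R b) t) has_real_derivative a2 b x t) (at 0)" if "x \<in> - {0}" for x
        using da1[OF _ t b] that by auto
      note kk = kato_integral_inequality[OF K S, where a = "\<lambda>x. a x t" and ?a1.0 = "\<lambda>x. a1 b x t" and ?a2.0 = "\<lambda>x. a2 b x t",
        OF 1 2 ca(1)[OF t] ca(2)[OF t b] ca(3)[OF t b] test(1-6) \<psi>0]
      show "integrable lborel (\<lambda>x. indicator K x * (\<psi> t x * sgn (a x t) * a2 b x t))"
        "integrable lborel (\<lambda>x. indicator K x * (\<bar>a x t\<bar> * ?L b x))"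
        "(LINT x|lborel. indicator K x * (\<psi> t x * sgn (a x t) * a2 b x t))
        \<le> (LINT x|lborel. indicator K x * (\<bar>a x t\<bar> * ?L b x))"
        using kk by auto
    qed
    \<comment> \<open>The gain from the decay of \<psi> in time; it has to absorb the terms of order
      E inside the unit ball.\<close>
    define Z where "Z x = indicator K x * (M * E t * (1 + (\<rho> x)\<^sup>2) * \<psi> t x * \<bar>\<delta> x t\<bar>)" for x
    have iZ: "integrable lborel Z"
      unfolding Z_def
      by (intro integrable_indicator_continuous K continuous_intros c\<psi>t c\<delta>s t continuous_on_subset[OF c\<rho>])
    have lin: "(LINT x|lborel. cn * (\<Sum>b\<in>Basis. f b x) - Z x) = cn * (\<Sum>b\<in>Basis. integral\<^sup>L lborel (f b)) - integral\<^sup>L lborel Z"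
      if "\<And>b. b \<in> Basis \<Longrightarrow> integrable lborel (f b)" for f :: "'a \<Rightarrow> 'a \<Rightarrow> real"
      using that iZ by (simp add: Bochner_Integration.integral_sum)
    have "(LINT x|lborel. indicator K x * (sgn (P x t) * P' x t))
      = (LINT x|lborel. cn * (\<Sum>b\<in>Basis. indicator K x * (\<psi> t x * sgn (a x t) * a2 b x t)) - Z x)"
    proof (rule Bochner_Integration.integral_cong[OF refl])
      fix x
      show "indicator K x * (sgn (P x t) * P' x t) = cn * (\<Sum>b\<in>Basis. indicator K x * (\<psi> t x * sgn (a x t) * a2 b x t)) - Z x"
      proof (cases "x \<in> K")
        case True
        \<comment> \<open>Where \<psi> vanishes the sign of P is 0 whatever that of \<delta>; the
          factor \<psi> hides the difference.\<close>
        have s: "sgn (P x t) * \<psi> t x = sgn (\<delta> x t) * \<psi> t x"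
          using \<psi>0[of t x] by (cases "\<psi> t x = 0") (auto simp: P_def sgn_mult)
        have "sgn (P x t) * P' x t = (sgn (P x t) * \<psi> t x) * (\<delta>t x t - M * E t * (1 + (\<rho> x)\<^sup>2) * \<delta> x t)"
          by (simp add: P'_def algebra_simps)
        also have "\<dots> = \<psi> t x * sgn (\<delta> x t) * \<delta>t x t - M * E t * (1 + (\<rho> x)\<^sup>2) * \<psi> t x * (sgn (\<delta> x t) * \<delta> x t)"
          unfolding s by (simp add: algebra_simps)
        also have "sgn (\<delta> x t) * \<delta> x t = \<bar>\<delta> x t\<bar>" by (simp add: abs_sgn mult.commute)
        \<comment> \<open>As a and \<delta> have the same sign, the equation for \<delta> yields
          precisely the expression that Kato's inequality for a controls.\<close>
        also have "\<psi> t x * sgn (\<delta> x t) * \<delta>t x t = cn * (\<Sum>b\<in>Basis. \<psi> t x * sgn (a x t) * a2 b x t)"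
          unfolding pde[OF K0[OF True] t] sg[OF K0[OF True] t] by (simp add: sum_distrib_left mult_ac)
        finally show ?thesis using True by (simp add: Z_def)
      qed (simp add: Z_def)
    qed
    also have "\<dots> = cn * (\<Sum>b\<in>Basis. LINT x|lborel. indicator K x * (\<psi> t x * sgn (a x t) * a2 b x t)) - integral\<^sup>L lborel Z"
      by (rule lin[OF kato(1)])
    also have "\<dots> \<le> cn * (\<Sum>b\<in>Basis. LINT x|lborel. indicator K x * (\<bar>a x t\<bar> * ?L b x)) - integral\<^sup>L lborel Z"
      using kato(3) cn by (intro diff_mono mult_left_mono sum_mono) auto
    also have "\<dots> = (LINT x|lborel. cn * (\<Sum>b\<in>Basis. indicator K x * (\<bar>a x t\<bar> * ?L b x)) - Z x)"
      by (rule lin[OF kato(2), symmetric])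
    also have "\<dots> \<le> integral\<^sup>L lborel H"
    proof (rule integral_mono[OF _ iH])
      show "integrable lborel (\<lambda>x. cn * (\<Sum>b\<in>Basis. indicator K x * (\<bar>a x t\<bar> * ?L b x)) - Z x)"
        using kato(2) iZ by (intro Bochner_Integration.integrable_diff integrable_mult_right Bochner_Integration.integrable_sum) auto
      fix x
      show "cn * (\<Sum>b\<in>Basis. indicator K x * (\<bar>a x t\<bar> * ?L b x)) - Z x \<le> H x"
      proof (cases "x \<in> K")
        case False
        then show ?thesis using H0 by (simp add: Z_def)
      next
        case True
        note x0 = K0[OF True]
        define r where "r = norm x"
        have r0: "r > 0" using x0 by (simp add: r_def)
        define X where "X = 1 + (\<rho> x)\<^sup>2"
        have X0: "X \<ge> 0" by (simp add: X_def add_nonneg_nonneg)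
        define eE where "eE = exp (- E t * X)"
        have eE: "eE > 0" "eE \<le> exp (- \<epsilon> * X)" using Et(2) X0 by (auto simp: eE_def mult_right_mono)
        define G1 where "G1 = (D + 4) * E t * X * \<psi> t x"
        define G2 where "G2 = (6 * D + 42) / k * X * w (\<rho> x) * eE"
        have G0: "G1 \<ge> 0" "G2 \<ge> 0"
          unfolding G1_def G2_def using D(2) Et(1) X0 \<psi>0[of t x] k wpos eE by (auto intro!: mult_nonneg_nonneg)
        have lap: "(\<Sum>b\<in>Basis. ?L b x) \<le> (G1 + G2) / r\<^sup>2"
        proof -
          have "(\<Sum>b\<in>Basis. ?L b x) = (\<phi>2 (\<rho> x) + d * \<phi>1 (\<rho> x)) / r\<^sup>2"
            unfolding sum_radial_line_deriv2 using x0 by (simp add: radial_def \<rho>_def d_def r_def)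
          also have "\<dots> \<le> (G1 + G2) / r\<^sup>2"
            using \<phi>(5)[of "\<rho> x"] x0
            by (intro divide_right_mono) (auto simp: G1_def G2_def X_def eE_def \<psi>t radial_def \<rho>_def)
          finally show ?thesis .
        qed
        have main: "cn * (\<Sum>b\<in>Basis. \<bar>a x t\<bar> * ?L b x) \<le> cn * \<bar>a x t\<bar> * (G1 / r\<^sup>2) + cn * \<bar>a x t\<bar> * (G2 / r\<^sup>2)"
        proof -
          have "cn * \<bar>a x t\<bar> * (\<Sum>b\<in>Basis. ?L b x) \<le> cn * \<bar>a x t\<bar> * ((G1 + G2) / r\<^sup>2)"
            using cn by (intro mult_left_mono lap) auto
          then show ?thesis by (simp add: sum_distrib_left mult.assoc distrib_left add_divide_distrib)
        qed
        have pw: "exp (- d * \<rho> x) * w (\<rho> x) / r\<^sup>2 \<le> Cw * exp (- N * \<rho> x)"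
        proof -
          have r2: "r\<^sup>2 = exp (2 * \<rho> x)" using r0 by (simp add: exp_double \<rho>_def r_def)
          have "exp (- d * \<rho> x) * w (\<rho> x) / r\<^sup>2 \<le> exp (- d * \<rho> x) * (Cw * exp (- Nw * \<rho> x)) / r\<^sup>2"
            by (intro divide_right_mono mult_left_mono wb) auto
          also have "\<dots> = Cw * exp (- d * \<rho> x + - Nw * \<rho> x - 2 * \<rho> x)"
            unfolding r2 exp_diff exp_add by (simp only: mult_ac times_divide_eq_right)
          also have "- d * \<rho> x + - Nw * \<rho> x - 2 * \<rho> x = - N * \<rho> x" by (simp add: d_def N_def algebra_simps)
          finally show ?thesis .
        qed
        have aw: "\<bar>a x t\<bar> * w (\<rho> x) / r\<^sup>2 \<le> A1 * Cw * exp (- N * \<rho> x)"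
        proof -
          have "\<bar>a x t\<bar> * (w (\<rho> x) / r\<^sup>2) \<le> A1 * exp (- d * \<rho> x) * (w (\<rho> x) / r\<^sup>2)"
            using far[OF x0 t] wpos[of "\<rho> x"] by (intro mult_right_mono) (auto simp: \<rho>_def)
          also have "\<dots> = A1 * (exp (- d * \<rho> x) * w (\<rho> x) / r\<^sup>2)" by simp
          also have "\<dots> \<le> A1 * (Cw * exp (- N * \<rho> x))" by (intro mult_left_mono pw A)
          finally show ?thesis by (simp add: mult.assoc)
        qed
        \<comment> \<open>The Gaussian is kept here, with \<open>E t\<close> replaced by its lower
          bound \<epsilon>, because exp (-N \<rho>) alone is not integrable at the origin.\<close>
        have p2: "cn * \<bar>a x t\<bar> * (G2 / r\<^sup>2) \<le> cn * A1 * Cw * ((6 * D + 42) / k * F2 x)"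
        proof -
          have "cn * \<bar>a x t\<bar> * (G2 / r\<^sup>2) = (cn * ((6 * D + 42) / k) * X) * ((\<bar>a x t\<bar> * w (\<rho> x) / r\<^sup>2) * eE)"
            by (simp add: G2_def mult_ac)
          also have "\<dots> \<le> (cn * ((6 * D + 42) / k) * X) * ((A1 * Cw * exp (- N * \<rho> x)) * exp (- \<epsilon> * X))"
            using cn D(2) k X0 A Cw eE wpos by (intro mult_left_mono mult_mono aw) auto
          also have "\<dots> = cn * A1 * Cw * ((6 * D + 42) / k * F2 x)"
            by (simp add: F2_def X_def \<rho>_def mult_ac)
          finally show ?thesis .
        qed
        have p1: "cn * \<bar>a x t\<bar> * (G1 / r\<^sup>2) \<le> Z x + cn * A1 * Cw * ((D + 4) * E T * F1 x)"
        proof (cases "r \<le> 1")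
          case True
          have "cn * \<bar>a x t\<bar> * (G1 / r\<^sup>2) \<le> cn * (A0 * r\<^sup>2 * \<bar>\<delta> x t\<bar>) * (G1 / r\<^sup>2)"
            using near[OF x0 t] True cn G0 by (intro mult_right_mono mult_left_mono) (auto simp: r_def)
          also have "\<dots> = cn * A0 * \<bar>\<delta> x t\<bar> * G1" using r0 by simp
          \<comment> \<open>Equality by the choice of M as \<open>cn * A0\<close> times the factor D
            + 4 of G1; the r^2 in \<open>near\<close> has just cancelled that of the
            Laplacian.\<close>
          also have "\<dots> = Z x" using \<open>x \<in> K\<close> by (simp add: Z_def G1_def M X_def mult_ac)
          finally have "cn * \<bar>a x t\<bar> * (G1 / r\<^sup>2) \<le> Z x" .
          moreover have "0 \<le> cn * A1 * Cw * ((D + 4) * E T * F1 x)"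
            using cn A Cw D(2) F0 ET by (intro mult_nonneg_nonneg) auto
          ultimately show ?thesis by simp
        next
          case False
          \<comment> \<open>Outside the unit ball the Gaussian and the bump are simply bounded by 1,
            since F1 is integrable without them.\<close>
          have "\<psi> t x \<le> w (\<rho> x)"
          proof -
            have "exp (- E t * X) * bump (\<rho> x / k) \<le> 1 * 1"
              using Et(1) X0 bump_bounds by (intro mult_mono) (auto intro!: mult_nonneg_nonneg)
            then have "w (\<rho> x) * (exp (- E t * X) * bump (\<rho> x / k)) \<le> w (\<rho> x) * 1"
              by (intro mult_left_mono wpos) auto
            then show ?thesis unfolding \<psi>[OF \<open>x \<in> K\<close>] X_def by simp
          qed
          then have "cn * \<bar>a x t\<bar> * (G1 / r\<^sup>2) \<le> cn * \<bar>a x t\<bar> * (((D + 4) * E T * X * w (\<rho> x)) / r\<^sup>2)"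
            unfolding G1_def using cn D(2) Et X0 \<psi>0 ET wpos
            by (intro mult_left_mono divide_right_mono mult_mono) (auto intro!: mult_nonneg_nonneg)
          also have "\<dots> = (cn * (D + 4) * E T * X) * (\<bar>a x t\<bar> * w (\<rho> x) / r\<^sup>2)" by (simp add: mult_ac)
          also have "\<dots> \<le> (cn * (D + 4) * E T * X) * (A1 * Cw * exp (- N * \<rho> x))"
            using cn D(2) ET X0 by (intro mult_left_mono aw) auto
          also have "\<dots> = cn * A1 * Cw * ((D + 4) * E T * F1 x)"
            using False by (simp add: F1_def X_def \<rho>_def r_def mult_ac)
          finally have "cn * \<bar>a x t\<bar> * (G1 / r\<^sup>2) \<le> cn * A1 * Cw * ((D + 4) * E T * F1 x)" .
          moreover have "Z x \<ge> 0" unfolding Z_def using M0 Et(1) \<psi>0[of t x]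
            by (auto intro!: mult_nonneg_nonneg add_nonneg_nonneg)
          ultimately show ?thesis by simp
        qed
        have "cn * (\<Sum>b\<in>Basis. indicator K x * (\<bar>a x t\<bar> * ?L b x)) = cn * (\<Sum>b\<in>Basis. \<bar>a x t\<bar> * ?L b x)"
          using True by simp
        then show ?thesis using main p1 p2 unfolding H_def distrib_left by linarith
      qed
    qed
    finally show ?thesis .
  qed
  have "(LINT x|lborel. indicator K x * \<bar>P x T\<bar>) \<le> (LINT x|lborel. indicator K x * \<bar>P x t1\<bar>) + integral\<^sup>L lborel H * (T - t1)"
    by (rule integral_abs_growth[OF K(1) t1(2) dP cP cP' bound])
  moreover have "\<bar>P x t\<bar> = \<bar>\<delta> x t\<bar> * \<psi> t x" for x t using \<psi>0[of t x] by (simp add: P_def abs_mult)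
  moreover have "integral\<^sup>L lborel H = cn * A1 * Cw * ((D + 4) * E T * integral\<^sup>L lborel F1 + (6 * D + 42) / k * integral\<^sup>L lborel F2)"
    unfolding H_def using iF1 iF2 by simp
  ultimately show ?thesis unfolding F1_def F2_def K_def E_def N_def by simp
qed

section \<open>Solutions and the contraction estimate\<close>

text \<open>The line derivatives are the gradient paired with b and the quadratic form of the
  Hessian at b. Joint continuity of u has to be derived: differentiability in x together with a
  jointly continuous time derivative gives joint differentiability.\<close>

lemma C21_line_derivatives:
  fixes u :: "real^'n \<Rightarrow> real \<Rightarrow> real"
  assumes "C21_on ((- {0}) \<times> {0<..}) u"
  obtains ut :: "(real^'n) \<times> real \<Rightarrow> real" and D1 D2 :: "real^'n \<Rightarrow> (real^'n) \<times> real \<Rightarrow> real" where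
    "\<And>x t. x \<noteq> 0 \<Longrightarrow> t > 0 \<Longrightarrow> (u x has_real_derivative ut (x, t)) (at t)"
    "\<And>x t b. x \<noteq> 0 \<Longrightarrow> t > 0 \<Longrightarrow> ((\<lambda>s. u (x + s *\<^sub>R b) t) has_real_derivative D1 b (x, t)) (at 0)"
    "\<And>x t b. x \<noteq> 0 \<Longrightarrow> t > 0 \<Longrightarrow> ((\<lambda>s. D1 b (x + s *\<^sub>R b, t)) has_real_derivative D2 b (x, t)) (at 0)"
    "continuous_on ((- {0}) \<times> {0<..}) ut"
    "\<And>b. continuous_on ((- {0}) \<times> {0<..}) (D1 b)"
    "\<And>b. continuous_on ((- {0}) \<times> {0<..}) (D2 b)"
    "continuous_on ((- {0}) \<times> {0<..}) (\<lambda>z. u (fst z) (snd z))"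
proof -
  let ?S = "(- {0 :: real^'n}) \<times> {0::real<..}"
  obtain ut and D :: "(real^'n) \<times> real \<Rightarrow> real^'n" and H :: "(real^'n) \<times> real \<Rightarrow> real^'n^'n" where
    R: "\<And>x t. (x, t) \<in> ?S \<Longrightarrow>
           (u x has_real_derivative ut (x, t)) (at t) \<and>
           ((\<lambda>y. u y t) has_derivative (\<lambda>h. D (x, t) \<bullet> h)) (at x) \<and>
           ((\<lambda>y. D (y, t)) has_derivative (\<lambda>h. H (x, t) *v h)) (at x)"
    and C: "continuous_on ?S ut" "continuous_on ?S D" "continuous_on ?S H"
    using assms unfolding C21_on_def by blast
  define D1 where "D1 b z = D z \<bullet> b" for b z
  define D2 where "D2 b z = (H z *v b) \<bullet> b" for b z
  have line: "((\<lambda>s. x + s *\<^sub>R b) has_derivative (\<lambda>s. s *\<^sub>R b)) (at 0)" for x b :: "real^'n"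
    by (auto intro!: derivative_eq_intros)
  have 1: "(u x has_real_derivative ut (x, t)) (at t)" if "x \<noteq> 0" "t > 0" for x t
    using R[of x t] that by auto
  have 2: "((\<lambda>s. u (x + s *\<^sub>R b) t) has_real_derivative D1 b (x, t)) (at 0)" if "x \<noteq> 0" "t > 0" for x t b
  proof -
    have "((\<lambda>y. u y t) has_derivative (\<lambda>h. D (x, t) \<bullet> h)) (at (x + 0 *\<^sub>R b))"
      using R[of x t] that by auto
    from has_derivative_compose[OF line this] show ?thesis
      by (simp add: has_field_derivative_def D1_def mult.commute[of _ "D (x, t) \<bullet> b"])
  qed
  have 3: "((\<lambda>s. D1 b (x + s *\<^sub>R b, t)) has_real_derivative D2 b (x, t)) (at 0)" if "x \<noteq> 0" "t > 0" for x t b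
  proof -
    have "((\<lambda>y. D (y, t)) has_derivative (\<lambda>h. H (x, t) *v h)) (at (x + 0 *\<^sub>R b))"
      using R[of x t] that by auto
    from has_derivative_inner_left[OF has_derivative_compose[OF line this], of b]
    have "((\<lambda>s. D (x + s *\<^sub>R b, t) \<bullet> b) has_derivative (\<lambda>s. (H (x, t) *v (s *\<^sub>R b)) \<bullet> b)) (at 0)" .
    moreover have "H (x, t) *v (s *\<^sub>R b) = s *\<^sub>R (H (x, t) *v b)" for s
      using linear_scale[OF matrix_vector_mul_linear] .
    ultimately show ?thesis
      by (simp add: has_field_derivative_def D1_def D2_def mult.commute[of _ "(H (x, t) *v b) \<bullet> b"])
  qed
  have 5: "continuous_on ?S (D1 b)" for b unfolding D1_def by (intro continuous_intros C)
  have 6: "continuous_on ?S (D2 b)" for b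
  proof -
    have "D2 b = (\<lambda>z. \<Sum>i\<in>UNIV. (\<Sum>j\<in>UNIV. H z $ i $ j * b $ j) * b $ i)"
      by (simp add: D2_def fun_eq_iff inner_vec_def matrix_vector_mult_def)
    then show ?thesis by (simp only:) (intro continuous_intros C)
  qed
  have 7: "continuous_on ?S (\<lambda>z. u (fst z) (snd z))"
  proof -
    have "continuous (at (x, t) within ?S) (\<lambda>(x, t). u x t)" if xt: "x \<noteq> 0" "t > 0" for x t
    proof (rule has_derivative_continuous)
      show "((\<lambda>(x, t). u x t) has_derivative
          (\<lambda>(tx, ty). D (x, t) \<bullet> tx + (ut (x, t) *\<^sub>R id_blinfun) ty)) (at (x, t) within ?S)"
      proof (rule has_derivative_partialsI[where fy = "\<lambda>x t. ut (x, t) *\<^sub>R id_blinfun"])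
        show "((\<lambda>x. u x t) has_derivative (\<lambda>h. D (x, t) \<bullet> h)) (at x within - {0})"
          using R[of x t] xt by (auto intro: has_derivative_at_withinI)
        show "(u x has_derivative blinfun_apply (ut (x, t) *\<^sub>R id_blinfun)) (at t within {0<..})"
          if "x \<in> - {0}" "t \<in> {0<..}" for x t
        proof -
          have "blinfun_apply (ut (x, t) *\<^sub>R id_blinfun) = (*) (ut (x, t))"
            by (simp add: fun_eq_iff blinfun.scaleR_left)
          then show ?thesis
            using 1[of x t] that by (auto simp: has_field_derivative_def intro: has_derivative_at_withinI)
        qed
        have "continuous_on ?S (\<lambda>z. ut z *\<^sub>R (id_blinfun :: real \<Rightarrow>\<^sub>L real))"
          by (intro continuous_intros C)
        then have "continuous (at (x, t) within ?S) (\<lambda>z. ut z *\<^sub>R (id_blinfun :: real \<Rightarrow>\<^sub>L real))"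
          using xt by (auto simp: continuous_on_eq_continuous_within)
        moreover have "(\<lambda>(x, t). ut (x, t) *\<^sub>R (id_blinfun :: real \<Rightarrow>\<^sub>L real)) = (\<lambda>z. ut z *\<^sub>R id_blinfun)"
          by (simp add: fun_eq_iff)
        ultimately show "continuous (at (x, t) within ?S) (\<lambda>(x, t). ut (x, t) *\<^sub>R (id_blinfun :: real \<Rightarrow>\<^sub>L real))"
          by (simp only:)
      qed (use xt in auto)
    qed
    moreover have "(\<lambda>(x, t). u x t) = (\<lambda>z. u (fst z) (snd z))" by (simp add: fun_eq_iff)
    ultimately show ?thesis by (auto simp: continuous_on_eq_continuous_within)
  qed
  show ?thesis by (rule that[OF 1 2 3 C(1) 5 6 7])
qed

text \<open>Positivity makes u^m as smooth as u. The Laplacian in the equation is written with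
  \<open>deriv\<close>, which by itself carries no differentiability; here it is identified with a
  sum of genuine continuous second derivatives.\<close>

lemma classical_solution_powr:
  fixes u :: "real^'n \<Rightarrow> real \<Rightarrow> real"
  assumes sol: "classical_solution m u" and pos: "\<And>x t. x \<noteq> 0 \<Longrightarrow> t > 0 \<Longrightarrow> u x t > 0"
  obtains ut :: "(real^'n) \<times> real \<Rightarrow> real" and a1 a2 :: "real^'n \<Rightarrow> (real^'n) \<times> real \<Rightarrow> real" where
    "\<And>x t. x \<noteq> 0 \<Longrightarrow> t > 0 \<Longrightarrow> (u x has_real_derivative ut (x, t)) (at t)"
    "\<And>x t b. x \<noteq> 0 \<Longrightarrow> t > 0 \<Longrightarrow> ((\<lambda>s. u (x + s *\<^sub>R b) t powr m) has_real_derivative a1 b (x, t)) (at 0)"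
    "\<And>x t b. x \<noteq> 0 \<Longrightarrow> t > 0 \<Longrightarrow> ((\<lambda>s. a1 b (x + s *\<^sub>R b, t)) has_real_derivative a2 b (x, t)) (at 0)"
    "continuous_on ((- {0}) \<times> {0<..}) ut"
    "continuous_on ((- {0}) \<times> {0<..}) (\<lambda>z. u (fst z) (snd z))"
    "\<And>b. continuous_on ((- {0}) \<times> {0<..}) (a1 b)"
    "\<And>b. continuous_on ((- {0}) \<times> {0<..}) (a2 b)"
    "\<And>x t. x \<noteq> 0 \<Longrightarrow> t > 0 \<Longrightarrow> ut (x, t) = (real CARD('n) - 1) / m * (\<Sum>b\<in>Basis. a2 b (x, t))"
proof -
  let ?S = "(- {0 :: real^'n}) \<times> {0::real<..}"
  obtain ut :: "(real^'n) \<times> real \<Rightarrow> real" and D1 D2 :: "real^'n \<Rightarrow> (real^'n) \<times> real \<Rightarrow> real" where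
    dt: "\<And>x t. x \<noteq> 0 \<Longrightarrow> t > 0 \<Longrightarrow> (u x has_real_derivative ut (x, t)) (at t)"
    and d1: "\<And>x t b. x \<noteq> 0 \<Longrightarrow> t > 0 \<Longrightarrow> ((\<lambda>s. u (x + s *\<^sub>R b) t) has_real_derivative D1 b (x, t)) (at 0)"
    and d2: "\<And>x t b. x \<noteq> 0 \<Longrightarrow> t > 0 \<Longrightarrow> ((\<lambda>s. D1 b (x + s *\<^sub>R b, t)) has_real_derivative D2 b (x, t)) (at 0)"
    and c: "continuous_on ?S ut" "\<And>b. continuous_on ?S (D1 b)" "\<And>b. continuous_on ?S (D2 b)"
      "continuous_on ?S (\<lambda>z. u (fst z) (snd z))"
    using C21_line_derivatives[of u] sol unfolding classical_solution_def by blast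
  define U where "U z = u (fst z) (snd z)" for z
  have Upos: "U z > 0" if "z \<in> ?S" for z using pos[of "fst z" "snd z"] that by (simp add: U_def mem_Times_iff)
  define a1 where "a1 b z = m * U z powr (m - 1) * D1 b z" for b z
  define a2 where "a2 b z = m * ((m - 1) * U z powr (m - 2) * D1 b z * D1 b z + U z powr (m - 1) * D2 b z)" for b z
  have dp: "((\<lambda>s. u (x + s *\<^sub>R b) t powr q) has_real_derivative q * u x t powr (q - 1) * D1 b (x, t)) (at 0)"
    if "x \<noteq> 0" "t > 0" for x t b q
    using DERIV_chain2[where f = "\<lambda>y. y powr q" and g = "\<lambda>s. u (x + s *\<^sub>R b) t",
      OF has_real_derivative_powr d1[OF that]] pos[OF that] by simp
  have 2: "((\<lambda>s. u (x + s *\<^sub>R b) t powr m) has_real_derivative a1 b (x, t)) (at 0)" if "x \<noteq> 0" "t > 0" for x t b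
    using dp[OF that] by (simp add: a1_def U_def)
  have 3: "((\<lambda>s. a1 b (x + s *\<^sub>R b, t)) has_real_derivative a2 b (x, t)) (at 0)" if "x \<noteq> 0" "t > 0" for x t b
    using DERIV_cmult[OF DERIV_mult[OF dp[OF that, of b "m - 1"] d2[OF that]], of m]
    by (simp add: a1_def a2_def U_def algebra_simps)
  have cU: "continuous_on ?S U" using c(4) by (simp add: U_def)
  have cUp: "continuous_on ?S (\<lambda>z. U z powr q)" for q
    by (intro continuous_intros cU) (use Upos in \<open>force simp: less_imp_neq[symmetric]\<close>)
  have c1: "continuous_on ?S (a1 b)" "continuous_on ?S (a2 b)" for b
    unfolding a1_def a2_def by (intro continuous_intros cUp c(2,3))+
  have lap: "laplacian (\<lambda>y. u y t powr m) x = (\<Sum>b\<in>Basis. a2 b (x, t))" if "x \<noteq> 0" "t > 0" for x t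
  proof -
    have "(deriv ^^ 2) (\<lambda>s. u (x + s *\<^sub>R b) t powr m) 0 = a2 b (x, t)" for b
    proof -
      \<comment> \<open>The outer \<open>deriv\<close> depends on the inner one near 0 and not only
        at 0; for small s the point x + s b still avoids the origin.\<close>
      have "open ((\<lambda>s. x + s *\<^sub>R b) -` (- {0}))"
        by (rule open_vimage) (auto intro!: continuous_intros)
      then have "eventually (\<lambda>s. x + s *\<^sub>R b \<noteq> 0) (nhds 0)"
        using that(1) by (auto simp: eventually_nhds intro!: exI[of _ "(\<lambda>s. x + s *\<^sub>R b) -` (- {0})"])
      then have ev: "eventually (\<lambda>s. deriv (\<lambda>s. u (x + s *\<^sub>R b) t powr m) s = a1 b (x + s *\<^sub>R b, t)) (nhds 0)"
      proof eventually_elim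
        case (elim s)
        have "((\<lambda>h. u (x + s *\<^sub>R b + h *\<^sub>R b) t powr m) has_real_derivative a1 b (x + s *\<^sub>R b, t)) (at 0)"
          by (rule 2[OF elim that(2)])
        then have "((\<lambda>s. u (x + s *\<^sub>R b) t powr m) has_real_derivative a1 b (x + s *\<^sub>R b, t)) (at s)"
          using DERIV_shift[of "\<lambda>s. u (x + s *\<^sub>R b) t powr m" "a1 b (x + s *\<^sub>R b, t)" 0 s] by (simp add: algebra_simps)
        then show ?case by (rule DERIV_imp_deriv)
      qed
      have "(deriv ^^ 2) (\<lambda>s. u (x + s *\<^sub>R b) t powr m) 0 = deriv (\<lambda>s. deriv (\<lambda>s. u (x + s *\<^sub>R b) t powr m) s) 0"
        by (simp add: numeral_2_eq_2)
      also have "\<dots> = deriv (\<lambda>s. a1 b (x + s *\<^sub>R b, t)) 0" by (rule deriv_cong_ev[OF ev refl])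
      also have "\<dots> = a2 b (x, t)" by (rule DERIV_imp_deriv[OF 3[OF that]])
      finally show ?thesis .
    qed
    then show ?thesis by (simp add: laplacian_def)
  qed
  have 8: "ut (x, t) = (real CARD('n) - 1) / m * (\<Sum>b\<in>Basis. a2 b (x, t))" if "x \<noteq> 0" "t > 0" for x t
    unfolding lap[OF that, symmetric]
    by (rule DERIV_unique[OF dt[OF that]]) (use sol that in \<open>simp add: classical_solution_def\<close>)
  show ?thesis by (rule that[OF dt 2 3 c(1) c(4) c1 8])
qed

text \<open>In the variable ln |x|, scaling by l and evolution up to time t act together as one
  translation by ln l - \<beta> t, with a factor exp (p (ln l - \<beta> t)) where p = 2 m / (1 - m).
  The relation between \<alpha> and \<beta> is what merges the two prefactors.\<close>

lemma self_similar_solution_powr: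
  fixes f :: "real \<Rightarrow> real" and x :: "real^'n"
  assumes f: "\<And>r. r > 0 \<Longrightarrow> f r > 0" and m: "m < 1" and l: "l > 0" and x: "x \<noteq> 0"
    and \<alpha>: "\<alpha> = 2 * \<beta> / (1 - m)"
  shows "self_similar_solution m \<alpha> \<beta> f l x t powr m
    = exp (2 * m / (1 - m) * (ln l - \<beta> * t)) * f (exp (ln (norm x) + (ln l - \<beta> * t))) powr m"
proof -
  have n: "norm (l *\<^sub>R (exp (- \<beta> * t) *\<^sub>R x)) = exp (ln (norm x) + (ln l - \<beta> * t))"
    using l x by (simp add: exp_add exp_diff exp_minus field_simps)
  have "self_similar_solution m \<alpha> \<beta> f l x t
     = exp (2 / (1 - m) * (ln l - \<beta> * t)) * f (exp (ln (norm x) + (ln l - \<beta> * t)))"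
  proof -
    have "exp (- \<alpha> * t) * l powr (2 / (1 - m)) = exp (2 / (1 - m) * (ln l - \<beta> * t))"
      using l by (simp add: powr_def exp_add[symmetric] \<alpha> algebra_simps diff_divide_distrib)
    then show ?thesis unfolding self_similar_solution_def scaled_profile_def n by (simp add: mult.assoc[symmetric])
  qed
  then show ?thesis
    using f[of "exp (ln (norm x) + (ln l - \<beta> * t))"]
    by (simp add: powr_mult) (simp add: powr_def mult_ac)
qed

lemma scaled_profile_eq_self_similar_solution:
  "scaled_profile m f l x = self_similar_solution m \<alpha> \<beta> f l x 0"
  by (simp add: self_similar_solution_def)

text \<open>Mean value theorem: the slope m \<xi>^(m-1) decreases in \<xi> because m < 1, and the
  lower bound on the powers gives \<xi> \<ge> L^(1/m).\<close>

lemma powr_diff_le: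
  fixes y z L m :: real
  assumes m: "0 < m" "m < 1" and L: "L > 0" and y: "y > 0" "L \<le> y powr m" and z: "z > 0" "L \<le> z powr m"
  shows "\<bar>y powr m - z powr m\<bar> \<le> m * L powr ((m - 1) / m) * \<bar>y - z\<bar>"
proof -
  have *: "\<bar>y powr m - z powr m\<bar> \<le> m * L powr ((m - 1) / m) * \<bar>y - z\<bar>"
    if yz: "y < z" "y > 0" "L \<le> y powr m" for y z :: real
  proof -
    have "\<exists>\<xi>>y. \<xi> < z \<and> z powr m - y powr m = (z - y) * (m * \<xi> powr (m - 1))"
      using yz by (intro MVT2) (auto intro!: has_real_derivative_powr)
    then obtain \<xi> where \<xi>: "y < \<xi>" "z powr m - y powr m = (z - y) * (m * \<xi> powr (m - 1))" by blast
    have "L powr (1 / m) \<le> (y powr m) powr (1 / m)" using yz L m by (intro powr_mono2) auto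
    then have "L powr (1 / m) \<le> \<xi>" using \<xi>(1) yz m by (simp add: powr_powr)
    then have "\<xi> powr (m - 1) \<le> (L powr (1 / m)) powr (m - 1)"
      using m L by (intro powr_mono2') auto
    then have "\<xi> powr (m - 1) \<le> L powr ((m - 1) / m)" by (simp add: powr_powr)
    then have "(z - y) * (m * \<xi> powr (m - 1)) \<le> (z - y) * (m * L powr ((m - 1) / m))"
      using yz m by (intro mult_left_mono) auto
    moreover have "y powr m \<le> z powr m" using yz m by (intro powr_mono2) auto
    ultimately show ?thesis using \<xi>(2) yz by (simp add: mult_ac)
  qed
  consider "y < z" | "z < y" | "y = z" by linarith
  then show ?thesis
    using *[of y z] *[of z y] y z by cases (auto simp: abs_minus_commute)
qed

text \<open>Triangle inequality through the initial data. On K the weight is bounded by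
  \<open>Wm\<close>, so the distances of the solutions from their data enter only through L1 norms
  on K, which is what the notion of solution controls.\<close>

lemma ennreal_weighted_integral_le:
  fixes u1 u2 u01 u02 \<psi> W :: "real^'n \<Rightarrow> real"
  assumes K: "compact K" "K \<subseteq> - {0}"
    and \<psi>: "\<And>x. x \<in> K \<Longrightarrow> 0 \<le> \<psi> x \<and> \<psi> x \<le> W x" and Wm: "\<And>x. x \<in> K \<Longrightarrow> W x \<le> Wm"
    and u0: "u01 \<in> L1_loc_punctured" "u02 \<in> L1_loc_punctured"
    and cu: "continuous_on K u1" "continuous_on K u2" and c\<psi>: "continuous_on K \<psi>" and cW: "continuous_on K W"
  shows "ennreal (LINT x|lborel. indicator K x * (\<bar>u1 x - u2 x\<bar> * \<psi> x))
    \<le> (\<integral>\<^sup>+x\<in>- {0}. ennreal (\<bar>u01 x - u02 x\<bar> * W x) \<partial>lebesgue)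
      + ennreal Wm * ((\<integral>\<^sup>+x\<in>K. ennreal \<bar>u1 x - u01 x\<bar> \<partial>lebesgue) + (\<integral>\<^sup>+x\<in>K. ennreal \<bar>u2 x - u02 x\<bar> \<partial>lebesgue))"
proof -
  have meas0: "(\<lambda>x. indicator K x * u x) \<in> borel_measurable lebesgue" if "u \<in> L1_loc_punctured" for u
  proof -
    have "u absolutely_integrable_on K" using that K by (simp add: L1_loc_punctured_def)
    then show ?thesis unfolding set_integrable_def by (auto dest!: borel_measurable_integrable)
  qed
  have measc: "(\<lambda>x. indicator K x * u x) \<in> borel_measurable lebesgue" if "continuous_on K u" for u :: "real^'n \<Rightarrow> real"
    using borel_measurable_integrable[OF integrable_indicator_continuous[OF K(1) that]]
    by (simp add: measurable_completion)
  note [measurable] = meas0[OF u0(1)] meas0[OF u0(2)] measc[OF cu(1)] measc[OF cu(2)] measc[OF cW]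
  define F0 where "F0 x = \<bar>indicator K x * u01 x - indicator K x * u02 x\<bar> * \<bar>indicator K x * W x\<bar>" for x
  define F1 where "F1 x = \<bar>indicator K x * u1 x - indicator K x * u01 x\<bar>" for x
  define F2 where "F2 x = \<bar>indicator K x * u2 x - indicator K x * u02 x\<bar>" for x
  have [measurable]: "F0 \<in> borel_measurable lebesgue" "F1 \<in> borel_measurable lebesgue" "F2 \<in> borel_measurable lebesgue"
    unfolding F0_def F1_def F2_def by measurable
  have int: "integrable lborel (\<lambda>x. indicator K x * (\<bar>u1 x - u2 x\<bar> * \<psi> x))"
    by (intro integrable_indicator_continuous K continuous_intros cu c\<psi>)
  have "ennreal (LINT x|lborel. indicator K x * (\<bar>u1 x - u2 x\<bar> * \<psi> x))
      = (\<integral>\<^sup>+x. ennreal (indicator K x * (\<bar>u1 x - u2 x\<bar> * \<psi> x)) \<partial>lborel)"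
    by (rule nn_integral_eq_integral[symmetric, OF int]) (auto simp: indicator_def \<psi>)
  also have "\<dots> = (\<integral>\<^sup>+x. ennreal (indicator K x * (\<bar>u1 x - u2 x\<bar> * \<psi> x)) \<partial>lebesgue)"
    by (simp add: nn_integral_completion)
  also have "\<dots> \<le> (\<integral>\<^sup>+x. ennreal (F0 x) + ennreal Wm * (ennreal (F1 x) + ennreal (F2 x)) \<partial>lebesgue)"
  proof (rule nn_integral_mono)
    fix x
    show "ennreal (indicator K x * (\<bar>u1 x - u2 x\<bar> * \<psi> x)) \<le> ennreal (F0 x) + ennreal Wm * (ennreal (F1 x) + ennreal (F2 x))"
    proof (cases "x \<in> K")
      case True
      have p: "0 \<le> \<psi> x" "\<psi> x \<le> W x" "W x \<le> Wm" using \<psi> Wm True by auto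
      have "\<bar>u1 x - u2 x\<bar> * \<psi> x \<le> (\<bar>u01 x - u02 x\<bar> + (\<bar>u1 x - u01 x\<bar> + \<bar>u2 x - u02 x\<bar>)) * W x"
        using p by (intro mult_mono) auto
      also have "\<dots> \<le> \<bar>u01 x - u02 x\<bar> * W x + (\<bar>u1 x - u01 x\<bar> + \<bar>u2 x - u02 x\<bar>) * Wm"
        unfolding distrib_right[of "\<bar>u01 x - u02 x\<bar>"] using p by (intro add_left_mono mult_left_mono) auto
      finally have "\<bar>u1 x - u2 x\<bar> * \<psi> x \<le> F0 x + Wm * (F1 x + F2 x)"
        using True p by (simp add: F0_def F1_def F2_def mult.commute)
      then have "ennreal (\<bar>u1 x - u2 x\<bar> * \<psi> x) \<le> ennreal (F0 x + Wm * (F1 x + F2 x))" by (rule ennreal_leI)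
      also have "\<dots> = ennreal (F0 x) + ennreal Wm * (ennreal (F1 x) + ennreal (F2 x))"
        using p by (simp add: F0_def F1_def F2_def ennreal_plus ennreal_mult)
      finally show ?thesis using True by simp
    qed simp
  qed
  also have "\<dots> = (\<integral>\<^sup>+x. ennreal (F0 x) \<partial>lebesgue)
      + ennreal Wm * ((\<integral>\<^sup>+x. ennreal (F1 x) \<partial>lebesgue) + (\<integral>\<^sup>+x. ennreal (F2 x) \<partial>lebesgue))"
    by (simp add: nn_integral_add nn_integral_cmult)
  also have "(\<integral>\<^sup>+x. ennreal (F1 x) \<partial>lebesgue) = (\<integral>\<^sup>+x\<in>K. ennreal \<bar>u1 x - u01 x\<bar> \<partial>lebesgue)"
    by (rule nn_integral_cong) (simp add: F1_def indicator_def)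
  also have "(\<integral>\<^sup>+x. ennreal (F2 x) \<partial>lebesgue) = (\<integral>\<^sup>+x\<in>K. ennreal \<bar>u2 x - u02 x\<bar> \<partial>lebesgue)"
    by (rule nn_integral_cong) (simp add: F2_def indicator_def)
  also have "(\<integral>\<^sup>+x. ennreal (F0 x) \<partial>lebesgue) \<le> (\<integral>\<^sup>+x\<in>- {0}. ennreal (\<bar>u01 x - u02 x\<bar> * W x) \<partial>lebesgue)"
  proof (rule nn_integral_mono)
    fix x
    show "ennreal (F0 x) \<le> ennreal (\<bar>u01 x - u02 x\<bar> * W x) * indicator (- {0}) x"
    proof (cases "x \<in> K")
      case True
      with K(2) have "x \<noteq> 0" by auto
      with True \<psi>[of x] show ?thesis by (simp add: F0_def)
    qed (simp add: F0_def)
  qed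
  finally show ?thesis by (simp add: add_right_mono)
qed

text \<open>The growth estimate starts from positive times, since the equation holds only there. As
  t tends to 0, convergence to the data in L1 on the compact K replaces the starting integral by the
  weighted integral of the data.\<close>

lemma growth_from_initial_trace:
  fixes u1 u2 :: "real^'n \<Rightarrow> real \<Rightarrow> real" and u01 u02 W :: "real^'n \<Rightarrow> real" and \<psi> :: "real \<Rightarrow> real^'n \<Rightarrow> real"
  assumes K: "compact K" "K \<subseteq> - {0}" and T: "T > 0" and R: "R \<ge> 0"
    and \<psi>: "\<And>x t. x \<in> K \<Longrightarrow> 0 \<le> t \<Longrightarrow> t \<le> T \<Longrightarrow> 0 \<le> \<psi> t x \<and> \<psi> t x \<le> W x"
    and u0: "u01 \<in> L1_loc_punctured" "u02 \<in> L1_loc_punctured"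
    and cu: "\<And>t. t > 0 \<Longrightarrow> continuous_on K (\<lambda>x. u1 x t)" "\<And>t. t > 0 \<Longrightarrow> continuous_on K (\<lambda>x. u2 x t)"
    and c\<psi>: "\<And>t. 0 \<le> t \<Longrightarrow> t \<le> T \<Longrightarrow> continuous_on K (\<psi> t)" and cW: "continuous_on K W"
    and tr: "((\<lambda>t. \<integral>\<^sup>+x\<in>K. ennreal \<bar>u1 x t - u01 x\<bar> \<partial>lebesgue) \<longlongrightarrow> 0) (at_right 0)"
      "((\<lambda>t. \<integral>\<^sup>+x\<in>K. ennreal \<bar>u2 x t - u02 x\<bar> \<partial>lebesgue) \<longlongrightarrow> 0) (at_right 0)"
    and growth: "\<And>t. 0 < t \<Longrightarrow> t \<le> T \<Longrightarrow>
      (LINT x|lborel. indicator K x * (\<bar>u1 x T - u2 x T\<bar> * \<psi> T x))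
        \<le> (LINT x|lborel. indicator K x * (\<bar>u1 x t - u2 x t\<bar> * \<psi> t x)) + R * (T - t)"
  shows "ennreal (LINT x|lborel. indicator K x * (\<bar>u1 x T - u2 x T\<bar> * \<psi> T x))
    \<le> (\<integral>\<^sup>+x\<in>- {0}. ennreal (\<bar>u01 x - u02 x\<bar> * W x) \<partial>lebesgue) + ennreal (R * T)"
proof -
  obtain Wm where Wm: "\<And>x. x \<in> K \<Longrightarrow> W x \<le> Wm"
    using compact_imp_bounded[OF compact_continuous_image[OF cW K(1)]]
    by (auto simp: bounded_iff) (meson abs_le_D1)
  let ?X = "\<integral>\<^sup>+x\<in>- {0}. ennreal (\<bar>u01 x - u02 x\<bar> * W x) \<partial>lebesgue"
  define N where "N t = (\<integral>\<^sup>+x\<in>K. ennreal \<bar>u1 x t - u01 x\<bar> \<partial>lebesgue) + (\<integral>\<^sup>+x\<in>K. ennreal \<bar>u2 x t - u02 x\<bar> \<partial>lebesgue)" for t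
  have "((\<lambda>t. ?X + ennreal Wm * N t + ennreal (R * T)) \<longlongrightarrow> ?X + ennreal Wm * (0 + 0) + ennreal (R * T)) (at_right 0)"
    unfolding N_def by (intro tendsto_add tendsto_const ennreal_tendsto_cmult tr) simp
  then have lim: "((\<lambda>t. ?X + ennreal Wm * N t + ennreal (R * T)) \<longlongrightarrow> ?X + ennreal (R * T)) (at_right 0)"
    by simp
  show ?thesis
  proof (rule tendsto_lowerbound[OF lim])
    have "eventually (\<lambda>t. t \<in> {0<..T}) (at_right 0)"
      using T by (auto simp: eventually_at_right[of 0 T] intro!: exI[of _ T])
    then show "eventually (\<lambda>t. ennreal (LINT x|lborel. indicator K x * (\<bar>u1 x T - u2 x T\<bar> * \<psi> T x))
        \<le> ?X + ennreal Wm * N t + ennreal (R * T)) (at_right 0)"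
    proof eventually_elim
      case (elim t)
      then have t: "0 < t" "t \<le> T" by auto
      let ?Y = "LINT x|lborel. indicator K x * (\<bar>u1 x t - u2 x t\<bar> * \<psi> t x)"
      have Y: "?Y \<ge> 0" using \<psi> t by (intro integral_nonneg_AE) (auto simp: indicator_def)
      have "R * (T - t) \<le> R * T" using R t by (intro mult_left_mono) auto
      with growth[OF t] have "(LINT x|lborel. indicator K x * (\<bar>u1 x T - u2 x T\<bar> * \<psi> T x)) \<le> ?Y + R * T" by simp
      then have "ennreal (LINT x|lborel. indicator K x * (\<bar>u1 x T - u2 x T\<bar> * \<psi> T x)) \<le> ennreal (?Y + R * T)"
        by (rule ennreal_leI)
      also have "\<dots> = ennreal ?Y + ennreal (R * T)" using Y R T by (intro ennreal_plus) auto
      also have "ennreal ?Y \<le> ?X + ennreal Wm * N t" unfolding N_def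
        by (rule ennreal_weighted_integral_le[OF K _ Wm u0]) (use \<psi> t cu c\<psi> cW in auto)
      finally show ?case by (simp add: add_right_mono)
    qed
  qed simp
qed

text \<open>Fatou's lemma, which asks for no common integrable majorant of the cutoff
  integrands.\<close>

lemma nn_integral_le_of_cutoffs:
  fixes F :: "nat \<Rightarrow> real^'n \<Rightarrow> real" and G :: "real^'n \<Rightarrow> real"
  assumes int: "\<And>j. integrable lborel (F j)" and nonneg: "\<And>j x. F j x \<ge> 0"
    and lim: "\<And>x. x \<noteq> 0 \<Longrightarrow> (\<lambda>j. F j x) \<longlonglongrightarrow> G x"
    and le: "\<And>j. ennreal (integral\<^sup>L lborel (F j)) \<le> X + ennreal (r j)" and r: "r \<longlonglongrightarrow> 0"
  shows "(\<integral>\<^sup>+x\<in>- {0}. ennreal (G x) \<partial>lebesgue) \<le> X"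
proof -
  have [measurable]: "F j \<in> borel_measurable borel" for j
    using borel_measurable_integrable[OF int[of j]] by simp
  have "(\<integral>\<^sup>+x\<in>- {0}. ennreal (G x) \<partial>lebesgue) = (\<integral>\<^sup>+x. ennreal (G x) * indicator (- {0}) x \<partial>lborel)"
    by (simp add: nn_integral_completion)
  also have "\<dots> \<le> (\<integral>\<^sup>+x. liminf (\<lambda>j. ennreal (F j x)) \<partial>lborel)"
  proof (rule nn_integral_mono)
    fix x
    show "ennreal (G x) * indicator (- {0}) x \<le> liminf (\<lambda>j. ennreal (F j x))"
    proof (cases "x = 0")
      case False
      have "liminf (\<lambda>j. ennreal (F j x)) = ennreal (G x)"
        by (intro lim_imp_Liminf tendsto_ennrealI lim False) simp
      with False show ?thesis by simp
    qed simp
  qed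
  also have "\<dots> \<le> liminf (\<lambda>j. \<integral>\<^sup>+x. ennreal (F j x) \<partial>lborel)"
    by (rule nn_integral_liminf) measurable
  also have "\<dots> \<le> liminf (\<lambda>j. X + ennreal (r j))"
  proof (intro Liminf_mono always_eventually allI)
    fix j
    show "(\<integral>\<^sup>+x. ennreal (F j x) \<partial>lborel) \<le> X + ennreal (r j)"
      using le[of j] nn_integral_eq_integral[OF int[of j]] nonneg by simp
  qed
  also have "liminf (\<lambda>j. X + ennreal (r j)) = X + ennreal 0"
    by (intro lim_imp_Liminf tendsto_add tendsto_const tendsto_ennrealI r) simp
  finally show ?thesis by simp
qed

theorem theorem1p7:
  fixes m \<alpha> \<beta> \<gamma>\<^sub>2 l1 l2 l3 :: real
    and f1 :: "real \<Rightarrow> real"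
    and u01 u02 :: "real^'n \<Rightarrow> real"
    and u1 u2 :: "real^'n \<Rightarrow> real \<Rightarrow> real"
  assumes "CARD('n) \<in> {3, 4}"
    and "(real CARD('n) - 2) / (real CARD('n) + 2) \<le> m"
    and "m < (real CARD('n) - 2) / real CARD('n)"
    and "\<gamma>\<^sub>2 = (1 - m) / (2 * m) * (real CARD('n) - 2 / (1 - m))"
    and "\<beta> < 0"
    and "\<alpha> = 2 * \<beta> / (1 - m)"
    and "l1 > l2" and "l2 > 0" and "l3 > 0"
    and "self_similar_profile CARD('n) m \<alpha> \<beta> f1"
    and "\<forall>x. x \<noteq> 0 \<longrightarrow> scaled_profile m f1 l1 x \<le> u01 x \<and> u01 x \<le> scaled_profile m f1 l2 x"
    and "\<forall>x. x \<noteq> 0 \<longrightarrow> scaled_profile m f1 l1 x \<le> u02 x \<and> u02 x \<le> scaled_profile m f1 l2 x"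
    and "(\<lambda>x. u01 x - u02 x) \<in> L1_weighted (\<lambda>x. scaled_profile m f1 l3 x powr (m * \<gamma>\<^sub>2))"
    and "cauchy_solution m u01 u1"
    and "cauchy_solution m u02 u2"
    and "\<forall>x t. x \<noteq> 0 \<and> t > 0 \<longrightarrow>
           self_similar_solution m \<alpha> \<beta> f1 l1 x t \<le> u1 x t \<and>
           u1 x t \<le> self_similar_solution m \<alpha> \<beta> f1 l2 x t"
    and "\<forall>x t. x \<noteq> 0 \<and> t > 0 \<longrightarrow>
           self_similar_solution m \<alpha> \<beta> f1 l1 x t \<le> u2 x t \<and>
           u2 x t \<le> self_similar_solution m \<alpha> \<beta> f1 l2 x t"
  shows "\<forall>t>0. (\<integral>\<^sup>+x\<in>- {0}. ennreal (\<bar>u1 x t - u2 x t\<bar> * scaled_profile m f1 l3 x powr (m * \<gamma>\<^sub>2)) \<partial>lebesgue)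
              \<le> (\<integral>\<^sup>+x\<in>- {0}. ennreal (\<bar>u01 x - u02 x\<bar> * scaled_profile m f1 l3 x powr (m * \<gamma>\<^sub>2)) \<partial>lebesgue)"
proof (intro allI impI)
  fix T :: real assume T: "0 < T"

  \<comment> \<open>Exponents and the range of m\<close>
  let ?n = "CARD('n)"
  have n2: "2 < real ?n" using assms(1) by auto
  have n3: "real ?n \<ge> 3" using assms(1) by auto
  define d where "d = real ?n - 2"
  define p where "p = 2 * m / (1 - m)"
  have d: "d > 0" using n3 by (simp add: d_def)
  have m0: "0 < m"
  proof -
    have "0 < (real ?n - 2) / (real ?n + 2)" using n3 by simp
    with assms(2) show ?thesis by linarith
  qed
  have nm: "real ?n * m < real ?n - 2" using assms(3) n3 by (simp add: field_simps)
  have m1: "m < 1"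
  proof -
    have "(real ?n - 2) / real ?n < 1" using n3 by simp
    with assms(3) show ?thesis by linarith
  qed
  have nm': "real ?n - 2 \<le> m * (real ?n + 2)" using assms(2) n3 by (simp add: field_simps)
  have \<gamma>eq: "\<gamma>\<^sub>2 = (real ?n * (1 - m) - 2) / (2 * m)"
    unfolding assms(4) using m0 m1 by (simp add: field_simps)
  \<comment> \<open>In terms of p and d the value is d/p - 1: positivity is p < d, the upper bound
    is p \<ge> d/2, and these are the two hypotheses on m.\<close>
  have \<gamma>: "0 < \<gamma>\<^sub>2" "\<gamma>\<^sub>2 \<le> 1"
    unfolding \<gamma>eq using m0 nm nm' by (simp_all add: field_simps)
  have p0: "0 < p" using m0 m1 by (simp add: p_def)
  have pd: "p < d"
    unfolding p_def d_def using m1 nm by (simp add: field_simps)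
  have \<beta>: "\<beta> < 0" and \<alpha>: "\<alpha> = 2 * \<beta> / (1 - m)" and l: "l1 > 0" "l2 > 0" "l3 > 0" using assms(5-9) by auto
  have prof: "self_similar_profile ?n m \<alpha> \<beta> f1" by fact
  have fpos: "f1 r > 0" if "r > 0" for r using prof that by (simp add: self_similar_profile_def)

  \<comment> \<open>The profile and the barriers in the logarithmic coordinate\<close>
  define V where "V = (\<lambda>\<rho>. f1 (exp \<rho>) powr m)"
  obtain V1 V2 c where dV: "\<And>x. (V has_real_derivative V1 x) (at x)"
    "\<And>x. (V1 has_real_derivative V2 x) (at x)" and cV2: "continuous_on UNIV V2"
    and Vpos: "\<And>x. V x > 0"
    and ode: "\<And>x. V2 x + d * V1 x = c x * (V1 x + p * V x)" and c: "\<And>x. c x > 0"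
    and limV: "((\<lambda>x. exp (d * x) * V x) \<longlongrightarrow> 1) at_top"
  proof (rule self_similar_profile_log_ode[OF prof n2 m0 m1 \<beta> \<alpha>, folded d_def p_def])
    fix V1 V2 c :: "real \<Rightarrow> real"
    assume *: "\<And>x. ((\<lambda>\<rho>. f1 (exp \<rho>) powr m) has_real_derivative V1 x) (at x)"
      "\<And>x. (V1 has_real_derivative V2 x) (at x)" "continuous_on UNIV V2" "\<And>x. 0 < f1 (exp x) powr m"
      "\<And>x. V2 x + d * V1 x = c x * (V1 x + p * f1 (exp x) powr m)" "\<And>x. 0 < c x"
      "((\<lambda>x. exp (d * x) * f1 (exp x) powr m) \<longlongrightarrow> 1) at_top"
    show thesis by (rule that[unfolded V_def, OF *])
  qed
  note Vb = profile_ode_bounds[OF dV Vpos ode c p0 pd limV]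
  have V1neg: "V1 x \<le> 0" for x
  proof -
    have "0 \<le> p * V x" using p0 Vpos[of x] by simp
    with Vb(1)[of x] show ?thesis by simp
  qed
  define U where "U l t \<rho> = exp (p * (ln l - \<beta> * t)) * V (\<rho> + (ln l - \<beta> * t))" for l t \<rho>
  have Up: "self_similar_solution m \<alpha> \<beta> f1 l x t powr m = U l t (ln (norm x))" if "l > 0" "x \<noteq> 0"
    for l t and x :: "real^'n"
    using self_similar_solution_powr[OF fpos m1 that \<alpha>] by (simp add: U_def V_def p_def)
  have Uupper: "U l t \<rho> \<le> exp ((p - d) * ln l) * exp (- d * \<rho>)" if "0 \<le> t" for l t \<rho>
  proof -
    have "U l t \<rho> \<le> exp (p * (ln l - \<beta> * t)) * exp (- d * (\<rho> + (ln l - \<beta> * t)))"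
      unfolding U_def by (intro mult_left_mono Vb(4)) simp
    also have "\<dots> = exp ((p - d) * ln l + (p - d) * (- \<beta> * t) - d * \<rho>)"
      by (simp add: exp_add[symmetric] algebra_simps)
    \<comment> \<open>As p < d and \<beta> < 0, the time-dependent factor is at most 1, which makes
      the bound uniform in t \<ge> 0.\<close>
    also have "\<dots> \<le> exp ((p - d) * ln l - d * \<rho>)"
    proof -
      have "0 \<le> (p - d) * (\<beta> * t)"
        using pd \<beta> that by (intro mult_nonpos_nonpos mult_nonpos_nonneg) auto
      then show ?thesis by simp
    qed
    also have "\<dots> = exp ((p - d) * ln l) * exp (- d * \<rho>)" by (simp add: exp_add[symmetric])
    finally show ?thesis .
  qed
  \<comment> \<open>The value of the decreasing function exp (p x) V at ln l1 - \<beta> T, the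
    largest argument ln |x| + ln l1 - \<beta> t that occurs for |x| \<le> 1 and t \<le> T; hence one
    constant serves all these points.\<close>
  define \<kappa> where "\<kappa> = exp (p * (ln l1 - \<beta> * T)) * V (ln l1 - \<beta> * T)"
  have \<kappa>: "\<kappa> > 0" using Vpos by (simp add: \<kappa>_def)
  have Ulower: "\<kappa> * exp (- p * \<rho>) \<le> U l1 t \<rho>" if "t \<le> T" "\<rho> \<le> 0" for t \<rho>
  proof -
    have "\<beta> * T \<le> \<beta> * t" using \<beta> that by (intro mult_left_mono_neg) auto
    then have "\<rho> + (ln l1 - \<beta> * t) \<le> ln l1 - \<beta> * T" using that by simp
    from Vb(5)[OF this] have "\<kappa> \<le> exp (p * (\<rho> + (ln l1 - \<beta> * t))) * V (\<rho> + (ln l1 - \<beta> * t))"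
      by (simp add: \<kappa>_def)
    then have "\<kappa> * exp (- p * \<rho>) \<le> exp (p * (\<rho> + (ln l1 - \<beta> * t))) * V (\<rho> + (ln l1 - \<beta> * t)) * exp (- p * \<rho>)"
      by (rule mult_right_mono) simp
    also have "\<dots> = exp (p * (\<rho> + (ln l1 - \<beta> * t)) + - p * \<rho>) * V (\<rho> + (ln l1 - \<beta> * t))"
      unfolding exp_add by (simp only: mult_ac)
    also have "\<dots> = U l1 t \<rho>" by (simp add: U_def algebra_simps)
    finally show ?thesis .
  qed

  \<comment> \<open>The weight, a power of the translated profile \<open>Vt\<close>\<close>
  define Vt where "Vt \<rho> = exp (p * ln l3) * V (\<rho> + ln l3)" for \<rho>
  have dVt: "(Vt has_real_derivative exp (p * ln l3) * V1 (x + ln l3)) (at x)"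
    "((\<lambda>\<rho>. exp (p * ln l3) * V1 (\<rho> + ln l3)) has_real_derivative exp (p * ln l3) * V2 (x + ln l3)) (at x)" for x
    unfolding Vt_def using dV by (auto intro!: DERIV_cmult simp: DERIV_shift[symmetric])
  have Vtpos: "Vt x > 0" for x using Vpos by (simp add: Vt_def)
  obtain w1 w2 where w1: "\<And>x. ((\<lambda>x. Vt x powr \<gamma>\<^sub>2) has_real_derivative w1 x) (at x)"
    and w2: "\<And>x. (w1 has_real_derivative w2 x) (at x)"
    and cw2: "continuous_on UNIV w2" and wsup: "\<And>x. w2 x + d * w1 x \<le> 0"
    and wD: "\<And>x. \<bar>2 * w1 x + d * Vt x powr \<gamma>\<^sub>2\<bar> \<le> 3 * d * Vt x powr \<gamma>\<^sub>2"
    and wb: "\<And>x. Vt x powr \<gamma>\<^sub>2 \<le> exp ((p - d) * ln l3) powr \<gamma>\<^sub>2 * exp (- (d * \<gamma>\<^sub>2) * x)"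
  proof -
    have 1: "continuous_on UNIV (\<lambda>x. exp (p * ln l3) * V2 (x + ln l3))"
      by (intro continuous_intros continuous_on_compose2[OF cV2]) auto
    have 2: "exp (p * ln l3) * V2 (x + ln l3) + d * (exp (p * ln l3) * V1 (x + ln l3)) \<le> 0" for x
    proof -
      have "exp (p * ln l3) * (V2 (x + ln l3) + d * V1 (x + ln l3)) \<le> 0"
        by (intro mult_nonneg_nonpos Vb(2)) simp
      then show ?thesis by (simp add: algebra_simps)
    qed
    have 3: "- d * Vt x \<le> exp (p * ln l3) * V1 (x + ln l3)" for x
    proof -
      have "exp (p * ln l3) * (- d * V (x + ln l3)) \<le> exp (p * ln l3) * V1 (x + ln l3)"
        by (intro mult_left_mono Vb(3)) simp
      then show ?thesis by (simp add: Vt_def mult_ac)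
    qed
    have 4: "exp (p * ln l3) * V1 (x + ln l3) \<le> 0" for x by (intro mult_nonneg_nonpos V1neg) simp
    have 5: "Vt x \<le> exp ((p - d) * ln l3) * exp (- d * x)" for x
      using Uupper[of 0 l3 x] by (simp add: Vt_def U_def)
    show thesis
      by (rule weight_properties[OF dVt 1 Vtpos 2 3 4 5 exp_gt_zero \<gamma> d]) (rule that)
  qed
  define w where "w x = Vt x powr \<gamma>\<^sub>2" for x
  note wp = w1[folded w_def] w2 cw2 wsup wD[folded w_def] wb[folded w_def]
  have w0: "w x \<ge> 0" for x by (simp add: w_def)
  define W where "W x = scaled_profile m f1 l3 x powr (m * \<gamma>\<^sub>2)" for x :: "real^'n"
  have W: "W x = w (ln (norm x))" if "x \<noteq> 0" for x
    using Up[OF l(3) that, of 0] unfolding W_def scaled_profile_eq_self_similar_solution[of _ _ _ _ \<alpha> \<beta>]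
    by (simp add: powr_powr[symmetric] U_def w_def Vt_def)

  \<comment> \<open>The two solutions between the barriers\<close>
  have sol: "classical_solution m u1" "classical_solution m u2"
    and u0: "u01 \<in> L1_loc_punctured" "u02 \<in> L1_loc_punctured"
    and tr1: "\<And>K. compact K \<Longrightarrow> K \<subseteq> - {0} \<Longrightarrow>
        ((\<lambda>t. \<integral>\<^sup>+x\<in>K. ennreal \<bar>u1 x t - u01 x\<bar> \<partial>lebesgue) \<longlongrightarrow> 0) (at_right 0)"
    and tr2: "\<And>K. compact K \<Longrightarrow> K \<subseteq> - {0} \<Longrightarrow>
        ((\<lambda>t. \<integral>\<^sup>+x\<in>K. ennreal \<bar>u2 x t - u02 x\<bar> \<partial>lebesgue) \<longlongrightarrow> 0) (at_right 0)"
    using assms(14,15) unfolding cauchy_solution_def by blast+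
  have upos1: "u1 x t > 0" if "x \<noteq> 0" "t > 0" for x t using assms(14) that unfolding cauchy_solution_def by blast
  have upos2: "u2 x t > 0" if "x \<noteq> 0" "t > 0" for x t using assms(15) that unfolding cauchy_solution_def by blast
  have Upos: "self_similar_solution m \<alpha> \<beta> f1 l x t > 0" if "l > 0" "x \<noteq> 0" for l t and x :: "real^'n"
    using that fpos by (auto simp: self_similar_solution_def scaled_profile_def)
  have sandwich: "U l1 t (ln (norm x)) \<le> v powr m \<and> v powr m \<le> U l2 t (ln (norm x))"
    if "x \<noteq> 0" "t > 0" "self_similar_solution m \<alpha> \<beta> f1 l1 x t \<le> v" "v \<le> self_similar_solution m \<alpha> \<beta> f1 l2 x t"
    for x :: "real^'n" and t v
    using that m0 Upos[OF l(1) that(1), of t] unfolding Up[OF l(1) that(1), symmetric] Up[OF l(2) that(1), symmetric]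
    by (auto intro!: powr_mono2)
  have um: "U l1 t (ln (norm x)) \<le> u1 x t powr m" "u1 x t powr m \<le> U l2 t (ln (norm x))"
    "U l1 t (ln (norm x)) \<le> u2 x t powr m" "u2 x t powr m \<le> U l2 t (ln (norm x))" if "x \<noteq> 0" "t > 0" for x t
    using sandwich[OF that, of "u1 x t"] sandwich[OF that, of "u2 x t"] assms(16,17) that by auto
  obtain ut1 a11 a21 where S1:
    "\<And>x t. x \<noteq> 0 \<Longrightarrow> t > 0 \<Longrightarrow> (u1 x has_real_derivative ut1 (x, t)) (at t)"
    "\<And>x t b. x \<noteq> 0 \<Longrightarrow> t > 0 \<Longrightarrow> ((\<lambda>s. u1 (x + s *\<^sub>R b) t powr m) has_real_derivative a11 b (x, t)) (at 0)"
    "\<And>x t b. x \<noteq> 0 \<Longrightarrow> t > 0 \<Longrightarrow> ((\<lambda>s. a11 b (x + s *\<^sub>R b, t)) has_real_derivative a21 b (x, t)) (at 0)"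
    "continuous_on ((- {0}) \<times> {0<..}) ut1"
    "continuous_on ((- {0}) \<times> {0<..}) (\<lambda>z. u1 (fst z) (snd z))"
    "\<And>b. continuous_on ((- {0}) \<times> {0<..}) (a11 b)"
    "\<And>b. continuous_on ((- {0}) \<times> {0<..}) (a21 b)"
    "\<And>x t. x \<noteq> 0 \<Longrightarrow> t > 0 \<Longrightarrow> ut1 (x, t) = (real ?n - 1) / m * (\<Sum>b\<in>Basis. a21 b (x, t))"
    using classical_solution_powr[OF sol(1) upos1] by blast
  obtain ut2 a12 a22 where S2:
    "\<And>x t. x \<noteq> 0 \<Longrightarrow> t > 0 \<Longrightarrow> (u2 x has_real_derivative ut2 (x, t)) (at t)"
    "\<And>x t b. x \<noteq> 0 \<Longrightarrow> t > 0 \<Longrightarrow> ((\<lambda>s. u2 (x + s *\<^sub>R b) t powr m) has_real_derivative a12 b (x, t)) (at 0)"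
    "\<And>x t b. x \<noteq> 0 \<Longrightarrow> t > 0 \<Longrightarrow> ((\<lambda>s. a12 b (x + s *\<^sub>R b, t)) has_real_derivative a22 b (x, t)) (at 0)"
    "continuous_on ((- {0}) \<times> {0<..}) ut2"
    "continuous_on ((- {0}) \<times> {0<..}) (\<lambda>z. u2 (fst z) (snd z))"
    "\<And>b. continuous_on ((- {0}) \<times> {0<..}) (a12 b)"
    "\<And>b. continuous_on ((- {0}) \<times> {0<..}) (a22 b)"
    "\<And>x t. x \<noteq> 0 \<Longrightarrow> t > 0 \<Longrightarrow> ut2 (x, t) = (real ?n - 1) / m * (\<Sum>b\<in>Basis. a22 b (x, t))"
    using classical_solution_powr[OF sol(2) upos2] by blast

  \<comment> \<open>Pointwise bounds for the difference of the m-th powers\<close>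
  define cn where "cn = (real ?n - 1) / m"
  have cn: "cn > 0" using n3 m0 by (simp add: cn_def)
  define A0 where "A0 = m * \<kappa> powr ((m - 1) / m)"
  define A1 where "A1 = exp ((p - d) * ln l2)"
  have A: "A0 \<ge> 0" "A1 \<ge> 0" using m0 by (auto simp: A0_def A1_def)
  have near: "\<bar>u1 x t powr m - u2 x t powr m\<bar> \<le> A0 * (norm x)\<^sup>2 * \<bar>u1 x t - u2 x t\<bar>"
    if "x \<noteq> 0" "0 < t" "t \<le> T" "norm x \<le> 1" for x t
  proof -
    define L where "L = \<kappa> * exp (- p * ln (norm x))"
    have L: "L > 0" using \<kappa> by (simp add: L_def)
    have "L \<le> U l1 t (ln (norm x))" unfolding L_def using that by (intro Ulower) auto
    then have "\<bar>u1 x t powr m - u2 x t powr m\<bar> \<le> m * L powr ((m - 1) / m) * \<bar>u1 x t - u2 x t\<bar>"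
      using um[OF that(1,2)] upos1 upos2 that m0 m1 L by (intro powr_diff_le) auto
    \<comment> \<open>L is a multiple of r^(-p), and p (1 - m) / m = 2: this is the origin of the
      factor r^2.\<close>
    also have "L powr ((m - 1) / m) = \<kappa> powr ((m - 1) / m) * (norm x)\<^sup>2"
    proof -
      have "exp (- p * ln (norm x)) powr ((m - 1) / m) = exp (2 * ln (norm x))"
        using m0 m1 by (simp add: powr_def p_def field_simps)
      also have "\<dots> = (norm x)\<^sup>2" using that(1) by (simp add: exp_double)
      finally show ?thesis using \<kappa> by (simp add: L_def powr_mult)
    qed
    finally show ?thesis by (simp add: A0_def mult_ac)
  qed
  have far: "\<bar>u1 x t powr m - u2 x t powr m\<bar> \<le> A1 * exp (- d * ln (norm x))" if "x \<noteq> 0" "0 < t" for x t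
  proof -
    \<comment> \<open>Both powers lie between 0 and the same upper barrier, so their difference is
      no larger than that barrier.\<close>
    have "u1 x t powr m \<ge> 0" "u2 x t powr m \<ge> 0" by auto
    with um[OF that] Uupper[of t l2 "ln (norm x)"] that show ?thesis unfolding A1_def by linarith
  qed

  \<comment> \<open>Constants and the growth estimate on annuli\<close>
  define Cw where "Cw = exp ((p - d) * ln l3) powr \<gamma>\<^sub>2"
  define D where "D = 3 * d"
  have D0: "D \<ge> 0" using d by (simp add: D_def)
  define Nw where "Nw = d * \<gamma>\<^sub>2"
  have Nw: "Nw > 0" using d \<gamma> by (simp add: Nw_def)
  define M where "M = cn * A0 * (D + 4)"
  have M0: "M \<ge> 0" using cn A D0 by (simp add: M_def)
  define I1 where "I1 = (LINT x::real^'n|lborel. indicator {x. 1 \<le> norm x} x *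
            (exp (- (real ?n + Nw) * ln (norm x)) * (1 + (ln (norm x))\<^sup>2)))"
  define I2 where "I2 \<epsilon> = (LINT x::real^'n|lborel. exp (- (real ?n + Nw) * ln (norm x)) * (1 + (ln (norm x))\<^sup>2)
            * exp (- \<epsilon> * (1 + (ln (norm x))\<^sup>2)))" for \<epsilon>
  have I: "I1 \<ge> 0" "I2 \<epsilon> \<ge> 0" for \<epsilon>
    unfolding I1_def I2_def by (intro integral_nonneg_AE AE_I2; auto intro!: mult_nonneg_nonneg add_nonneg_nonneg)+
  define \<psi> where "\<psi> \<epsilon> k t = (radial (cutoff_weight w (\<epsilon> * exp (M * t)) k) :: real^'n \<Rightarrow> real)" for \<epsilon> k t
  define R where "R \<epsilon> k = cn * A1 * Cw * ((D + 4) * (\<epsilon> * exp (M * T)) * I1 + (6 * D + 42) / k * I2 \<epsilon>)" for \<epsilon> k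
  have R0: "R \<epsilon> k \<ge> 0" if "\<epsilon> > 0" "k \<ge> 1" for \<epsilon> k
    unfolding R_def using cn A D0 I that
    by (intro mult_nonneg_nonneg add_nonneg_nonneg divide_nonneg_nonneg) (auto simp: Cw_def)
  have d': "d = real DIM(real^'n) - 2" by (simp add: d_def)
  have grow: "(LINT x|lborel. indicator (annulus k) x * (\<bar>u1 x T - u2 x T\<bar> * \<psi> \<epsilon> k T x))
     \<le> (LINT x|lborel. indicator (annulus k) x * (\<bar>u1 x t1 - u2 x t1\<bar> * \<psi> \<epsilon> k t1 x)) + R \<epsilon> k * (T - t1)"
    if t1: "0 < t1" "t1 \<le> T" and \<epsilon>: "\<epsilon> > 0" "\<epsilon> * exp (M * T) \<le> 1" and k: "k \<ge> 1" for t1 \<epsilon> k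
  proof -
    have sub: "(- {0 :: real^'n}) \<times> {t1..T} \<subseteq> (- {0}) \<times> {0<..}" using t1 by auto
    have slice: "continuous_on (- {0}) (\<lambda>x. f (x, t))" if "continuous_on ((- {0}) \<times> {0<..}) f" "t \<in> {t1..T}"
      for f :: "(real^'n) \<times> real \<Rightarrow> real" and t
      by (rule continuous_on_compose2[OF that(1)]) (use that(2) t1 in \<open>auto intro!: continuous_intros\<close>)
    note cu = slice[OF S1(5)] slice[OF S2(5)]
    show ?thesis
      unfolding \<psi>_def R_def I1_def I2_def
    proof (rule weighted_l1_growth[where \<delta> = "\<lambda>x t. u1 x t - u2 x t"
          and \<delta>t = "\<lambda>x t. ut1 (x, t) - ut2 (x, t)" and a = "\<lambda>x t. u1 x t powr m - u2 x t powr m"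
          and ?a1.0 = "\<lambda>b x t. a11 b (x, t) - a12 b (x, t)" and ?a2.0 = "\<lambda>b x t. a21 b (x, t) - a22 b (x, t)"
          and ?w1.0 = w1 and ?w2.0 = w2 and w = w and cn = cn and ?A0.0 = A0 and ?A1.0 = A1 and D = D and M = M
          and \<epsilon> = \<epsilon> and k = k and T = T and ?t1.0 = t1 and Cw = Cw and Nw = Nw,
          folded d', unfolded DIM_cart DIM_real mult_1_right])
      fix x :: "real^'n" and t assume x: "x \<noteq> 0" and "t \<in> {t1..T}"
      then have t: "0 < t" "t \<le> T" using t1 by auto
      show "((\<lambda>t. u1 x t - u2 x t) has_real_derivative ut1 (x, t) - ut2 (x, t)) (at t)"
        by (intro DERIV_diff S1(1) S2(1) x t)
      show "((\<lambda>s. u1 (x + s *\<^sub>R b) t powr m - u2 (x + s *\<^sub>R b) t powr m) has_real_derivative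
          a11 b (x, t) - a12 b (x, t)) (at 0)" for b
        by (intro DERIV_diff S1(2) S2(2) x t)
      show "((\<lambda>s. a11 b (x + s *\<^sub>R b, t) - a12 b (x + s *\<^sub>R b, t)) has_real_derivative
          a21 b (x, t) - a22 b (x, t)) (at 0)" for b
        by (intro DERIV_diff S1(3) S2(3) x t)
      show "ut1 (x, t) - ut2 (x, t) = cn * (\<Sum>b\<in>Basis. a21 b (x, t) - a22 b (x, t))"
        using S1(8)[OF x t(1)] S2(8)[OF x t(1)] by (simp add: cn_def sum_subtractf right_diff_distrib)
      show "sgn (u1 x t powr m - u2 x t powr m) = sgn (u1 x t - u2 x t)"
        using powr_less_mono2[OF m0 less_imp_le[OF upos1[OF x t(1)]], of "u2 x t"]
          powr_less_mono2[OF m0 less_imp_le[OF upos2[OF x t(1)]], of "u1 x t"]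
        by (cases "u1 x t" "u2 x t" rule: linorder_cases) auto
      show "norm x \<le> 1 \<Longrightarrow> \<bar>u1 x t powr m - u2 x t powr m\<bar> \<le> A0 * (norm x)\<^sup>2 * \<bar>u1 x t - u2 x t\<bar>"
        by (rule near[OF x t])
      show "\<bar>u1 x t powr m - u2 x t powr m\<bar> \<le> A1 * exp (- d * ln (norm x))"
        by (rule far[OF x t(1)])
    next
      show "continuous_on ((- {0 :: real^'n}) \<times> {t1..T}) (\<lambda>z. u1 (fst z) (snd z) - u2 (fst z) (snd z))"
        by (intro continuous_intros continuous_on_subset[OF S1(5) sub] continuous_on_subset[OF S2(5) sub])
      show "continuous_on ((- {0 :: real^'n}) \<times> {t1..T}) (\<lambda>z. ut1 (fst z, snd z) - ut2 (fst z, snd z))"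
        using continuous_on_subset[OF S1(4) sub] continuous_on_subset[OF S2(4) sub] by (simp add: continuous_on_diff)
      fix t assume tt: "t \<in> {t1..T}"
      have pos: "u1 x t \<noteq> 0" "u2 x t \<noteq> 0" if "x \<in> - {0}" for x
        using upos1[of x t] upos2[of x t] that tt t1 by auto
      show "continuous_on (- {0 :: real^'n}) (\<lambda>x. u1 x t powr m - u2 x t powr m)"
        using cu[OF tt] pos by (intro continuous_intros) auto
      show "continuous_on (- {0}) (\<lambda>x. a11 b (x, t) - a12 b (x, t))"
        "continuous_on (- {0}) (\<lambda>x. a21 b (x, t) - a22 b (x, t))" for b
        by (intro continuous_intros slice[OF S1(6) tt] slice[OF S2(6) tt] slice[OF S1(7) tt] slice[OF S2(7) tt])+
    qed (use t1 \<epsilon> k wp w0 cn A D0 Nw in \<open>auto simp: D_def Cw_def Nw_def M_def\<close>)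
  qed

  \<comment> \<open>Comparison of time T with the initial data on annuli\<close>
  let ?X = "\<integral>\<^sup>+x\<in>- {0}. ennreal (\<bar>u01 x - u02 x\<bar> * W x) \<partial>lebesgue"
  have cw: "continuous_on UNIV w" using wp(1) by (auto intro!: continuous_at_imp_continuous_on DERIV_isCont)
  have cbump: "continuous_on UNIV bump" using DERIV_bump by (auto intro!: continuous_at_imp_continuous_on DERIV_isCont)
  have cW: "continuous_on (- {0}) W"
  proof -
    have "continuous_on (- {0 :: real^'n}) (radial w)" by (rule continuous_on_radial[OF cw]) simp
    then show ?thesis by (rule continuous_on_eq) (auto simp: radial_def W)
  qed
  have cu: "continuous_on (annulus k) (\<lambda>x. u1 x t)" "continuous_on (annulus k) (\<lambda>x. u2 x t)" if "t > 0" for k t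
  proof -
    have sub: "(\<lambda>x. (x, t)) ` annulus k \<subseteq> (- {0 :: real^'n}) \<times> {0<..}"
      using annulus_subset_punctured[of k, where 'a = "real^'n"] that by auto
    have pc: "continuous_on (annulus k) (\<lambda>x::real^'n. (x, t))" by (intro continuous_intros)
    from continuous_on_compose2[OF S1(5) pc sub] continuous_on_compose2[OF S2(5) pc sub]
    show "continuous_on (annulus k) (\<lambda>x. u1 x t)" "continuous_on (annulus k) (\<lambda>x. u2 x t)" by simp_all
  qed
  have c\<psi>: "continuous_on (annulus k) (\<psi> \<epsilon> k t)" if "k \<ge> 1" for \<epsilon> k t
  proof -
    have "continuous_on UNIV (cutoff_weight w (\<epsilon> * exp (M * t)) k)"
      unfolding cutoff_weight_def[abs_def] using that
      by (intro continuous_intros continuous_on_compose2[OF cw] continuous_on_compose2[OF cbump]) auto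
    then show ?thesis unfolding \<psi>_def by (rule continuous_on_radial) (use annulus_subset_punctured in blast)
  qed
  have \<psi>b: "0 \<le> \<psi> \<epsilon> k t x \<and> \<psi> \<epsilon> k t x \<le> W x" if "x \<noteq> 0" "\<epsilon> > 0" for \<epsilon> k t x
  proof -
    define y where "y = exp (- (\<epsilon> * exp (M * t)) * (1 + (ln (norm x))\<^sup>2)) * bump (ln (norm x) / k)"
    have "0 \<le> \<epsilon> * exp (M * t) * (1 + (ln (norm x))\<^sup>2)" using that by (intro mult_nonneg_nonneg) auto
    then have "y \<le> 1 * 1" unfolding y_def using bump_bounds by (intro mult_mono) auto
    moreover have "0 \<le> y" unfolding y_def using bump_bounds by (intro mult_nonneg_nonneg) auto
    ultimately have "0 \<le> w (ln (norm x)) * y" "w (ln (norm x)) * y \<le> w (ln (norm x)) * 1"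
      using mult_left_mono[OF _ w0, of y 1 "ln (norm x)"] w0 by simp_all
    then show ?thesis using that by (simp add: \<psi>_def radial_def cutoff_weight_def y_def W)
  qed
  define F where "F \<epsilon> k x = indicator (annulus k) x * (\<bar>u1 x T - u2 x T\<bar> * \<psi> \<epsilon> k T x)" for \<epsilon> k x
  have Fint: "integrable lborel (F \<epsilon> k)" if "k \<ge> 1" for \<epsilon> k
    unfolding F_def using T that
    by (intro integrable_indicator_continuous compact_annulus continuous_intros cu c\<psi>)
  have F0: "F \<epsilon> k x \<ge> 0" if "\<epsilon> > 0" for \<epsilon> k x
  proof (cases "x \<in> annulus k")
    case True
    then have "x \<noteq> 0" using annulus_subset_punctured[of k, where 'a = "real^'n"] by auto
    from \<psi>b[OF this that, of k T] show ?thesis by (simp add: F_def)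
  qed (simp add: F_def)
  have Fle: "ennreal (integral\<^sup>L lborel (F \<epsilon> k)) \<le> ?X + ennreal (R \<epsilon> k * T)"
    if "\<epsilon> > 0" "\<epsilon> * exp (M * T) \<le> 1" "k \<ge> 1" for \<epsilon> k
    unfolding F_def
  proof (rule growth_from_initial_trace[OF compact_annulus annulus_subset_punctured T R0 _ u0 cu])
    show "continuous_on (annulus k) W" by (rule continuous_on_subset[OF cW annulus_subset_punctured])
    show "0 \<le> \<psi> \<epsilon> k t x \<and> \<psi> \<epsilon> k t x \<le> W x" if "x \<in> annulus k" for x t
      using \<psi>b[of x \<epsilon> k t] that \<open>\<epsilon> > 0\<close> annulus_subset_punctured[of k, where 'a = "real^'n"] by auto
  qed (use that grow c\<psi> tr1[OF compact_annulus annulus_subset_punctured] tr2[OF compact_annulus annulus_subset_punctured] in auto)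

  \<comment> \<open>Joint choice of \<epsilon> and k, and passage to the limit\<close>
  define e where "e j = 1 / real (Suc j)" for j
  have e: "e j > 0" "e j \<le> 1" for j by (auto simp: e_def)
  have e0: "e \<longlonglongrightarrow> 0" unfolding e_def using LIMSEQ_inverse_real_of_nat by (simp add: inverse_eq_divide)
  \<comment> \<open>Normalised so that the Gaussian coefficient at time T, its largest value on
    [0, T], is \<open>e j\<close> and thus at most 1, as the growth estimate requires.\<close>
  define \<epsilon> where "\<epsilon> j = e j * exp (- (M * T))" for j
  have \<epsilon>: "\<epsilon> j > 0" "\<epsilon> j * exp (M * T) = e j" for j
    using e by (auto simp: \<epsilon>_def exp_minus)
  \<comment> \<open>\<open>I2\<close> is unbounded as \<epsilon> tends to 0, because r^(-N) is not
    integrable at the origin. Letting k grow in proportion to it makes I2 / k at most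
    \<open>e j\<close>, so the two limits, first in k and then in \<epsilon>, are taken along one
    sequence. The summand 1 forces k to infinity in any case.\<close>
  define k where "k j = real (Suc j) * (1 + I2 (\<epsilon> j))" for j
  have k: "k j \<ge> real (Suc j)" for j using mult_left_mono[of 1 "1 + I2 (\<epsilon> j)" "real (Suc j)"] I by (simp add: k_def)
  have k1: "k j \<ge> 1" for j using k[of j] by simp
  define C where "C = cn * A1 * Cw * ((D + 4) * I1 + (6 * D + 42)) * T"
  have "ennreal (R (\<epsilon> j) (k j) * T) \<le> ennreal (C * e j)" for j
  proof (rule ennreal_leI)
    have "I2 (\<epsilon> j) / k j \<le> e j"
    proof -
      have "I2 (\<epsilon> j) \<le> e j * k j" using I(2)[of "\<epsilon> j"] by (simp add: k_def e_def)
      then show ?thesis using k1[of j] by (simp add: divide_le_eq)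
    qed
    then have "(6 * D + 42) * (I2 (\<epsilon> j) / k j) \<le> (6 * D + 42) * e j" using D0 by (intro mult_left_mono) auto
    then have "(D + 4) * e j * I1 + (6 * D + 42) / k j * I2 (\<epsilon> j) \<le> ((D + 4) * I1 + (6 * D + 42)) * e j"
      unfolding distrib_right[of "(D + 4) * I1"] by (simp add: mult.commute mult.left_commute)
    then have "cn * A1 * Cw * ((D + 4) * e j * I1 + (6 * D + 42) / k j * I2 (\<epsilon> j)) * T
        \<le> cn * A1 * Cw * (((D + 4) * I1 + (6 * D + 42)) * e j) * T"
      using cn A T by (intro mult_right_mono mult_left_mono) (auto simp: Cw_def)
    then show "R (\<epsilon> j) (k j) * T \<le> C * e j" by (simp add: R_def \<epsilon> C_def mult_ac)
  qed
  then have le: "ennreal (integral\<^sup>L lborel (F (\<epsilon> j) (k j))) \<le> ?X + ennreal (C * e j)" for j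
    using Fle[OF \<epsilon>(1) _ k1, of j j] e(2)[of j] unfolding \<epsilon>(2) by (meson add_left_mono order_trans)
  have Ce: "(\<lambda>j. C * e j) \<longlonglongrightarrow> 0" using tendsto_mult[OF tendsto_const e0, of C] by simp
  have lim: "(\<lambda>j. F (\<epsilon> j) (k j) x) \<longlonglongrightarrow> \<bar>u1 x T - u2 x T\<bar> * W x" if x: "x \<noteq> 0" for x
  proof -
    define \<rho> where "\<rho> = ln (norm x)"
    have kinf: "filterlim k at_top sequentially"
      by (rule filterlim_at_top_mono[OF filterlim_compose[OF filterlim_real_sequentially filterlim_Suc]])
        (use k in auto)
    have "(\<lambda>j. bump (\<rho> / k j)) \<longlonglongrightarrow> bump 0"
    proof (rule isCont_tendsto_compose[OF DERIV_isCont[OF DERIV_bump]])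
      show "(\<lambda>j. \<rho> / k j) \<longlonglongrightarrow> 0" by (rule tendsto_divide_0[OF tendsto_const filterlim_at_top_imp_at_infinity[OF kinf]])
    qed
    then have "(\<lambda>j. \<bar>u1 x T - u2 x T\<bar> * (w \<rho> * (exp (- e j * (1 + \<rho>\<^sup>2)) * bump (\<rho> / k j))))
       \<longlonglongrightarrow> \<bar>u1 x T - u2 x T\<bar> * (w \<rho> * (exp (- 0 * (1 + \<rho>\<^sup>2)) * bump 0))"
      by (intro tendsto_intros e0)
    then have main: "(\<lambda>j. \<bar>u1 x T - u2 x T\<bar> * (w \<rho> * (exp (- e j * (1 + \<rho>\<^sup>2)) * bump (\<rho> / k j))))
       \<longlonglongrightarrow> \<bar>u1 x T - u2 x T\<bar> * W x"
      using x by (simp add: W \<rho>_def bump_def)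
    have "eventually (\<lambda>j. \<bar>\<rho>\<bar> \<le> k j) sequentially"
      using kinf by (auto simp: filterlim_at_top)
    then have "eventually (\<lambda>j. \<bar>u1 x T - u2 x T\<bar> * (w \<rho> * (exp (- e j * (1 + \<rho>\<^sup>2)) * bump (\<rho> / k j))) = F (\<epsilon> j) (k j) x) sequentially"
    proof eventually_elim
      case (elim j)
      then have "x \<in> annulus (k j)" using x by (simp add: mem_annulus_iff \<rho>_def)
      then show ?case using x by (simp add: F_def \<psi>_def radial_def cutoff_weight_def \<epsilon> \<rho>_def)
    qed
    from Lim_transform_eventually[OF main this] show ?thesis .
  qed
  have "(\<integral>\<^sup>+x\<in>- {0}. ennreal (\<bar>u1 x T - u2 x T\<bar> * W x) \<partial>lebesgue) \<le> ?X"
    by (rule nn_integral_le_of_cutoffs[OF Fint[OF k1] F0[OF \<epsilon>(1)] lim le Ce])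
  then show "(\<integral>\<^sup>+x\<in>- {0}. ennreal (\<bar>u1 x T - u2 x T\<bar> * scaled_profile m f1 l3 x powr (m * \<gamma>\<^sub>2)) \<partial>lebesgue)
      \<le> (\<integral>\<^sup>+x\<in>- {0}. ennreal (\<bar>u01 x - u02 x\<bar> * scaled_profile m f1 l3 x powr (m * \<gamma>\<^sub>2)) \<partial>lebesgue)"
    by (simp only: W_def)
qed

end
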